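(* Let $\mathfrak g=\mathfrak{gl}(1|1)$ over $\mathbb C$ and $\widehat{\mathfrak g}_-=t^{-1}\mathfrak g[t^{-1}]$. The algebra $\mathrm S(\widehat{\mathfrak g}_-)^{\mathfrak g[t]}$ of $\mathfrak g[t]$-invariants of the symmetric algebra $\mathrm S(\widehat{\mathfrak g}_-)$ is isomorphic to the algebra $\Lambda^{\mathrm{aff}}(1|1)$ of affine supersymmetric polynomials.
   Context: The Lie superalgebra $\mathfrak g=\mathfrak{gl}(1|1)$ has basis $E_{ij}$, $i,j\in\{1,2\}$; with $\bar 1=0$, $\bar 2=1$, the element $E_{ij}$ has parity $\bar\imath+\bar\jmath$ mod 2. Write $E_{ij}[r]=E_{ij}t^r$; in $\mathfrak g[t,t^{-1}]$, $$[E_{ij}[r],E_{kl}[s]]=\delta_{kj}E_{il}[r+s]-\delta_{il}E_{kj}[r+s](-1)^{(\bar\imath+\bar\jmath)(\bar k+\bar l)}.$$ The space $\widehat{\mathfrak g}_-=t^{-1}\mathfrak g[t^{-1}]$ is identified with the quotient $\mathfrak g[t,t^{-1}]/\mathfrak g[t]$ and thus is a $\mathfrak g[t]$-module under the adjoint action (so $E_{ij}[r]$ with $r\ge0$ acts on $E_{kl}[s]$ with $s<0$ by the bracket above, where all terms with $r+s\geqslant0$ are set to zero). The action is extended to the (super)symmetric algebra $\mathrm S(\widehat{\mathfrak g}_-)$ (even generators commute with everything, odd generators anticommute with each other) by superderivations, and $$\mathrm S(\widehat{\mathfrak g}_-)^{\mathfrak g[t]}=\{P\in\mathrm S(\widehat{\mathfrak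 g}_-)\mid \mathfrak g[t]\,P=0\}.$$ Supersymmetric polynomials: $\Lambda(1|1)$ is the algebra of polynomials $P(u,v)\in\mathbb C[u,v]$ such that the result of the substitution $u=t$, $v=-t$ is independent of $t$. For $P\in\Lambda(1|1)$, substitute $u\mapsto u(z)=\sum_{r\geqslant0}u_rz^r$ and $v\mapsto v(z)=\sum_{r\geqslant0}v_rz^r$, where $u_r,v_r$ ($r\geqslant0$) are independent commuting variables, and write $P(u(z),v(z))=\sum_{r\geqslant0}P_rz^r$ with $P_r\in\mathbb C[u_s,v_s\mid s\geqslant0]$. The algebra $\Lambda^{\mathrm{aff}}(1|1)$ of affine supersymmetric polynomials is the subalgebra of $\mathbb C[u_s,v_s\mid s\geqslant0]$ generated by all coefficients $P_r$, $r\geqslant 0$, for all $P\in\Lambda(1|1)$. *)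

theory Defs
  imports
    Complex_Main
    "HOL-Library.Poly_Mapping"
    "HOL-Computational_Algebra.Polynomial"
    "HOL-Computational_Algebra.Formal_Power_Series"
begin

section \<open>Complex monoid algebras\<close>

text \<open>
  For a monoid \<open>M\<close>, written additively, \<open>M \<Rightarrow>\<^sub>0 complex\<close> with the convolution product is the
  monoid algebra of \<open>M\<close> over the complex numbers. With \<open>M = 'x \<Rightarrow>\<^sub>0 nat\<close> it is the polynomial
  algebra in the variables \<open>'x\<close>, with \<open>M = 'x word\<close> it is the free associative algebra on \<open>'x\<close>.
\<close>

definition smul :: "complex \<Rightarrow> ('m::monoid_add \<Rightarrow>\<^sub>0 complex) \<Rightarrow> 'm \<Rightarrow>\<^sub>0 complex" where
  "smul c p = Poly_Mapping.single 0 c * p"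

definition lin_ext :: "('a \<Rightarrow> ('m::monoid_add \<Rightarrow>\<^sub>0 complex)) \<Rightarrow> ('a \<Rightarrow>\<^sub>0 complex) \<Rightarrow> 'm \<Rightarrow>\<^sub>0 complex" where
  "lin_ext f p = (\<Sum>a\<in>Poly_Mapping.keys p. smul (Poly_Mapping.lookup p a) (f a))"

lemma smul_lookup: "Poly_Mapping.lookup (smul c p) k = c * Poly_Mapping.lookup p k"
  unfolding smul_def mult_map_scale_conv_mult[symmetric]
  by (simp add: Poly_Mapping.map.rep_eq when_def)

lemma smul_add: "smul c (p + q) = smul c p + smul c q"
  by (simp add: smul_def distrib_left)

lemma smul_minus: "smul c (p - q) = smul c p - smul c q"
  by (simp add: smul_def right_diff_distrib)

lemma smul_left_add: "smul (c + d) p = smul c p + smul d p"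
  by (simp add: smul_def single_add distrib_right)

lemma smul_smul: "smul c (smul d p) = smul (c * d) p"
  by (rule poly_mapping_eqI) (simp add: smul_lookup)

lemma smul_zero [simp]: "smul 0 p = 0" "smul c 0 = 0"
  by (simp_all add: smul_def)

lemma smul_one [simp]: "smul 1 p = p"
  by (simp add: smul_def)

lemma smul_neg1: "smul (- 1) p = - p"
  by (rule poly_mapping_eqI) (simp add: smul_lookup)

lemma smul_uminus: "smul (- c) p = - smul c p"
  by (rule poly_mapping_eqI) (simp add: smul_lookup)

lemma smul_mult_left: "smul c p * q = smul c (p * q)"
  by (simp add: smul_def mult.assoc)

lemma smul_sum: "smul c (sum f A) = (\<Sum>a\<in>A. smul c (f a))"
  by (simp add: smul_def sum_distrib_left)

lemma lin_ext_superset: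
  assumes "finite A" "Poly_Mapping.keys p \<subseteq> A"
  shows "lin_ext f p = (\<Sum>a\<in>A. smul (Poly_Mapping.lookup p a) (f a))"
  unfolding lin_ext_def using assms
  by (intro sum.mono_neutral_left) (auto simp: in_keys_iff)

lemma lin_ext_single [simp]: "lin_ext f (Poly_Mapping.single a c) = smul c (f a)"
  by (subst lin_ext_superset[where A = "{a}"]) auto

lemma lin_ext_zero [simp]: "lin_ext f 0 = 0"
  by (simp add: lin_ext_def)

lemma lin_ext_add: "lin_ext f (p + q) = lin_ext f p + lin_ext f q"
  by (subst (1 2 3) lin_ext_superset[where A = "Poly_Mapping.keys p \<union> Poly_Mapping.keys q"])
     (auto simp: keys_add lookup_add smul_left_add sum.distrib dest: subsetD[OF keys_add])

lemma lin_ext_smul: "lin_ext f (smul c p) = smul c (lin_ext f p)"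
  by (subst (1 2) lin_ext_superset[where A = "Poly_Mapping.keys p"])
     (auto simp: in_keys_iff smul_lookup smul_smul smul_sum)

lemma lin_ext_minus: "lin_ext f (p - q) = lin_ext f p - lin_ext f q"
proof -
  have "lin_ext f (p - q) + lin_ext f q = lin_ext f p"
    by (simp add: lin_ext_add[symmetric])
  then show ?thesis by (simp add: algebra_simps)
qed

lemma poly_mapping_lin_induct [case_names zero single add]:
  fixes p :: "'a \<Rightarrow>\<^sub>0 complex"
  assumes "P 0" "\<And>a c. P (Poly_Mapping.single a c)" "\<And>p q. P p \<Longrightarrow> P q \<Longrightarrow> P (p + q)"
  shows "P p"
proof (induction p rule: update_induct)
  case const
  then show ?case by (rule assms(1))
next
  case (update f a b)
  have "Poly_Mapping.update a b f = f + Poly_Mapping.single a b"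
    using update(1)
    by (intro poly_mapping_eqI) (auto simp: lookup_update lookup_add lookup_single when_def in_keys_iff)
  then show ?case using assms(2,3) update.IH by simp
qed

text \<open>
  \<open>is_algebra_iso sA A sB B f\<close>: \<open>f\<close> is an isomorphism of unital complex algebras from the subalgebra
  \<open>A\<close> to the subalgebra \<open>B\<close>; \<open>sA\<close> and \<open>sB\<close> are the scalar multiplications.
\<close>

definition is_algebra_iso ::
  "(complex \<Rightarrow> 'a::ring_1 \<Rightarrow> 'a) \<Rightarrow> 'a set \<Rightarrow> (complex \<Rightarrow> 'b::ring_1 \<Rightarrow> 'b) \<Rightarrow> 'b set \<Rightarrow> ('a \<Rightarrow> 'b) \<Rightarrow> bool"
where
  "is_algebra_iso sA A sB B f \<longleftrightarrow>
     bij_betw f A B \<and> f 1 = 1 \<and>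
     (\<forall>x\<in>A. \<forall>y\<in>A. f (x + y) = f x + f y) \<and>
     (\<forall>x\<in>A. \<forall>y\<in>A. f (x * y) = f x * f y) \<and>
     (\<forall>c. \<forall>x\<in>A. f (sA c x) = sB c (f x))"


section \<open>The free associative algebra\<close>

datatype 'a word = Word (letters: "'a list")

instantiation word :: (type) monoid_add
begin

definition zero_word :: "'a word" where "zero_word = Word []"

definition plus_word :: "'a word \<Rightarrow> 'a word \<Rightarrow> 'a word" where
  "plus_word v w = Word (letters v @ letters w)"

instance
  by standard (simp_all add: zero_word_def plus_word_def)

end

type_synonym 'a free_alg = "'a word \<Rightarrow>\<^sub>0 complex"

definition fmon :: "'a list \<Rightarrow> 'a free_alg" where
  "fmon w = Poly_Mapping.single (Word w) 1"

lemma fmon_mult: "fmon v * fmon w = fmon (v @ w)"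
  by (simp add: fmon_def mult_single plus_word_def)

lemma fmon_Nil: "fmon [] = 1"
  by (simp add: fmon_def single_one[symmetric] zero_word_def del: single_one)

lemma single_word: "Poly_Mapping.single w c = smul c (fmon (letters w))"
  by (simp add: smul_def fmon_def mult_single plus_word_def zero_word_def)

lemma free_alg_induct [case_names zero smul add]:
  fixes p :: "'a free_alg"
  assumes "P 0" "\<And>w c. P (smul c (fmon w))" "\<And>p q. P p \<Longrightarrow> P q \<Longrightarrow> P (p + q)"
  shows "P p"
  by (induction p rule: poly_mapping_lin_induct) (auto simp: single_word assms)

lemma smul_mult_right: "p * smul c q = smul c (p * q)" for p q :: "'a free_alg"
proof -
  have comm: "p * Poly_Mapping.single 0 c = Poly_Mapping.single 0 c * p"
    by (induction p rule: poly_mapping_lin_induct) (simp_all add: mult_single algebra_simps)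
  then show ?thesis by (metis mult.assoc smul_def)
qed


section \<open>The loop superalgebra of \<open>gl(1|1)\<close>\<close>

datatype idx = I1 | I2

primrec par :: "idx \<Rightarrow> nat" where
  "par I1 = 0"
| "par I2 = 1"

text \<open>
  \<open>g[t, t\<^sup>-\<^sup>1]\<close> has the basis \<open>E\<^sub>i\<^sub>j[r]\<close>, encoded as \<open>(i, j, r)\<close>. Parities only occur as exponents of
  \<open>- 1\<close>, so they are not reduced modulo 2.
\<close>

type_synonym loop = "(idx \<times> idx \<times> int) \<Rightarrow>\<^sub>0 complex"

fun bracket :: "idx \<times> idx \<times> int \<Rightarrow> idx \<times> idx \<times> int \<Rightarrow> loop" where
  "bracket (i, j, r) (k, l, s) =
     (if k = j then Poly_Mapping.single (i, l, r + s) 1 else 0) -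
     (if i = l then Poly_Mapping.single (k, j, r + s) ((- 1) ^ ((par i + par j) * (par k + par l))) else 0)"

text \<open>The generator \<open>(k, l, n)\<close> of the symmetric algebra stands for \<open>E\<^sub>k\<^sub>l[-n-1]\<close>.\<close>

type_synonym gen = "idx \<times> idx \<times> nat"

fun gpar :: "gen \<Rightarrow> nat" where
  "gpar (k, l, n) = par k + par l"

text \<open>
  The projection \<open>g[t, t\<^sup>-\<^sup>1] \<rightarrow> g[t, t\<^sup>-\<^sup>1] / g[t] = t\<^sup>-\<^sup>1 g[t\<^sup>-\<^sup>1]\<close>, followed by the inclusion of the
  latter into the tensor algebra.
\<close>

fun neg_basis :: "idx \<times> idx \<times> int \<Rightarrow> gen free_alg" where
  "neg_basis (k, l, s) = (if s < 0 then fmon [(k, l, nat (- s - 1))] else 0)"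

definition neg_part :: "loop \<Rightarrow> gen free_alg" where
  "neg_part = lin_ext neg_basis"

text \<open>
  Basis elements of \<open>g[t]\<close> are encoded as \<open>(i, j, r)\<close> with \<open>r :: nat\<close>, for \<open>E\<^sub>i\<^sub>j[r]\<close>.
\<close>

type_synonym pos = "idx \<times> idx \<times> nat"

fun ppar :: "pos \<Rightarrow> nat" where
  "ppar (i, j, r) = par i + par j"

fun ad_gen :: "pos \<Rightarrow> gen \<Rightarrow> gen free_alg" where
  "ad_gen (i, j, r) (k, l, n) = neg_part (bracket (i, j, int r) (k, l, - int n - 1))"

primrec der_word :: "pos \<Rightarrow> gen list \<Rightarrow> gen free_alg" where
  "der_word e [] = 0"
| "der_word e (x # w) = ad_gen e x * fmon w + smul ((- 1) ^ (ppar e * gpar x)) (fmon [x] * der_word e w)"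

definition der :: "pos \<Rightarrow> gen free_alg \<Rightarrow> gen free_alg" where
  "der e = lin_ext (\<lambda>w. der_word e (letters w))"


section \<open>The symmetric algebra of \<open>t\<^sup>-\<^sup>1 g[t\<^sup>-\<^sup>1]\<close>\<close>

definition scomm :: "gen \<Rightarrow> gen \<Rightarrow> gen free_alg" where
  "scomm x y = fmon [x, y] - smul ((- 1) ^ (gpar x * gpar y)) (fmon [y, x])"

inductive_set super_ideal :: "gen free_alg set" where
  zero: "0 \<in> super_ideal"
| rel: "a * scomm x y * b \<in> super_ideal"
| add: "p \<in> super_ideal \<Longrightarrow> q \<in> super_ideal \<Longrightarrow> p + q \<in> super_ideal"

lemma super_ideal_mult_left: "p \<in> super_ideal \<Longrightarrow> a * p \<in> super_ideal"
  by (induction p rule: super_ideal.induct)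
     (auto simp: distrib_left mult.assoc[symmetric] intro: super_ideal.intros)

lemma super_ideal_mult_right: "p \<in> super_ideal \<Longrightarrow> p * a \<in> super_ideal"
  by (induction p rule: super_ideal.induct)
     (auto simp: distrib_right mult.assoc super_ideal.zero super_ideal.add
           intro: super_ideal.rel[unfolded mult.assoc])

lemma super_ideal_smul: "p \<in> super_ideal \<Longrightarrow> smul c p \<in> super_ideal"
  by (simp add: smul_def super_ideal_mult_left)

lemma super_ideal_uminus: "p \<in> super_ideal \<Longrightarrow> - p \<in> super_ideal"
  using super_ideal_smul[of p "- 1"] by (simp add: smul_neg1)

lemma super_ideal_diff: "p \<in> super_ideal \<Longrightarrow> q \<in> super_ideal \<Longrightarrow> p - q \<in> super_ideal"
  using super_ideal.add[of p "- q"] super_ideal_uminus[of q] by simp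

lemma super_ideal_scomm: "scomm x y \<in> super_ideal"
  using super_ideal.rel[of 1 x y 1] by simp

lemma lookup_mult_empty:
  "Poly_Mapping.lookup (p * q) (Word []) = Poly_Mapping.lookup p (Word []) * Poly_Mapping.lookup q (Word [])"
  for p q :: "'a free_alg"
proof (induction p rule: free_alg_induct)
  case (smul w c)
  show ?case
  proof (induction q rule: free_alg_induct)
    case (smul w' c')
    show ?case
      by (simp add: smul_mult_left smul_mult_right fmon_mult smul_lookup)
         (simp add: fmon_def lookup_single when_def)
  qed (simp_all add: distrib_left lookup_add)
qed (simp_all add: distrib_right lookup_add)

lemma one_notin_super_ideal: "1 \<notin> super_ideal"
proof
  have "Poly_Mapping.lookup p (Word []) = 0" if "p \<in> super_ideal" for p
    using that
    by induction
      (simp_all add: lookup_mult_empty lookup_add scomm_def lookup_minus smul_lookup,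
       simp add: fmon_def lookup_single)
  moreover assume "1 \<in> super_ideal"
  ultimately show False
    by (metis lookup_one_zero zero_neq_one zero_word_def)
qed

definition super_rel :: "gen free_alg \<Rightarrow> gen free_alg \<Rightarrow> bool" where
  "super_rel p q \<longleftrightarrow> p - q \<in> super_ideal"

quotient_type super_sym = "gen free_alg" / super_rel
proof (rule equivpI)
  show "reflp super_rel"
    by (simp add: reflp_def super_rel_def super_ideal.zero)
  show "symp super_rel"
    using super_ideal_uminus by (fastforce simp: symp_def super_rel_def)
  show "transp super_rel"
  proof (rule transpI)
    fix x y z assume "super_rel x y" "super_rel y z"
    then have "(x - y) + (y - z) \<in> super_ideal"
      unfolding super_rel_def by (rule super_ideal.add)
    then show "super_rel x z" by (simp add: super_rel_def)
  qed
qed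

instantiation super_sym :: ring_1
begin

lift_definition zero_super_sym :: super_sym is 0 .

lift_definition one_super_sym :: super_sym is 1 .

lift_definition plus_super_sym :: "super_sym \<Rightarrow> super_sym \<Rightarrow> super_sym" is plus
  unfolding super_rel_def by (metis add_diff_add super_ideal.add)

lift_definition uminus_super_sym :: "super_sym \<Rightarrow> super_sym" is uminus
  unfolding super_rel_def using super_ideal_uminus by fastforce

lift_definition minus_super_sym :: "super_sym \<Rightarrow> super_sym \<Rightarrow> super_sym" is minus
proof -
  fix a b c d :: "gen free_alg"
  assume "super_rel a b" "super_rel c d"
  then have "(a - b) - (c - d) \<in> super_ideal"
    unfolding super_rel_def by (rule super_ideal_diff)
  then show "super_rel (a - c) (b - d)" by (simp add: super_rel_def algebra_simps)
qed

lift_definition times_super_sym :: "super_sym \<Rightarrow> super_sym \<Rightarrow> super_sym" is times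
proof -
  fix a b c d :: "gen free_alg"
  assume "super_rel a b" "super_rel c d"
  then have "(a - b) * c + b * (c - d) \<in> super_ideal"
    unfolding super_rel_def
    by (intro super_ideal.add super_ideal_mult_left super_ideal_mult_right)
  then show "super_rel (a * c) (b * d)" by (simp add: super_rel_def algebra_simps)
qed

instance
proof
  show "(0::super_sym) \<noteq> 1"
    by transfer (use one_notin_super_ideal super_ideal_uminus[of "- 1"] in
        \<open>auto simp: super_rel_def\<close>)
qed (transfer, simp add: super_rel_def super_ideal.zero algebra_simps)+

end

lift_definition super_smul :: "complex \<Rightarrow> super_sym \<Rightarrow> super_sym" is smul
  unfolding super_rel_def by (metis smul_minus super_ideal_smul)

lift_definition super_gen :: "gen \<Rightarrow> super_sym" is "\<lambda>x. fmon [x]" .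

lemma super_gen_commute:
  "super_gen x * super_gen y = super_smul ((- 1) ^ (gpar x * gpar y)) (super_gen y * super_gen x)"
  by transfer (use super_ideal_scomm in \<open>simp add: super_rel_def fmon_mult scomm_def\<close>)


subsection \<open>The action of \<open>g[t]\<close>\<close>

definition wpar :: "gen list \<Rightarrow> nat" where
  "wpar w = sum_list (map gpar w)"

definition twist :: "nat \<Rightarrow> gen free_alg \<Rightarrow> gen free_alg" where
  "twist m = lin_ext (\<lambda>w. smul ((- 1) ^ (m * wpar (letters w))) (fmon (letters w)))"

lemma wpar_simps [simp]: "wpar [] = 0" "wpar (x # w) = gpar x + wpar w" "wpar (v @ w) = wpar v + wpar w"
  by (simp_all add: wpar_def)

lemma twist_fmon: "twist m (fmon w) = smul ((- 1) ^ (m * wpar w)) (fmon w)"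
  unfolding twist_def fmon_def[of w] by (simp add: fmon_def)

lemma der_fmon: "der e (fmon w) = der_word e w"
  by (simp add: der_def fmon_def)

lemmas twist_linear = lin_ext_add[where f = "\<lambda>w. smul ((- 1) ^ (m * wpar (letters w))) (fmon (letters w))" for m, folded twist_def]
  lin_ext_smul[where f = "\<lambda>w. smul ((- 1) ^ (m * wpar (letters w))) (fmon (letters w))" for m, folded twist_def]
  lin_ext_minus[where f = "\<lambda>w. smul ((- 1) ^ (m * wpar (letters w))) (fmon (letters w))" for m, folded twist_def]

lemmas der_linear = lin_ext_add[where f = "\<lambda>w. der_word e (letters w)" for e, folded der_def]
  lin_ext_smul[where f = "\<lambda>w. der_word e (letters w)" for e, folded der_def]
  lin_ext_minus[where f = "\<lambda>w. der_word e (letters w)" for e, folded der_def]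

lemma twist_zero [simp]: "twist m 0 = 0" and der_zero [simp]: "der e 0 = 0"
  by (simp_all add: twist_def der_def)

lemma twist_mult: "twist m (p * q) = twist m p * twist m q"
proof (induction p rule: free_alg_induct)
  case (smul w c)
  show ?case
  proof (induction q rule: free_alg_induct)
    case (smul w' c')
    show ?case
      by (simp add: smul_mult_left smul_mult_right fmon_mult twist_linear twist_fmon smul_smul
          distrib_left power_add mult_ac)
  qed (simp_all add: distrib_left twist_linear)
qed (simp_all add: distrib_right twist_linear)

lemma der_word_append:
  "der_word e (v @ w) = der_word e v * fmon w + smul ((- 1) ^ (ppar e * wpar v)) (fmon v * der_word e w)"
proof (induction v)
  case Nil
  then show ?case by (simp add: fmon_Nil)
next
  case (Cons x v)
  have [simp]: "fmon (x # v) = fmon [x] * fmon v" by (simp add: fmon_mult)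
  show ?case
    by (simp add: Cons distrib_left distrib_right smul_add smul_mult_left smul_mult_right
        smul_smul power_add mult.assoc flip: fmon_mult[of v w])
qed

lemma der_mult: "der e (p * q) = der e p * q + twist (ppar e) p * der e q"
proof (induction p rule: free_alg_induct)
  case (smul v c)
  show ?case
  proof (induction q rule: free_alg_induct)
    case (smul w c')
    show ?case
      by (simp add: smul_mult_left smul_mult_right fmon_mult twist_linear der_linear twist_fmon
          der_fmon der_word_append smul_smul smul_add mult_ac)
  qed (simp_all add: distrib_left der_linear algebra_simps)
qed (simp_all add: distrib_right twist_linear der_linear algebra_simps)

lemma twist_scomm: "twist m (scomm x y) = smul ((- 1) ^ (m * (gpar x + gpar y))) (scomm x y)"
  by (simp add: scomm_def twist_linear twist_fmon smul_minus smul_smul add.commute mult.commute)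

lemma neg_basis_scomm:
  "neg_basis (k, l, s) * fmon [y] - smul ((- 1) ^ ((par k + par l) * gpar y)) (fmon [y] * neg_basis (k, l, s))
     \<in> super_ideal"
  using super_ideal_scomm[of "(k, l, nat (- s - 1))" y]
  by (simp add: scomm_def fmon_mult super_ideal.zero)

definition homog :: "nat \<Rightarrow> gen free_alg \<Rightarrow> bool" where
  "homog m a \<longleftrightarrow> (\<forall>y. a * fmon [y] - smul ((- 1) ^ (m * gpar y)) (fmon [y] * a) \<in> super_ideal)"

lemma homog_zero: "homog m 0"
  by (simp add: homog_def super_ideal.zero)

lemma homog_smul: "homog m a \<Longrightarrow> homog m (smul c a)"
  unfolding homog_def
proof (intro allI)
  fix y assume "\<forall>y. a * fmon [y] - smul ((- 1) ^ (m * gpar y)) (fmon [y] * a) \<in> super_ideal"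
  then have "smul c (a * fmon [y] - smul ((- 1) ^ (m * gpar y)) (fmon [y] * a)) \<in> super_ideal"
    by (intro super_ideal_smul) blast
  then show "smul c a * fmon [y] - smul ((- 1) ^ (m * gpar y)) (fmon [y] * smul c a) \<in> super_ideal"
    by (simp add: smul_mult_left smul_mult_right smul_minus smul_smul mult.commute)
qed

lemma homog_diff:
  assumes "homog m a" "homog m b"
  shows "homog m (a - b)"
  unfolding homog_def
proof (intro allI)
  fix y
  have "(a * fmon [y] - smul ((- 1) ^ (m * gpar y)) (fmon [y] * a)) -
        (b * fmon [y] - smul ((- 1) ^ (m * gpar y)) (fmon [y] * b)) \<in> super_ideal"
    using assms unfolding homog_def by (metis super_ideal_diff)
  then show "(a - b) * fmon [y] - smul ((- 1) ^ (m * gpar y)) (fmon [y] * (a - b)) \<in> super_ideal"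
    by (simp add: algebra_simps smul_minus)
qed

lemma homog_neg_basis:
  assumes "even (m + par k + par l)"
  shows "homog m (neg_basis (k, l, s))"
proof -
  have "(- 1 :: complex) ^ (m * gpar y) = (- 1) ^ ((par k + par l) * gpar y)" for y
    using assms by (cases "even m") (auto simp: minus_one_power_iff)
  then show ?thesis using neg_basis_scomm by (simp add: homog_def del: neg_basis.simps)
qed

lemma homog_ad_gen: "homog (ppar e + gpar x) (ad_gen e x)"
proof -
  obtain i j r where e: "e = (i, j, r)" by (cases e)
  obtain k l n where x: "x = (k, l, n)" by (cases x)
  show ?thesis
    unfolding e x ad_gen.simps bracket.simps neg_part_def lin_ext_minus
    by (intro homog_diff)
       (auto simp: homog_zero simp del: neg_basis.simps intro!: homog_smul homog_neg_basis)
qed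

lemma der_scomm: "der e (scomm x y) \<in> super_ideal"
proof -
  let ?s = "\<lambda>m. (- 1 :: complex) ^ m"
  let ?e = "ppar e" and ?x = "gpar x" and ?y = "gpar y"
  have 1: "ad_gen e x * fmon [y] - smul (?s ((?e + ?x) * ?y)) (fmon [y] * ad_gen e x) \<in> super_ideal"
    and 2: "ad_gen e y * fmon [x] - smul (?s ((?e + ?y) * ?x)) (fmon [x] * ad_gen e y) \<in> super_ideal"
    using homog_ad_gen unfolding homog_def by blast+
  have sq: "?s m * ?s m = 1" for m by (simp flip: power_add)
  have sq': "?s m * (?s m * z) = z" for m z by (simp add: sq mult.assoc[symmetric])
  have "der e (scomm x y) =
      (ad_gen e x * fmon [y] - smul (?s ((?e + ?x) * ?y)) (fmon [y] * ad_gen e x)) -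
      smul (?s (?x * ?y)) (ad_gen e y * fmon [x] - smul (?s ((?e + ?y) * ?x)) (fmon [x] * ad_gen e y))"
    by (simp add: scomm_def der_linear der_fmon smul_minus smul_smul smul_add fmon_Nil
        power_add distrib_right distrib_left mult_ac sq sq')
  also have "\<dots> \<in> super_ideal"
    by (intro super_ideal_diff super_ideal_smul 1 2)
  finally show ?thesis .
qed

lemma super_ideal_sandwich: "p \<in> super_ideal \<Longrightarrow> a * p * b \<in> super_ideal"
  by (intro super_ideal_mult_left super_ideal_mult_right)

lemma der_super_ideal: "p \<in> super_ideal \<Longrightarrow> der e p \<in> super_ideal"
proof (induction p rule: super_ideal.induct)
  case (rel a x y b)
  show ?case
    unfolding der_mult distrib_right twist_mult twist_scomm
    by (intro super_ideal.add super_ideal_sandwich super_ideal_smul super_ideal_scomm der_scomm)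
qed (auto simp: der_linear intro: super_ideal.intros)

lemma twist_super_ideal: "p \<in> super_ideal \<Longrightarrow> twist m p \<in> super_ideal"
proof (induction p rule: super_ideal.induct)
  case (rel a x y b)
  show ?case
    unfolding twist_mult twist_scomm
    by (intro super_ideal_sandwich super_ideal_smul super_ideal_scomm)
qed (auto simp: twist_linear intro: super_ideal.intros)

lift_definition super_twist :: "nat \<Rightarrow> super_sym \<Rightarrow> super_sym" is twist
  unfolding super_rel_def by (metis twist_linear(3) twist_super_ideal)

lift_definition act_basis :: "pos \<Rightarrow> super_sym \<Rightarrow> super_sym" is der
  unfolding super_rel_def by (metis der_linear(3) der_super_ideal)

text \<open>
  \<open>act_basis e\<close> is the superderivation extending \<open>ad_gen e\<close>: \<open>super_twist m\<close> multiplies a homogeneous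
  element of parity \<open>q\<close> by \<open>(- 1) ^ (m * q)\<close>.
\<close>

lemma act_basis_gen: "act_basis e (super_gen x) = abs_super_sym (ad_gen e x)"
  by (simp add: super_gen_def act_basis.abs_eq der_fmon fmon_Nil)

lemma act_basis_mult: "act_basis e (p * q) = act_basis e p * q + super_twist (ppar e) p * act_basis e q"
  by transfer (simp add: der_mult super_rel_def super_ideal.zero)

lemma act_basis_add: "act_basis e (p + q) = act_basis e p + act_basis e q"
  by transfer (simp add: der_linear super_rel_def super_ideal.zero)

lemma act_basis_smul: "act_basis e (super_smul c p) = super_smul c (act_basis e p)"
  by transfer (simp add: der_linear super_rel_def super_ideal.zero)

lemma super_twist_gen: "super_twist m (super_gen x) = super_smul ((- 1) ^ (m * gpar x)) (super_gen x)"
  by transfer (simp add: twist_fmon super_rel_def super_ideal.zero)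

lemma super_twist_mult: "super_twist m (p * q) = super_twist m p * super_twist m q"
  by transfer (simp add: twist_mult super_rel_def super_ideal.zero)

definition act :: "(pos \<Rightarrow>\<^sub>0 complex) \<Rightarrow> super_sym \<Rightarrow> super_sym" where
  "act X p = (\<Sum>e\<in>Poly_Mapping.keys X. super_smul (Poly_Mapping.lookup X e) (act_basis e p))"

definition invariants :: "super_sym set" where
  "invariants = {p. \<forall>X. act X p = 0}"


section \<open>Affine supersymmetric polynomials\<close>

type_synonym 'x cpoly = "('x \<Rightarrow>\<^sub>0 nat) \<Rightarrow>\<^sub>0 complex"

definition cvar :: "'x \<Rightarrow> 'x cpoly" where
  "cvar x = Poly_Mapping.single (Poly_Mapping.single x 1) 1"

text \<open>
  Substitution of \<open>f x\<close> for each variable \<open>x\<close> in a polynomial; the values lie in a commutative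
  complex algebra with structure map \<open>\<kappa>\<close>.
\<close>

definition subst_poly :: "(complex \<Rightarrow> 'r::comm_ring_1) \<Rightarrow> ('x \<Rightarrow> 'r) \<Rightarrow> 'x cpoly \<Rightarrow> 'r" where
  "subst_poly \<kappa> f P =
     (\<Sum>m\<in>Poly_Mapping.keys P. \<kappa> (Poly_Mapping.lookup P m) *
        (\<Prod>x\<in>Poly_Mapping.keys m. f x ^ Poly_Mapping.lookup m x))"

datatype uv = U | V

definition subst_t :: "uv cpoly \<Rightarrow> complex poly" where
  "subst_t = subst_poly (\<lambda>c. [:c:]) (case_uv [:0, 1:] (- [:0, 1:]))"

definition supersymmetric :: "uv cpoly set" where
  "supersymmetric = {P. \<exists>c. subst_t P = [:c:]}"

text \<open>\<open>cvar (U, r)\<close> and \<open>cvar (V, r)\<close> are the variables \<open>u\<^sub>r\<close> and \<open>v\<^sub>r\<close>.\<close>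

definition subst_series :: "uv cpoly \<Rightarrow> (uv \<times> nat) cpoly fps" where
  "subst_series = subst_poly (\<lambda>c. fps_const (Poly_Mapping.single 0 c)) (\<lambda>x. Abs_fps (\<lambda>r. cvar (x, r)))"

inductive_set generated_subalgebra :: "'x cpoly set \<Rightarrow> 'x cpoly set" for G where
  gen: "p \<in> G \<Longrightarrow> p \<in> generated_subalgebra G"
| one: "1 \<in> generated_subalgebra G"
| smul: "p \<in> generated_subalgebra G \<Longrightarrow> smul c p \<in> generated_subalgebra G"
| add: "p \<in> generated_subalgebra G \<Longrightarrow> q \<in> generated_subalgebra G \<Longrightarrow> p + q \<in> generated_subalgebra G"
| mult: "p \<in> generated_subalgebra G \<Longrightarrow> q \<in> generated_subalgebra G \<Longrightarrow> p * q \<in> generated_subalgebra G"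

definition affine_supersymmetric :: "(uv \<times> nat) cpoly set" where
  "affine_supersymmetric =
     generated_subalgebra {fps_nth (subst_series P) r | P r. P \<in> supersymmetric}"

end

theory Submission
  imports Defs
begin

text \<open>
  Let \<open>a(z), b(z), c(z), d(z)\<close> be the generating series \<open>\<Sum>n. E\<^sub>i\<^sub>j[-n-1] z\<^sup>n\<close> of the generators for
  \<open>E\<^sub>1\<^sub>1, E\<^sub>1\<^sub>2, E\<^sub>2\<^sub>1, E\<^sub>2\<^sub>2\<close>. The element \<open>E\<^sub>i\<^sub>j[r]\<close> of \<open>g[t]\<close> acts on them by \<open>z\<^sup>r\<close> times the bracket of
  \<open>gl(1|1)\<close>. The series \<open>s = a + d\<close> is killed by everything, and the two odd currents act by
  \<open>E\<^sub>1\<^sub>2[r] : a \<mapsto> - z\<^sup>r b, c \<mapsto> z\<^sup>r s\<close> and \<open>E\<^sub>2\<^sub>1[r] : a \<mapsto> z\<^sup>r c, b \<mapsto> z\<^sup>r s\<close>, killing \<open>b\<close> and \<open>c\<close>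
  respectively. The isomorphism is the Chevalley projection \<open>proj\<close>, which sends \<open>b, c\<close> to \<open>0\<close> and \<open>a, d\<close> to
  the series of the variables \<open>u\<^sub>n, v\<^sub>n\<close>. On the polynomial side the coordinates are \<open>s\<^sub>n = u\<^sub>n + v\<^sub>n\<close>
  and \<open>x\<^sub>n = u\<^sub>n\<close>.

  Injectivity (\<open>invariant_proj_zero\<close>). The part of lowest degree in the odd generators of an invariant
  is killed by all \<open>\<Sum>n. s\<^sub>n\<^sub>-\<^sub>r \<partial>/\<partial>c\<^sub>n\<close> and \<open>\<Sum>n. s\<^sub>n\<^sub>-\<^sub>r \<partial>/\<partial>b\<^sub>n\<close>. These systems are triangular with the
  non-zero-divisor \<open>s\<^sub>0\<close> on the diagonal, so all odd derivatives of that part vanish and it has odd degree \<open>0\<close>.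

  The image contains the affine supersymmetric polynomials (\<open>affine_liftable\<close>). The coefficients of
  \<open>s a\<^sup>k - k a\<^sup>k\<^sup>-\<^sup>1 b c\<close> are invariants over those of \<open>s x\<^sup>k\<close>. Since \<open>v = - u\<close> modulo \<open>s\<close>, a supersymmetric
  \<open>P(u, v)\<close> is a constant plus a combination of products of series \<open>s x\<^sup>k\<close>.

  The image is contained in them (\<open>s_divisible_imp_affine\<close>). Let \<open>p\<close> be the projection of an invariant \<open>P\<close>.
  The coefficient of \<open>b\<^sub>0\<close> in \<open>E\<^sub>1\<^sub>2[r] P = 0\<close> says that \<open>\<partial>p/\<partial>x\<^sub>r = \<Sum>l. s\<^sub>l g\<^sub>r\<^sub>+\<^sub>l\<close> with one family \<open>g\<close> for
  all \<open>r\<close>. This alone forces \<open>p\<close> into the algebra generated by the coefficients of the \<open>s x\<^sup>k\<close>, for the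
  following reason. Encode the part of degree \<open>N\<close> in \<open>s\<close> by its iterated derivatives
  \<open>F(n\<^sub>1, \<dots>, n\<^sub>N)\<close> by \<open>s\<^sub>n\<^sub>1, \<dots>, s\<^sub>n\<^sub>N\<close>, which are polynomials in \<open>x\<close>, and let \<open>S\<^sub>j\<close> be the shift of \<open>n\<^sub>j\<close>.
  By the Leibniz rule the condition becomes \<open>\<partial>F/\<partial>x\<^sub>i = \<Sum>j. S\<^sub>j\<^sup>i u\<^sub>j\<close> for some families \<open>u\<^sub>j\<close>. By induction on
  the degree in \<open>x\<close>, the left hand sides are combinations of families obtained from constants by the
  operators \<open>\<Sum>i. x\<^sub>i S\<^sub>j\<^sup>i\<close>. On these families all \<open>S\<^sub>b - S\<^sub>a\<close> are surjective, and a Vandermonde argument then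
  shows that the \<open>u\<^sub>j\<close> may be chosen among them (\<open>vandermonde_splitting\<close>). Euler's identity
  \<open>d F = \<Sum>i. x\<^sub>i \<partial>F/\<partial>x\<^sub>i\<close> puts \<open>F\<close> itself among them. Finally, contracting such a family with
  \<open>s\<^sub>n\<^sub>1 \<cdots> s\<^sub>n\<^sub>N\<close> gives a combination of products of coefficients of the series \<open>s x\<^sup>k\<close>, because the operator
  \<open>\<Sum>i. x\<^sub>i S\<^sub>j\<^sup>i\<close> is adjoint to the multiplication of the \<open>j\<close>-th series by \<open>x(z)\<close>.
\<close>


section \<open>Derivations of a polynomial algebra\<close>

definition pderiv_var :: "'x \<Rightarrow> 'x cpoly \<Rightarrow> 'x cpoly" where
  "pderiv_var x = lin_ext (\<lambda>m. smul (of_nat (Poly_Mapping.lookup m x))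
     (Poly_Mapping.single (m - Poly_Mapping.single x 1) 1))"

lemma smul_mult_right_comm: "p * smul c q = smul c (p * q)" for p q :: "'m::comm_monoid_add \<Rightarrow>\<^sub>0 complex"
  by (simp add: smul_def mult_ac)

lemma pderiv_var_linear [simp]:
  "pderiv_var x 0 = 0" "pderiv_var x (p + q) = pderiv_var x p + pderiv_var x q"
  "pderiv_var x (p - q) = pderiv_var x p - pderiv_var x q"
  "pderiv_var x (smul c p) = smul c (pderiv_var x p)"
  by (simp_all add: pderiv_var_def lin_ext_add lin_ext_minus lin_ext_smul)

lemma single_eq_smul: "Poly_Mapping.single m c = smul c (Poly_Mapping.single m 1)"
  by (simp add: smul_def mult_single)

lemma monomial_induct [case_names zero add]:
  fixes m :: "'x \<Rightarrow>\<^sub>0 nat"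
  assumes "P 0" "\<And>x m. P m \<Longrightarrow> P (Poly_Mapping.single x 1 + m)"
  shows "P m"
proof (induction m rule: update_induct)
  case (update m x k)
  have "Poly_Mapping.update x k m = Poly_Mapping.single x k + m"
    using update(1)
    by (intro poly_mapping_eqI) (auto simp: lookup_update lookup_add lookup_single when_def in_keys_iff)
  moreover have "P (Poly_Mapping.single x k + m)" for k
  proof (induction k)
    case (Suc k)
    have "Poly_Mapping.single x (Suc k) + m = Poly_Mapping.single x 1 + (Poly_Mapping.single x k + m)"
      by (simp add: single_add [symmetric] add.assoc [symmetric])
    then show ?case using assms(2) Suc by simp
  qed (simp add: update.IH)
  ultimately show ?case by simp
qed (rule assms(1))

lemma cvar_mult_monomial:
  "cvar x * Poly_Mapping.single m 1 = Poly_Mapping.single (Poly_Mapping.single x 1 + m) 1"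
  by (simp add: cvar_def mult_single)

lemma cpoly_induct [case_names zero one smul add var]:
  fixes p :: "'x cpoly"
  assumes "P 0" "P 1" "\<And>c p. P p \<Longrightarrow> P (smul c p)" "\<And>p q. P p \<Longrightarrow> P q \<Longrightarrow> P (p + q)"
    "\<And>x p. P p \<Longrightarrow> P (cvar x * p)"
  shows "P p"
proof (induction p rule: poly_mapping_lin_induct)
  case (single m c)
  have "P (Poly_Mapping.single m 1)"
    by (induction m rule: monomial_induct)
       (use assms(2,5) in \<open>auto simp flip: cvar_mult_monomial simp del: One_nat_def\<close>)
  then show ?case by (subst single_eq_smul) (rule assms(3))
qed (use assms in auto)

lemma pderiv_var_one [simp]: "pderiv_var x 1 = 0"
  by (simp add: pderiv_var_def single_one[symmetric] del: single_one)

lemma pderiv_var_cvar_mult [simp]: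
  "pderiv_var x (cvar y * p) = (if x = y then p else 0) + cvar y * pderiv_var x p"
proof (induction p rule: poly_mapping_lin_induct)
  case (single m c)
  let ?x = "Poly_Mapping.single x (1::nat)" and ?y = "Poly_Mapping.single y (1::nat)"
  have "?x + m - ?x = m" by simp
  moreover have "?y + m - ?x = ?y + (m - ?x)" if "Poly_Mapping.lookup m x \<noteq> 0"
    using that
    by (intro poly_mapping_eqI) (auto simp: lookup_add lookup_minus lookup_single when_def)
  moreover have "?y + m - ?x = ?y + (m - ?x)" if "x \<noteq> y"
    using that
    by (intro poly_mapping_eqI) (auto simp: lookup_add lookup_minus lookup_single when_def)
  ultimately have "pderiv_var x (cvar y * Poly_Mapping.single m 1) =
      (if x = y then Poly_Mapping.single m 1 else 0) + cvar y * pderiv_var x (Poly_Mapping.single m 1)"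
    unfolding cvar_mult_monomial pderiv_var_def lin_ext_single smul_one smul_mult_right_comm
    by (cases "Poly_Mapping.lookup m x = 0")
       (auto simp: lookup_add lookup_single when_def smul_left_add)
  moreover have "cvar y * Poly_Mapping.single m c = smul c (cvar y * Poly_Mapping.single m 1)"
    "pderiv_var x (Poly_Mapping.single m c) = smul c (pderiv_var x (Poly_Mapping.single m 1))"
    "Poly_Mapping.single m c = smul c (Poly_Mapping.single m 1)"
    by (simp_all add: smul_mult_right_comm [symmetric] flip: single_eq_smul pderiv_var_linear(4))
  ultimately show ?case
    by (simp add: smul_mult_right_comm smul_add)
qed (auto simp: distrib_left)

lemma pderiv_var_commute: "pderiv_var x (pderiv_var y p) = pderiv_var y (pderiv_var x p)"
  by (induction p rule: cpoly_induct) auto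

abbreviation const_term :: "'x cpoly \<Rightarrow> complex" where
  "const_term p \<equiv> Poly_Mapping.lookup p 0"

lemma const_term_cvar_mult: "const_term (cvar x * p) = 0"
proof (induction p rule: poly_mapping_lin_induct)
  case (single m c)
  have "Poly_Mapping.lookup (Poly_Mapping.single x 1 + m) x \<noteq> 0"
    by (simp add: lookup_add)
  then have "Poly_Mapping.single x 1 + m \<noteq> 0" by (metis lookup_zero)
  then show ?case by (simp add: cvar_def mult_single lookup_single)
qed (simp_all add: distrib_left lookup_add)


section \<open>The coordinates s and x\<close>

text \<open>
  The derivations \<open>ds n\<close> and \<open>dx n\<close> are the partial derivatives for the coordinate system \<open>s\<^sub>n, x\<^sub>n\<close>; in terms
  of \<open>u\<^sub>n = x\<^sub>n\<close> and \<open>v\<^sub>n = s\<^sub>n - x\<^sub>n\<close> they are given by the chain rule.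
\<close>

definition svar :: "nat \<Rightarrow> (uv \<times> nat) cpoly" where "svar n = cvar (U, n) + cvar (V, n)"
definition xvar :: "nat \<Rightarrow> (uv \<times> nat) cpoly" where "xvar n = cvar (U, n)"
definition ds :: "nat \<Rightarrow> (uv \<times> nat) cpoly \<Rightarrow> (uv \<times> nat) cpoly" where
  "ds n p = pderiv_var (V, n) p"
definition dx :: "nat \<Rightarrow> (uv \<times> nat) cpoly \<Rightarrow> (uv \<times> nat) cpoly" where
  "dx n p = pderiv_var (U, n) p - pderiv_var (V, n) p"

lemma ds_simps [simp]:
  "ds n 0 = 0" "ds n 1 = 0" "ds n (p + q) = ds n p + ds n q" "ds n (p - q) = ds n p - ds n q"
  "ds n (smul c p) = smul c (ds n p)"
  "ds n (svar m * p) = (if n = m then p else 0) + svar m * ds n p"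
  "ds n (xvar m * p) = xvar m * ds n p"
  by (auto simp: ds_def svar_def xvar_def distrib_right)

lemma dx_simps [simp]:
  "dx n 0 = 0" "dx n 1 = 0" "dx n (p + q) = dx n p + dx n q" "dx n (p - q) = dx n p - dx n q"
  "dx n (smul c p) = smul c (dx n p)"
  "dx n (xvar m * p) = (if n = m then p else 0) + xvar m * dx n p"
  "dx n (svar m * p) = svar m * dx n p"
  by (auto simp: dx_def svar_def xvar_def distrib_right right_diff_distrib smul_minus)

lemma dx_sum: "dx n (sum f A) = (\<Sum>a\<in>A. dx n (f a))"
  by (induction A rule: infinite_finite_induct) auto

lemma ds_commute: "ds m (ds n p) = ds n (ds m p)"
  by (simp add: ds_def pderiv_var_commute)

lemma ds_dx_commute: "ds m (dx n p) = dx n (ds m p)"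
  by (simp add: ds_def dx_def pderiv_var_commute[of "(V, m)"])

lemma dx_commute: "dx m (dx n p) = dx n (dx m p)"
  by (simp add: dx_def pderiv_var_commute[of _ "(U, n)"] pderiv_var_commute[of _ "(V, n)"])

lemma ds_of_nat_mult [simp]: "ds n (of_nat j * p) = of_nat j * ds n p"
  by (induction j) (auto simp: distrib_right)

lemma const_term_coord_mult:
  "const_term (svar n * p) = 0" "const_term (xvar n * p) = 0"
  by (simp_all add: svar_def xvar_def distrib_right lookup_add const_term_cvar_mult)

text \<open>
  Since \<open>v\<^sub>n = s\<^sub>n - x\<^sub>n\<close>, the coordinates \<open>s\<^sub>n, x\<^sub>n\<close> generate the polynomial algebra, so it suffices to
  check linear identities on their products.
\<close>

lemma sx_induct [case_names zero one smul add s x]: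
  assumes "P 0" "P 1" "\<And>c p. P p \<Longrightarrow> P (smul c p)" "\<And>p q. P p \<Longrightarrow> P q \<Longrightarrow> P (p + q)"
    "\<And>n p. P p \<Longrightarrow> P (svar n * p)" "\<And>n p. P p \<Longrightarrow> P (xvar n * p)"
  shows "P p"
proof (induction p rule: cpoly_induct)
  case (var y p)
  obtain w n where y: "y = (w, n)" by (cases y)
  show ?case
  proof (cases w)
    case U
    then show ?thesis using assms(6)[OF var] by (simp add: xvar_def y)
  next
    case V
    have "cvar y * p = svar n * p + smul (-1) (xvar n * p)"
      by (simp add: y V svar_def xvar_def smul_neg1 algebra_simps)
    then show ?thesis by (metis assms(3-6) var)
  qed
qed (use assms in auto)

text \<open>
  Differentiating \<open>s\<^sub>0 p = 0\<close> repeatedly by \<open>s\<^sub>0\<close> expresses each derivative of \<open>p\<close> as a multiple of the next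
  one. High derivatives of a polynomial vanish, so all of them do, down to \<open>p\<close> itself.
\<close>

lemma s0_nonzerodivisor:
  assumes "svar 0 * p = 0"
  shows "p = 0"
proof -
  \<comment> \<open>\<open>ds 0\<close> is locally nilpotent\<close>
  have nilp: "\<exists>K. \<forall>k\<ge>K. (ds 0 ^^ k) q = 0" for q
  proof (induction q rule: sx_induct)
    case zero
    have "(ds 0 ^^ k) 0 = 0" for k by (induction k) auto
    then show ?case by auto
  next
    case one
    have "(ds 0 ^^ k) 1 = 0" if "k \<ge> 1" for k
      using that by (induction k rule: dec_induct) auto
    then show ?case by auto
  next
    case (smul c q)
    have "(ds 0 ^^ k) (smul c q) = smul c ((ds 0 ^^ k) q)" for k by (induction k) auto
    moreover obtain K where "\<And>k. k \<ge> K \<Longrightarrow> (ds 0 ^^ k) q = 0" using smul by blast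
    ultimately show ?case by (intro exI[of _ K]) auto
  next
    case (add q r)
    have "(ds 0 ^^ k) (q + r) = (ds 0 ^^ k) q + (ds 0 ^^ k) r" for k by (induction k) auto
    moreover obtain K L where "\<And>k. k \<ge> K \<Longrightarrow> (ds 0 ^^ k) q = 0" "\<And>k. k \<ge> L \<Longrightarrow> (ds 0 ^^ k) r = 0"
      using add by blast
    ultimately show ?case by (intro exI[of _ "max K L"]) auto
  next
    case (s n q)
    then obtain K where K: "\<And>k. k \<ge> K \<Longrightarrow> (ds 0 ^^ k) q = 0" by blast
    have "(ds 0 ^^ Suc k) (svar n * q) =
        svar n * (ds 0 ^^ Suc k) q + (if n = 0 then of_nat (Suc k) * (ds 0 ^^ k) q else 0)" for k
    proof (induction k)
      case (Suc k)
      have "(ds 0 ^^ Suc (Suc k)) (svar n * q) = ds 0 ((ds 0 ^^ Suc k) (svar n * q))" by simp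
      then show ?case unfolding Suc by (simp add: distrib_right add_ac)
    qed auto
    then have "(ds 0 ^^ k) (svar n * q) = 0" if "k \<ge> Suc K" for k
      using that K by (cases k) auto
    then show ?case by blast
  next
    case (x n q)
    have "(ds 0 ^^ k) (xvar n * q) = xvar n * ((ds 0 ^^ k) q)" for k by (induction k) auto
    moreover obtain K where "\<And>k. k \<ge> K \<Longrightarrow> (ds 0 ^^ k) q = 0" using x by blast
    ultimately show ?case by (intro exI[of _ K]) auto
  qed
  have step: "of_nat (Suc k) * (ds 0 ^^ k) p + svar 0 * (ds 0 ^^ Suc k) p = 0" for k
  proof (induction k)
    case 0
    have "ds 0 (svar 0 * p) = 0" using assms by simp
    then show ?case by simp
  next
    case (Suc k)
    have "ds 0 (of_nat (Suc k) * (ds 0 ^^ k) p + svar 0 * (ds 0 ^^ Suc k) p) = 0"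
      by (simp only: Suc ds_simps)
    then show ?case by (simp add: distrib_right add_ac)
  qed
  obtain K where K: "(ds 0 ^^ K) p = 0" using nilp by blast
  have "(ds 0 ^^ (K - j)) p = 0" for j
  proof (induction j)
    case (Suc j)
    show ?case
    proof (cases "j < K")
      case True
      then have eq: "K - j = Suc (K - Suc j)" by simp
      have "of_nat (Suc (K - Suc j)) * (ds 0 ^^ (K - Suc j)) p = 0"
        using step[of "K - Suc j"] Suc unfolding eq by simp
      then have "smul (of_nat (Suc (K - Suc j))) ((ds 0 ^^ (K - Suc j)) p) = 0"
        unfolding smul_def single_of_nat .
      then have "smul (inverse (of_nat (Suc (K - Suc j)))) (smul (of_nat (Suc (K - Suc j))) ((ds 0 ^^ (K - Suc j)) p)) = 0"
        by simp
      then show ?thesis by (simp add: smul_smul del: of_nat_Suc)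
    qed (use Suc in auto)
  qed (simp add: K)
  from this[of K] show ?thesis by simp
qed


section \<open>Partial derivatives on the symmetric superalgebra\<close>

subsection \<open>Scalars and generators\<close>

lemma super_smul_simps [simp]:
  "super_smul c 0 = 0" "super_smul 0 p = 0" "super_smul 1 p = p"
  "super_smul c (p + q) = super_smul c p + super_smul c q"
  "super_smul c (p - q) = super_smul c p - super_smul c q"
  "super_smul c (- p) = - super_smul c p"
  "super_smul c (super_smul d p) = super_smul (c * d) p"
  "super_smul c p * q = super_smul c (p * q)"
  "p * super_smul c q = super_smul c (p * q)"
  by (transfer, simp add: super_rel_def super_ideal.zero smul_add smul_minus smul_smul
        smul_mult_left smul_mult_right smul_neg1[symmetric] mult.commute)+

lemma super_smul_left_add: "super_smul (c + d) p = super_smul c p + super_smul d p"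
  by transfer (simp add: super_rel_def super_ideal.zero smul_left_add)

lemma super_smul_neg1 [simp]: "super_smul (- 1) p = - p"
  by transfer (simp add: super_rel_def super_ideal.zero smul_neg1)

lemma super_smul_uminus: "super_smul (- c) p = - super_smul c p"
  by transfer (simp add: super_rel_def super_ideal.zero smul_uminus)

lemma super_smul_sum: "super_smul c (sum f A) = (\<Sum>a\<in>A. super_smul c (f a))"
  by (induction A rule: infinite_finite_induct) auto

lemma super_sym_induct [case_names zero one smul add gen]:
  assumes "P 0" "P 1" "\<And>c p. P p \<Longrightarrow> P (super_smul c p)" "\<And>p q. P p \<Longrightarrow> P q \<Longrightarrow> P (p + q)"
    "\<And>x p. P p \<Longrightarrow> P (super_gen x * p)"
  shows "P p"
proof -
  have word: "P (abs_super_sym (fmon w))" for w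
  proof (induction w)
    case Nil
    then show ?case using assms(2) by (simp add: fmon_Nil one_super_sym_def)
  next
    case (Cons x w)
    have "abs_super_sym (fmon (x # w)) = super_gen x * abs_super_sym (fmon w)"
      by (simp add: super_gen_def times_super_sym.abs_eq fmon_mult)
    then show ?case using assms(5) Cons by simp
  qed
  have "P (abs_super_sym q)" for q
  proof (induction q rule: free_alg_induct)
    case zero
    then show ?case using assms(1) by (simp add: zero_super_sym_def)
  next
    case (smul w c)
    then show ?case using assms(3)[OF word] by (simp add: super_smul.abs_eq)
  next
    case (add p q)
    then show ?case using assms(4) by (simp add: plus_super_sym.abs_eq [symmetric])
  qed
  then show ?thesis by (metis Quotient3_abs_rep Quotient3_super_sym)
qed


subsection \<open>Left partial superderivatives\<close>

text \<open>
  The left superderivation with value \<open>1\<close> on the generator \<open>y\<close> and \<open>0\<close> on the others. It has the parity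
  of \<open>y\<close>, which is where the sign for passing a letter comes from.
\<close>

primrec pd_word :: "gen \<Rightarrow> gen list \<Rightarrow> gen free_alg" where
  "pd_word y [] = 0"
| "pd_word y (x # w) =
     (if x = y then fmon w else 0) + smul ((- 1) ^ (gpar y * gpar x)) (fmon [x] * pd_word y w)"

definition pd_free :: "gen \<Rightarrow> gen free_alg \<Rightarrow> gen free_alg" where
  "pd_free y = lin_ext (\<lambda>w. pd_word y (letters w))"

lemma pd_free_linear:
  "pd_free y 0 = 0" "pd_free y (p + q) = pd_free y p + pd_free y q"
  "pd_free y (p - q) = pd_free y p - pd_free y q" "pd_free y (smul c p) = smul c (pd_free y p)"
  by (simp_all add: pd_free_def lin_ext_add lin_ext_minus lin_ext_smul)

lemma pd_free_fmon: "pd_free y (fmon w) = pd_word y w"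
  by (simp add: pd_free_def fmon_def)

lemma pd_word_append:
  "pd_word y (v @ w) = pd_word y v * fmon w + smul ((- 1) ^ (gpar y * wpar v)) (fmon v * pd_word y w)"
proof (induction v)
  case Nil
  then show ?case by (simp add: fmon_Nil)
next
  case (Cons x v)
  have [simp]: "fmon (x # v) = fmon [x] * fmon v" by (simp add: fmon_mult)
  show ?case
    by (simp add: Cons distrib_left distrib_right smul_add smul_mult_left smul_mult_right
        smul_smul power_add mult.assoc flip: fmon_mult[of v w])
qed

lemma pd_free_mult: "pd_free y (p * q) = pd_free y p * q + twist (gpar y) p * pd_free y q"
proof (induction p rule: free_alg_induct)
  case (smul v c)
  show ?case
  proof (induction q rule: free_alg_induct)
    case (smul w c')
    show ?case
      by (simp add: smul_mult_left smul_mult_right fmon_mult twist_linear pd_free_linear twist_fmon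
          pd_free_fmon pd_word_append smul_smul smul_add mult_ac)
  qed (simp_all add: distrib_left pd_free_linear algebra_simps)
qed (simp_all add: distrib_right twist_linear pd_free_linear algebra_simps)

lemma pd_free_scomm: "pd_free y (scomm x z) = 0"
proof -
  have "(- 1 :: complex) ^ m * (- 1) ^ m = 1" for m by (simp flip: power_add)
  then show ?thesis
    by (auto simp: scomm_def pd_free_linear pd_free_fmon smul_minus smul_add smul_smul fmon_Nil mult.commute)
qed

lemma pd_free_super_ideal: "p \<in> super_ideal \<Longrightarrow> pd_free y p \<in> super_ideal"
proof (induction p rule: super_ideal.induct)
  case (rel a x z b)
  show ?case
    unfolding pd_free_mult distrib_right twist_mult twist_scomm pd_free_scomm
    by (intro super_ideal.add super_ideal_sandwich super_ideal_smul super_ideal_scomm)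
       (auto intro: super_ideal.zero)
qed (auto simp: pd_free_linear intro: super_ideal.intros)

lift_definition pd :: "gen \<Rightarrow> super_sym \<Rightarrow> super_sym" is pd_free
  unfolding super_rel_def by (metis pd_free_linear(3) pd_free_super_ideal)

lemma pd_simps [simp]:
  "pd y 0 = 0" "pd y 1 = 0" "pd y (p + q) = pd y p + pd y q" "pd y (p - q) = pd y p - pd y q"
  "pd y (super_smul c p) = super_smul c (pd y p)"
proof -
  show "pd y 1 = 0"
    by transfer (simp add: super_rel_def super_ideal.zero flip: fmon_Nil, simp add: pd_free_fmon super_ideal.zero)
qed (transfer, simp add: super_rel_def super_ideal.zero pd_free_linear)+

lemma pd_gen_mult:
  "pd y (super_gen x * p) =
     (if x = y then p else 0) + super_smul ((- 1) ^ (gpar y * gpar x)) (super_gen x * pd y p)"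
  by transfer
     (simp add: super_rel_def super_ideal.zero pd_free_mult pd_free_fmon twist_fmon fmon_Nil smul_mult_left)

lemma minus_one_sq: "(- 1 :: complex) ^ m * (- 1) ^ m = 1" "(- 1 :: complex) ^ m * ((- 1) ^ m * z) = z"
  by (simp_all flip: power_add mult.assoc)

lemma pd_commute: "pd y (pd z p) = super_smul ((- 1) ^ (gpar y * gpar z)) (pd z (pd y p))"
proof (induction p rule: super_sym_induct)
  case (gen x p)
  show ?case
    by (auto simp: pd_gen_mult gen minus_one_sq mult_ac)
qed (auto simp: mult.commute)

lemma finite_pd_support: "finite {y. pd y p \<noteq> 0}"
proof (induction p rule: super_sym_induct)
  case (smul c p)
  then show ?case by (rule finite_subset[rotated]) auto
next
  case (add p q)
  have "{y. pd y (p + q) \<noteq> 0} \<subseteq> {y. pd y p \<noteq> 0} \<union> {y. pd y q \<noteq> 0}" by auto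
  then show ?case using add by (meson finite_UnI finite_subset)
next
  case (gen x p)
  have "{y. pd y (super_gen x * p) \<noteq> 0} \<subseteq> insert x {y. pd y p \<noteq> 0}"
    by (auto simp: pd_gen_mult)
  then show ?case using gen by (meson finite_insert finite_subset)
qed auto

text \<open>Only the finitely many generators on which \<open>p\<close> depends contribute to the chain rule, so its range is
  immaterial once it contains them.\<close>

lemma pd_sum_superset:
  assumes "finite Y" "{y. pd y p \<noteq> 0} \<subseteq> Y"
  shows "(\<Sum>y\<in>Y. f y * pd y p) = (\<Sum>y | pd y p \<noteq> 0. f y * pd y p)"
  using assms by (intro sum.mono_neutral_right) auto

text \<open>
  Both sides are superderivations: by \<open>comm\<close>, moving the coefficient \<open>f y\<close> past a generator turns the sign
  of \<open>pd y\<close> into that of \<open>dv\<close>. Hence it suffices that they agree on generators.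
\<close>

lemma superderivation_chain_rule:
  assumes one: "dv 1 = 0" and add: "\<And>p q. dv (p + q) = dv p + dv q"
    and smul: "\<And>c p. dv (super_smul c p) = super_smul c (dv p)"
    and gen: "\<And>x p. dv (super_gen x * p) = f x * p + super_smul (\<epsilon> x) (super_gen x * dv p)"
    and comm: "\<And>x y. super_smul ((- 1) ^ (gpar y * gpar x)) (f y * super_gen x) = super_smul (\<epsilon> x) (super_gen x * f y)"
    and Y: "finite Y" "{y. pd y p \<noteq> 0} \<subseteq> Y"
  shows "dv p = (\<Sum>y\<in>Y. f y * pd y p)"
proof -
  have zero: "dv 0 = 0" using smul[of 0 0] by simp
  have "dv p = (\<Sum>y | pd y p \<noteq> 0. f y * pd y p)"
  proof (induction p rule: super_sym_induct)
    case (smul c p)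
    have "(\<Sum>y | pd y (super_smul c p) \<noteq> 0. f y * pd y (super_smul c p)) =
        (\<Sum>y | pd y p \<noteq> 0. f y * pd y (super_smul c p))"
      by (rule pd_sum_superset [symmetric]) (auto simp: finite_pd_support)
    then show ?case by (simp add: assms(3) smul super_smul_sum)
  next
    case (add p q)
    let ?Y = "{y. pd y p \<noteq> 0} \<union> {y. pd y q \<noteq> 0}"
    have fin: "finite ?Y" by (simp add: finite_pd_support)
    have sum_eq: "(\<Sum>y | pd y r \<noteq> 0. f y * pd y r) = (\<Sum>y\<in>?Y. f y * pd y r)" if "r \<in> {p, q, p + q}" for r
      by (rule pd_sum_superset [symmetric]) (use that fin in auto)
    have "dv (p + q) = (\<Sum>y\<in>?Y. f y * pd y (p + q))"
      using sum_eq[of p] sum_eq[of q] by (simp add: assms(2) add distrib_left sum.distrib)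
    then show ?case using sum_eq[of "p + q"] by simp
  next
    case (gen x p)
    let ?Y = "insert x {y. pd y p \<noteq> 0}"
    have fin: "finite ?Y" by (simp add: finite_pd_support)
    have sum_eq: "(\<Sum>y | pd y r \<noteq> 0. f y * pd y r) = (\<Sum>y\<in>?Y. f y * pd y r)" if "r \<in> {p, super_gen x * p}" for r
      by (rule pd_sum_superset [symmetric]) (use that fin in \<open>auto simp: pd_gen_mult\<close>)
    have summand: "f y * pd y (super_gen x * p) =
        (if x = y then f x * p else 0) + super_smul (\<epsilon> x) (super_gen x * (f y * pd y p))" for y
    proof -
      have "super_smul ((- 1) ^ (gpar y * gpar x)) (f y * super_gen x) * pd y p =
          super_smul (\<epsilon> x) (super_gen x * f y) * pd y p"
        by (simp only: comm)
      then show ?thesis by (auto simp: pd_gen_mult distrib_left mult.assoc)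
    qed
    have "dv (super_gen x * p) = f x * p + super_smul (\<epsilon> x) (super_gen x * (\<Sum>y\<in>?Y. f y * pd y p))"
      using sum_eq[of p] by (simp add: assms(4) gen)
    also have "\<dots> = (\<Sum>y\<in>?Y. f y * pd y (super_gen x * p))"
      unfolding summand sum.distrib sum_distrib_left super_smul_sum
      by (subst sum.delta'[OF fin]) simp
    also have "\<dots> = (\<Sum>y | pd y (super_gen x * p) \<noteq> 0. f y * pd y (super_gen x * p))"
      by (rule sum_eq [symmetric]) simp
    finally show ?case .
  qed (auto simp: one zero)
  then show ?thesis using pd_sum_superset[OF Y] by simp
qed

definition ad_super :: "pos \<Rightarrow> gen \<Rightarrow> super_sym" where
  "ad_super e y = abs_super_sym (ad_gen e y)"

lemma act_basis_one: "act_basis e 1 = 0"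
  by transfer (simp add: super_rel_def super_ideal.zero flip: fmon_Nil, simp add: der_fmon super_ideal.zero)

lemma ad_super_commute:
  "ad_super e y * super_gen x = super_smul ((- 1) ^ ((ppar e + gpar y) * gpar x)) (super_gen x * ad_super e y)"
  unfolding ad_super_def super_gen_def
  using homog_ad_gen[of e y, unfolded homog_def, rule_format, of x]
  by (simp add: times_super_sym.abs_eq super_smul.abs_eq super_sym.abs_eq_iff super_rel_def)

lemma act_basis_eq_sum_pd:
  assumes "finite Y" "{y. pd y p \<noteq> 0} \<subseteq> Y"
  shows "act_basis e p = (\<Sum>y\<in>Y. ad_super e y * pd y p)"
proof (rule superderivation_chain_rule[where \<epsilon> = "\<lambda>x. (- 1) ^ (ppar e * gpar x)"])
  show "act_basis e (super_gen x * p) =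
      ad_super e x * p + super_smul ((- 1) ^ (ppar e * gpar x)) (super_gen x * act_basis e p)" for x p
    by (simp add: act_basis_mult act_basis_gen super_twist_gen ad_super_def)
qed (use assms in \<open>simp_all add: act_basis_one act_basis_add act_basis_smul ad_super_commute
       minus_one_sq distrib_left power_add mult_ac\<close>)

text \<open>
  The bracket by \<open>E\<^sub>i\<^sub>j[r]\<close> lowers the mode \<open>n\<close> by \<open>r\<close>, and modes below \<open>r\<close> vanish in the quotient by \<open>g[t]\<close>.
\<close>

lemma ad_super_eq:
  "ad_super (i, j, r) (k, l, n) =
     (if r \<le> n then (if k = j then super_gen (i, l, n - r) else 0) -
       (if i = l then super_smul ((- 1) ^ ((par i + par j) * (par k + par l))) (super_gen (k, j, n - r)) else 0)
      else 0)"
proof -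
  have idx: "nat (int n - int r) = n - r" "int r < 1 + int n \<longleftrightarrow> r \<le> n" by auto
  have "abs_super_sym (neg_part (Poly_Mapping.single (a, b, int r + (- int n - 1)) c)) =
      (if r \<le> n then super_smul c (super_gen (a, b, n - r)) else 0)" for a b c
    by (auto simp: neg_part_def super_gen_def super_smul.abs_eq zero_super_sym_def idx algebra_simps)
  moreover have "neg_part 0 = 0" "neg_part (p - q) = neg_part p - neg_part q" for p q
    by (simp_all add: neg_part_def lin_ext_minus)
  moreover have "abs_super_sym (p - q) = abs_super_sym p - abs_super_sym q" for p q
    by (simp add: minus_super_sym.abs_eq)
  moreover have "abs_super_sym 0 = 0" by (simp add: zero_super_sym_def)
  ultimately show ?thesis
    unfolding ad_super_def ad_gen.simps bracket.simps by (auto simp del: gpar.simps)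
qed


subsection \<open>The projection onto the even coordinates\<close>

fun proj_gen :: "gen \<Rightarrow> (uv \<times> nat) cpoly" where
  "proj_gen (I1, I1, n) = cvar (U, n)"
| "proj_gen (I2, I2, n) = cvar (V, n)"
| "proj_gen _ = 0"

text \<open>
  The Chevalley projection, that is, the quotient by the ideal of the odd generators.
\<close>

definition proj_free :: "gen free_alg \<Rightarrow> (uv \<times> nat) cpoly" where
  "proj_free = lin_ext (\<lambda>w. prod_list (map proj_gen (letters w)))"

lemma proj_free_linear:
  "proj_free 0 = 0" "proj_free (p + q) = proj_free p + proj_free q"
  "proj_free (p - q) = proj_free p - proj_free q" "proj_free (smul c p) = smul c (proj_free p)"
  by (simp_all add: proj_free_def lin_ext_add lin_ext_minus lin_ext_smul)

lemma proj_free_fmon: "proj_free (fmon w) = prod_list (map proj_gen w)"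
  by (simp add: proj_free_def fmon_def)

lemma proj_free_mult: "proj_free (p * q) = proj_free p * proj_free q"
proof (induction p rule: free_alg_induct)
  case (smul v c)
  show ?case
  proof (induction q rule: free_alg_induct)
    case (smul w c')
    show ?case
      by (simp add: smul_mult_left smul_mult_right smul_mult_right_comm fmon_mult proj_free_linear
          proj_free_fmon smul_smul)
  qed (simp_all add: distrib_left proj_free_linear)
qed (simp_all add: distrib_right proj_free_linear)

lemma proj_gen_odd: "odd (gpar x) \<Longrightarrow> proj_gen x = 0"
  by (cases x rule: proj_gen.cases) auto

lemma proj_free_scomm: "proj_free (scomm x y) = 0"
proof -
  have "proj_gen x * proj_gen y = smul ((- 1) ^ (gpar x * gpar y)) (proj_gen y * proj_gen x)"
  proof (cases "odd (gpar x) \<and> odd (gpar y)")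
    case False
    then have "even (gpar x * gpar y)" by simp
    then show ?thesis by (simp add: mult.commute)
  qed (simp add: proj_gen_odd)
  then show ?thesis by (simp add: scomm_def proj_free_linear proj_free_fmon)
qed

lemma proj_free_super_ideal: "p \<in> super_ideal \<Longrightarrow> proj_free p = 0"
  by (induction p rule: super_ideal.induct)
     (simp_all add: proj_free_linear proj_free_mult proj_free_scomm)

lift_definition proj :: "super_sym \<Rightarrow> (uv \<times> nat) cpoly" is proj_free
  unfolding super_rel_def using proj_free_super_ideal proj_free_linear(3) by fastforce

lemma proj_simps [simp]:
  "proj 0 = 0" "proj 1 = 1" "proj (p + q) = proj p + proj q" "proj (p - q) = proj p - proj q"
  "proj (super_smul c p) = smul c (proj p)" "proj (p * q) = proj p * proj q"
  "proj (super_gen x) = proj_gen x"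
proof -
  show "proj 1 = 1" by transfer (simp flip: fmon_Nil, simp add: proj_free_fmon)
  show "proj (super_gen x) = proj_gen x" by transfer (simp add: proj_free_fmon)
  show "proj (p * q) = proj p * proj q" by transfer (rule proj_free_mult)
  show "proj 0 = 0"
    by (simp add: zero_super_sym_def proj.abs_eq proj_free_linear)
  obtain a b where "p = abs_super_sym a" "q = abs_super_sym b"
    by (metis Quotient3_abs_rep Quotient3_super_sym)
  then show "proj (p + q) = proj p + proj q" "proj (p - q) = proj p - proj q"
    "proj (super_smul c p) = smul c (proj p)"
    by (simp_all add: plus_super_sym.abs_eq minus_super_sym.abs_eq super_smul.abs_eq proj.abs_eq
        proj_free_linear)
qed

lemma proj_uminus [simp]: "proj (- p) = - proj p"
  using proj_simps(4)[of 0 p] by (simp del: proj_simps(4))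

lemma proj_sum: "proj (sum f A) = (\<Sum>a\<in>A. proj (f a))"
  by (induction A rule: infinite_finite_induct) auto

lemma proj_pd_even:
  "proj (pd (I1, I1, n) p) = pderiv_var (U, n) (proj p)"
  "proj (pd (I2, I2, n) p) = pderiv_var (V, n) (proj p)"
proof -
  have "proj (pd (I1, I1, n) p) = pderiv_var (U, n) (proj p) \<and>
      proj (pd (I2, I2, n) p) = pderiv_var (V, n) (proj p)"
  proof (induction p rule: super_sym_induct)
    case (gen x p)
    then show ?case by (cases x rule: proj_gen.cases) (auto simp: pd_gen_mult)
  qed auto
  then show "proj (pd (I1, I1, n) p) = pderiv_var (U, n) (proj p)"
    "proj (pd (I2, I2, n) p) = pderiv_var (V, n) (proj p)" by auto
qed


section \<open>Invariants are determined by their projection\<close>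

subsection \<open>Vanishing of all derivatives\<close>

text \<open>
  The filtration by word length. It serves to prove by induction that an element all of whose Taylor
  coefficients vanish is zero, without choosing a basis of the symmetric algebra.
\<close>

inductive length_le :: "nat \<Rightarrow> super_sym \<Rightarrow> bool" where
  length_le_one: "length_le 0 1"
| length_le_Suc: "length_le k p \<Longrightarrow> length_le (Suc k) p"
| length_le_gen: "length_le k p \<Longrightarrow> length_le (Suc k) (super_gen x * p)"
| length_le_add: "length_le k p \<Longrightarrow> length_le k q \<Longrightarrow> length_le k (p + q)"
| length_le_smul: "length_le k p \<Longrightarrow> length_le k (super_smul c p)"

lemma length_le_zero: "length_le k 0"
proof (induction k)
  case 0
  show ?case using length_le_smul[OF length_le_one, of 0] by simp
qed (rule length_le_Suc)

lemma length_le_mono: "length_le k p \<Longrightarrow> k \<le> l \<Longrightarrow> length_le l p"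
  by (induction l rule: nat_induct) (auto simp: le_Suc_eq intro: length_le_Suc)

lemma length_le_exists: "\<exists>k. length_le k p"
proof (induction p rule: super_sym_induct)
  case (add p q)
  then obtain k l where "length_le k p" "length_le l q" by blast
  then have "length_le (max k l) (p + q)" by (intro length_le_add) (auto intro: length_le_mono)
  then show ?case by blast
qed (auto intro: length_le.intros length_le_zero)

lemma length_le_pd: "length_le k p \<Longrightarrow> (case k of 0 \<Rightarrow> pd y p = 0 | Suc l \<Rightarrow> length_le l (pd y p))"
proof (induction rule: length_le.induct)
  case (length_le_Suc k p)
  then show ?case by (cases k rule: nat.exhaust) (auto intro: length_le_zero length_le.length_le_Suc)
next
  case (length_le_gen k p x)
  have "length_le k (super_gen x * pd y p)"
    using length_le_gen by (cases k rule: nat.exhaust) (auto intro: length_le_zero length_le.length_le_gen)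
  moreover have "length_le k (if x = y then p else 0)"
    using length_le_gen by (auto intro: length_le_zero)
  ultimately show ?case by (auto simp: pd_gen_mult intro!: length_le.length_le_add length_le.length_le_smul)
next
  case (length_le_add k p q)
  then show ?case by (cases k rule: nat.exhaust) (auto intro: length_le.length_le_add)
next
  case (length_le_smul k p c)
  then show ?case by (cases k rule: nat.exhaust) (auto intro: length_le.length_le_smul)
qed simp

text \<open>
  The Euler operator \<open>\<Sum>y. y \<partial>/\<partial>y\<close> multiplies a word by its length, provided that the sum ranges over all
  its letters, which \<open>Z\<close> collects. So it acts as \<open>k\<close> on the \<open>k\<close>-th step of the filtration modulo the
  previous one.
\<close>

lemma euler_length_le:
  "length_le k p \<Longrightarrow> \<exists>Z. finite Z \<and> (\<forall>Y. finite Y \<longrightarrow> Z \<subseteq> Y \<longrightarrow>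
     (case k of 0 \<Rightarrow> (\<Sum>y\<in>Y. super_gen y * pd y p) = 0
      | Suc l \<Rightarrow> length_le l ((\<Sum>y\<in>Y. super_gen y * pd y p) - super_smul (of_nat k) p)))"
proof (induction rule: length_le.induct)
  case length_le_one
  then show ?case by auto
next
  case (length_le_Suc k p)
  then obtain Z where Z: "finite Z" "\<And>Y. finite Y \<Longrightarrow> Z \<subseteq> Y \<Longrightarrow> (case k of 0 \<Rightarrow> (\<Sum>y\<in>Y. super_gen y * pd y p) = 0
      | Suc l \<Rightarrow> length_le l ((\<Sum>y\<in>Y. super_gen y * pd y p) - super_smul (of_nat k) p))" by blast
  have "length_le k ((\<Sum>y\<in>Y. super_gen y * pd y p) - super_smul (of_nat (Suc k)) p)"
    if "finite Y" "Z \<subseteq> Y" for Y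
  proof -
    have "length_le k ((\<Sum>y\<in>Y. super_gen y * pd y p) - super_smul (of_nat k) p)"
      using Z(2)[OF that] by (cases k rule: nat.exhaust) (auto intro: length_le_zero length_le.length_le_Suc)
    then have "length_le k (((\<Sum>y\<in>Y. super_gen y * pd y p) - super_smul (of_nat k) p) + super_smul (- 1) p)"
      by (intro length_le.length_le_add length_le.length_le_smul length_le_Suc.hyps)
    then show ?thesis by (simp add: super_smul_left_add algebra_simps)
  qed
  then show ?case using Z(1) by auto
next
  case (length_le_gen k p x)
  then obtain Z where Z: "finite Z" "\<And>Y. finite Y \<Longrightarrow> Z \<subseteq> Y \<Longrightarrow> (case k of 0 \<Rightarrow> (\<Sum>y\<in>Y. super_gen y * pd y p) = 0
      | Suc l \<Rightarrow> length_le l ((\<Sum>y\<in>Y. super_gen y * pd y p) - super_smul (of_nat k) p))" by blast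
  have "length_le k ((\<Sum>y\<in>Y. super_gen y * pd y (super_gen x * p)) - super_smul (of_nat (Suc k)) (super_gen x * p))"
    if Y: "finite Y" "insert x Z \<subseteq> Y" for Y
  proof -
    have "super_gen y * pd y (super_gen x * p) =
        (if x = y then super_gen x * p else 0) + super_gen x * (super_gen y * pd y p)" for y
    proof -
      have "super_gen y * (super_gen x * pd y p) =
          super_smul ((- 1) ^ (gpar y * gpar x)) (super_gen x * (super_gen y * pd y p))"
        by (subst mult.assoc [symmetric], subst super_gen_commute) (simp add: mult.assoc)
      then show ?thesis by (auto simp: pd_gen_mult distrib_left minus_one_sq)
    qed
    then have "(\<Sum>y\<in>Y. super_gen y * pd y (super_gen x * p)) =
        super_gen x * p + super_gen x * (\<Sum>y\<in>Y. super_gen y * pd y p)"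
      using Y by (simp add: sum.distrib sum_distrib_left)
    then have eq: "(\<Sum>y\<in>Y. super_gen y * pd y (super_gen x * p)) - super_smul (of_nat (Suc k)) (super_gen x * p)
        = super_gen x * ((\<Sum>y\<in>Y. super_gen y * pd y p) - super_smul (of_nat k) p)"
      by (simp add: super_smul_left_add right_diff_distrib)
    show ?thesis
      unfolding eq using Z(2)[of Y] Y by (cases k rule: nat.exhaust) (auto intro: length_le_zero length_le.length_le_gen)
  qed
  then show ?case using Z(1) by (intro exI[of _ "insert x Z"]) auto
next
  case (length_le_add k p q)
  then obtain Z Z' where Z: "finite Z" "\<And>Y. finite Y \<Longrightarrow> Z \<subseteq> Y \<Longrightarrow> (case k of 0 \<Rightarrow> (\<Sum>y\<in>Y. super_gen y * pd y p) = 0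
      | Suc l \<Rightarrow> length_le l ((\<Sum>y\<in>Y. super_gen y * pd y p) - super_smul (of_nat k) p))"
    and Z': "finite Z'" "\<And>Y. finite Y \<Longrightarrow> Z' \<subseteq> Y \<Longrightarrow> (case k of 0 \<Rightarrow> (\<Sum>y\<in>Y. super_gen y * pd y q) = 0
      | Suc l \<Rightarrow> length_le l ((\<Sum>y\<in>Y. super_gen y * pd y q) - super_smul (of_nat k) q))"
    by blast
  have "case k of 0 \<Rightarrow> (\<Sum>y\<in>Y. super_gen y * pd y (p + q)) = 0
      | Suc l \<Rightarrow> length_le l ((\<Sum>y\<in>Y. super_gen y * pd y (p + q)) - super_smul (of_nat k) (p + q))"
    if Y: "finite Y" "Z \<union> Z' \<subseteq> Y" for Y
  proof -
    have sum: "(\<Sum>y\<in>Y. super_gen y * pd y (p + q)) =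
       (\<Sum>y\<in>Y. super_gen y * pd y p) + (\<Sum>y\<in>Y. super_gen y * pd y q)"
      by (simp add: distrib_left sum.distrib)
    then have diff: "(\<Sum>y\<in>Y. super_gen y * pd y (p + q)) - super_smul c (p + q) =
       ((\<Sum>y\<in>Y. super_gen y * pd y p) - super_smul c p) +
       ((\<Sum>y\<in>Y. super_gen y * pd y q) - super_smul c q)" for c
      by simp
    show ?thesis
    proof (cases k)
      case 0
      then show ?thesis using Z(2)[of Y] Z'(2)[of Y] Y sum by simp
    next
      case (Suc l)
      have "length_le l ((\<Sum>y\<in>Y. super_gen y * pd y p) - super_smul (of_nat (Suc l)) p)"
        "length_le l ((\<Sum>y\<in>Y. super_gen y * pd y q) - super_smul (of_nat (Suc l)) q)"
        using Z(2)[of Y] Z'(2)[of Y] Y Suc by (simp_all del: of_nat_Suc)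
      from length_le.length_le_add[OF this] show ?thesis
        unfolding Suc nat.case diff .
    qed
  qed
  then show ?case using Z(1) Z'(1) by (intro exI[of _ "Z \<union> Z'"]) auto
next
  case (length_le_smul k p c)
  have *: "(\<Sum>y\<in>Y. super_gen y * pd y (super_smul c p)) = super_smul c (\<Sum>y\<in>Y. super_gen y * pd y p)" for Y
    by (simp add: super_smul_sum)
  have **: "(\<Sum>y\<in>Y. super_gen y * pd y (super_smul c p)) - super_smul d (super_smul c p) =
      super_smul c ((\<Sum>y\<in>Y. super_gen y * pd y p) - super_smul d p)" for Y d
    unfolding * by (simp add: mult.commute)
  from length_le_smul.IH obtain Z where Z: "finite Z" "\<And>Y. finite Y \<Longrightarrow> Z \<subseteq> Y \<Longrightarrow> (case k of 0 \<Rightarrow> (\<Sum>y\<in>Y. super_gen y * pd y p) = 0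
      | Suc l \<Rightarrow> length_le l ((\<Sum>y\<in>Y. super_gen y * pd y p) - super_smul (of_nat k) p))" by blast
  have "case k of 0 \<Rightarrow> (\<Sum>y\<in>Y. super_gen y * pd y (super_smul c p)) = 0
      | Suc l \<Rightarrow> length_le l ((\<Sum>y\<in>Y. super_gen y * pd y (super_smul c p)) - super_smul (of_nat k) (super_smul c p))"
    if Y: "finite Y" "Z \<subseteq> Y" for Y
  proof (cases k)
    case 0
    then show ?thesis using Z(2)[OF Y] unfolding * by simp
  next
    case (Suc l)
    then have "length_le l ((\<Sum>y\<in>Y. super_gen y * pd y p) - super_smul (of_nat (Suc l)) p)"
      using Z(2)[OF Y] by (simp del: of_nat_Suc)
    from length_le.length_le_smul[OF this, of c] show ?thesis unfolding Suc nat.case ** .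
  qed
  then show ?case using Z(1) by blast
qed

text \<open>
  Here the Euler operator is zero, so \<open>Suc k\<close> times \<open>p\<close> lies in the lower step of the filtration.
\<close>

lemma length_le_descend:
  assumes "length_le (Suc k) p" "\<And>y. pd y p = 0"
  shows "length_le k p"
proof -
  have "length_le k (- super_smul (of_nat (Suc k)) p)"
    using euler_length_le[OF assms(1)] assms(2) by (auto simp del: of_nat_Suc)
  then have "length_le k (super_smul (- inverse (of_nat (Suc k))) (- super_smul (of_nat (Suc k)) p))"
    by (rule length_le_smul)
  then show ?thesis by (simp add: super_smul_uminus del: of_nat_Suc)
qed

primrec pds :: "gen list \<Rightarrow> super_sym \<Rightarrow> super_sym" where
  "pds [] p = p"
| "pds (y # ys) p = pds ys (pd y p)"

abbreviation odd_gens :: "gen list \<Rightarrow> bool" where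
  "odd_gens ys \<equiv> (\<forall>y\<in>set ys. odd (gpar y))"

lemma pds_simps [simp]:
  "pds ys 0 = 0" "pds ys (p + q) = pds ys p + pds ys q" "pds ys (p - q) = pds ys p - pds ys q"
  "pds ys (super_smul c p) = super_smul c (pds ys p)"
  by (induction ys arbitrary: p q) auto

lemma pds_sum: "pds ys (sum f A) = (\<Sum>a\<in>A. pds ys (f a))"
  by (induction A rule: infinite_finite_induct) auto

lemma pds_pd_even: "even (gpar y) \<Longrightarrow> pds ys (pd y p) = pd y (pds ys p)"
  by (induction ys arbitrary: p) (simp_all add: pd_commute[of _ y] del: gpar.simps)

lemma pds_even_mult:
  "even (gpar x) \<Longrightarrow> odd_gens ys \<Longrightarrow> pds ys (super_gen x * p) = super_gen x * pds ys p"
  by (induction ys arbitrary: p) (auto simp: pd_gen_mult simp del: gpar.simps)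

definition odd_vanishing :: "super_sym \<Rightarrow> bool" where
  "odd_vanishing p \<longleftrightarrow> (\<forall>ys. odd_gens ys \<longrightarrow> proj (pds ys p) = 0)"

lemma even_gen_cases:
  assumes "even (gpar y)"
  obtains n where "y = (I1, I1, n)" | n where "y = (I2, I2, n)"
  using assms by (cases y rule: proj_gen.cases) auto

lemma odd_vanishing_pd:
  assumes "odd_vanishing p"
  shows "odd_vanishing (pd y p)"
  unfolding odd_vanishing_def
proof (intro allI impI)
  fix ys assume ys: "odd_gens ys"
  show "proj (pds ys (pd y p)) = 0"
  proof (cases "even (gpar y)")
    case True
    then show ?thesis
      using assms ys
      by (cases rule: even_gen_cases) (simp_all add: pds_pd_even proj_pd_even odd_vanishing_def)
  next
    case False
    then have "odd_gens (y # ys)" using ys by simp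
    then have "proj (pds (y # ys) p) = 0" using assms unfolding odd_vanishing_def by blast
    then show ?thesis by simp
  qed
qed

lemma length_le_0_const: "length_le 0 p \<Longrightarrow> \<exists>c. p = super_smul c 1"
proof -
  have "length_le k p \<Longrightarrow> k = 0 \<Longrightarrow> \<exists>c. p = super_smul c 1" for k
  proof (induction rule: length_le.induct)
    case length_le_one
    show ?case by (rule exI[of _ 1]) simp
  next
    case (length_le_add k p q)
    then show ?case by (metis super_smul_left_add)
  next
    case (length_le_smul k p c)
    then show ?case by (metis super_smul_simps(7))
  qed auto
  then show "length_le 0 p \<Longrightarrow> \<exists>c. p = super_smul c 1" by blast
qed

text \<open>
  The assumption is inherited by all derivatives of \<open>p\<close>: by the odd ones trivially, and by the even ones
  because they commute with \<open>proj\<close>. By induction on the length, all derivatives of \<open>p\<close> vanish, so \<open>p\<close> descends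
  in the filtration until it is a constant, and constants are detected by \<open>proj\<close>.
\<close>

lemma odd_vanishing_imp_zero:
  assumes "odd_vanishing p"
  shows "p = 0"
proof -
  have "length_le k p \<Longrightarrow> odd_vanishing p \<Longrightarrow> p = 0" for k
  proof (induction k arbitrary: p)
    case 0
    then obtain c where c: "p = super_smul c 1" using length_le_0_const by blast
    have "proj (pds [] p) = 0" using 0(2)[unfolded odd_vanishing_def, rule_format, of "[]"] by simp
    then have "smul c 1 = (0 :: (uv \<times> nat) cpoly)" by (simp add: c)
    then have "Poly_Mapping.lookup (smul c 1 :: (uv \<times> nat) cpoly) 0 = 0" by simp
    then have "c = 0" by (simp add: smul_lookup lookup_one)
    then show ?case by (simp add: c)
  next
    case (Suc k)
    have "pd y p = 0" for y
      using Suc.IH[of "pd y p"] length_le_pd[OF Suc.prems(1), of y] odd_vanishing_pd[OF Suc.prems(2)] by simp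
    then show ?case using Suc length_le_descend by blast
  qed
  then show ?thesis using assms length_le_exists by blast
qed


subsection \<open>The equations of invariance\<close>

abbreviation a_gen :: "nat \<Rightarrow> gen" where "a_gen n \<equiv> (I1, I1, n)"
abbreviation b_gen :: "nat \<Rightarrow> gen" where "b_gen n \<equiv> (I1, I2, n)"
abbreviation c_gen :: "nat \<Rightarrow> gen" where "c_gen n \<equiv> (I2, I1, n)"
abbreviation d_gen :: "nat \<Rightarrow> gen" where "d_gen n \<equiv> (I2, I2, n)"

definition s_gen :: "nat \<Rightarrow> super_sym" where
  "s_gen n = super_gen (a_gen n) + super_gen (d_gen n)"

definition pd_x :: "nat \<Rightarrow> super_sym \<Rightarrow> super_sym" where
  "pd_x n p = pd (a_gen n) p - pd (d_gen n) p"

lemma proj_s_gen: "proj (s_gen n) = svar n"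
  by (simp add: s_gen_def svar_def)

lemma proj_pds_pd_x: "proj (pds ys (pd_x n p)) = dx n (proj (pds ys p))"
  by (simp add: pd_x_def pds_pd_even proj_pd_even dx_def)

lemma pds_s_gen: "odd_gens ys \<Longrightarrow> pds ys (s_gen n * p) = s_gen n * pds ys p"
  by (simp add: s_gen_def distrib_right pds_even_mult)

lemma invariants_iff: "p \<in> invariants \<longleftrightarrow> (\<forall>e. act_basis e p = 0)"
proof
  assume p: "p \<in> invariants"
  have "act (Poly_Mapping.single e 1) p = act_basis e p" for e
    by (simp add: act_def)
  then show "\<forall>e. act_basis e p = 0" using p unfolding invariants_def by simp
qed (auto simp: invariants_def act_def simp del: split_paired_All)

lemma pd_bound: "\<exists>M. \<forall>n\<ge>M. \<forall>k l. pd (k, l, n) p = 0"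
proof -
  have "finite ((\<lambda>(k, l, n). n) ` {y. pd y p \<noteq> 0})" by (intro finite_imageI finite_pd_support)
  then obtain M where "\<And>n. n \<in> (\<lambda>(k, l, n). n) ` {y. pd y p \<noteq> 0} \<Longrightarrow> n < M"
    by (meson finite_nat_set_iff_bounded)
  then have "pd (k, l, n) p = 0" if "n \<ge> M" for k l n
    using that by force
  then show ?thesis by blast
qed

lemma UNIV_idx: "(UNIV :: idx set) = {I1, I2}"
  using idx.exhaust by auto

text \<open>
  These are the vector fields of the two odd currents: \<open>E\<^sub>1\<^sub>2[r]\<close> sends \<open>c\<^sub>n\<close> to \<open>s\<^sub>n\<^sub>-\<^sub>r\<close> and \<open>x\<^sub>n\<close> to \<open>- b\<^sub>n\<^sub>-\<^sub>r\<close>,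
  while \<open>E\<^sub>2\<^sub>1[r]\<close> sends \<open>b\<^sub>n\<close> to \<open>s\<^sub>n\<^sub>-\<^sub>r\<close> and \<open>x\<^sub>n\<close> to \<open>c\<^sub>n\<^sub>-\<^sub>r\<close>.
\<close>

lemma act_basis_odd_eq_sum:
  assumes "\<And>n k l. n \<ge> M \<Longrightarrow> pd (k, l, n) p = 0"
  shows "act_basis (I1, I2, r) p =
      (\<Sum>n\<in>{r..<M}. s_gen (n - r) * pd (c_gen n) p + super_smul (-1) (super_gen (b_gen (n - r)) * pd_x n p))"
    and "act_basis (I2, I1, r) p =
      (\<Sum>n\<in>{r..<M}. s_gen (n - r) * pd (b_gen n) p + super_smul 1 (super_gen (c_gen (n - r)) * pd_x n p))"
proof -
  \<comment> \<open>a box containing all generators on which \<open>p\<close> depends, with the mode first so that the sum splits by modes\<close>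
  let ?Y = "(\<lambda>(n, k, l). (k, l, n)) ` ({..<M} \<times> (UNIV :: idx set) \<times> (UNIV :: idx set))"
  have "finite (UNIV :: idx set)" by (simp add: UNIV_idx)
  then have Y: "finite ?Y" by (intro finite_imageI finite_cartesian_product finite_lessThan)
  have Y': "{y. pd y p \<noteq> 0} \<subseteq> ?Y"
  proof clarify
    fix k l n assume "pd (k, l, n) p \<noteq> 0"
    then have "n < M" using assms not_le by blast
    then show "(k, l, n) \<in> ?Y" by (intro image_eqI[of _ _ "(n, k, l)"]) auto
  qed
  have inj: "inj_on (\<lambda>(n, k, l). (k, l, n)) ({..<M} \<times> (UNIV :: idx set) \<times> (UNIV :: idx set))"
    by (auto simp: inj_on_def)
  have sum: "act_basis e p = (\<Sum>n<M. ad_super e (a_gen n) * pd (a_gen n) p + ad_super e (b_gen n) * pd (b_gen n) p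
      + ad_super e (c_gen n) * pd (c_gen n) p + ad_super e (d_gen n) * pd (d_gen n) p)" for e
    unfolding act_basis_eq_sum_pd[OF Y Y'] sum.reindex[OF inj]
    by (simp add: sum.cartesian_product' UNIV_idx add.assoc split_def comp_def)
  show "act_basis (I1, I2, r) p =
      (\<Sum>n\<in>{r..<M}. s_gen (n - r) * pd (c_gen n) p + super_smul (-1) (super_gen (b_gen (n - r)) * pd_x n p))"
    unfolding sum
    by (rule sum.mono_neutral_cong_right)
       (auto simp: ad_super_eq s_gen_def pd_x_def algebra_simps)
  show "act_basis (I2, I1, r) p =
      (\<Sum>n\<in>{r..<M}. s_gen (n - r) * pd (b_gen n) p + super_smul 1 (super_gen (c_gen (n - r)) * pd_x n p))"
    unfolding sum
    by (rule sum.mono_neutral_cong_right)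
       (auto simp: ad_super_eq s_gen_def pd_x_def algebra_simps)
qed

text \<open>
  By the Leibniz rule, every term either still contains the odd generator \<open>y\<close>, and is killed by \<open>proj\<close>, or
  has spent one of the derivatives on \<open>y\<close>, so that fewer of them act on \<open>p\<close>.
\<close>

lemma proj_pds_odd_mult:
  assumes "odd (gpar y)" "odd_gens ys"
    "\<And>zs. odd_gens zs \<Longrightarrow> length zs < length ys \<Longrightarrow> proj (pds zs p) = 0"
  shows "proj (pds ys (super_gen y * p)) = 0"
  using assms(2,3)
proof (induction ys arbitrary: p)
  case Nil
  then show ?case using assms(1) by (simp add: proj_gen_odd)
next
  case (Cons z ys)
  have "proj (pds zs (pd z p)) = 0" if "odd_gens zs" "length zs < length ys" for zs
    using Cons.prems(2)[of "z # zs"] that Cons.prems(1) by simp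
  then have "proj (pds ys (super_gen y * pd z p)) = 0"
    using Cons by simp
  moreover have "proj (pds ys p) = 0" using Cons.prems by simp
  ultimately show ?case by (simp add: pd_gen_mult)
qed

text \<open>
  Solve from the last unknown backwards; the diagonal coefficient is \<open>s\<^sub>0\<close>.
\<close>

lemma triangular_system_zero:
  assumes "\<And>r. (\<Sum>n\<in>{r..<M}. svar (n - r) * f n) = 0" "n < M"
  shows "f n = 0"
  using assms(2)
proof (induction "M - n" arbitrary: n rule: less_induct)
  case less
  have "(\<Sum>m\<in>{n..<M}. svar (m - n) * f m) = svar 0 * f n + (\<Sum>m\<in>{Suc n..<M}. svar (m - n) * f m)"
    using less.prems by (simp add: sum.atLeast_Suc_lessThan)
  also have "(\<Sum>m\<in>{Suc n..<M}. svar (m - n) * f m) = 0"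
    by (intro sum.neutral ballI) (use less in auto)
  finally have "svar 0 * f n = 0" using assms(1) by simp
  then show ?case by (rule s0_nonzerodivisor)
qed

text \<open>
  It is shown by induction on their number that odd derivatives of \<open>p\<close> project to zero. After \<open>k\<close> odd
  derivatives and the projection, the terms with \<open>\<partial>/\<partial>x\<close> in the equations of \<open>E\<^sub>1\<^sub>2[r]\<close> and \<open>E\<^sub>2\<^sub>1[r]\<close> involve fewer
  than \<open>k\<close> odd derivatives and vanish. A triangular system for the derivatives of order \<open>k + 1\<close> remains.
\<close>

lemma invariant_proj_zero:
  assumes "p \<in> invariants" "proj p = 0"
  shows "p = 0"
proof (rule odd_vanishing_imp_zero)
  obtain M where M: "\<And>n k l. n \<ge> M \<Longrightarrow> pd (k, l, n) p = 0"
    using pd_bound by blast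
  have inv: "act_basis e p = 0" for e using assms(1) by (simp add: invariants_iff del: split_paired_All)
  have act_eq:
    "(\<Sum>n\<in>{r..<M}. s_gen (n - r) * pd (c_gen n) p + super_smul (-1) (super_gen (b_gen (n - r)) * pd_x n p)) = 0"
    "(\<Sum>n\<in>{r..<M}. s_gen (n - r) * pd (b_gen n) p + super_smul 1 (super_gen (c_gen (n - r)) * pd_x n p)) = 0"
    for r
    by (subst act_basis_odd_eq_sum [symmetric], rule M, assumption, rule inv)+
  have vanish: "\<forall>ys. odd_gens ys \<longrightarrow> length ys \<le> k \<longrightarrow> proj (pds ys p) = 0" for k
  proof (induction k)
    case 0
    then show ?case using assms(2) by simp
  next
    case (Suc k)
    have key: "proj (pds ys (pd (y n) p)) = 0"
      if ys: "odd_gens ys" "length ys \<le> k" and z: "\<And>n. odd (gpar (z n))"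
        and eq: "\<And>r. (\<Sum>n\<in>{r..<M}. s_gen (n - r) * pd (y n) p + super_smul c (super_gen (z (n - r)) * pd_x n p)) = 0"
        and y: "\<And>n. n \<ge> M \<Longrightarrow> pd (y n) p = 0"
      for ys y z c n
    proof (cases "n < M")
      case True
      have "(\<Sum>n\<in>{r..<M}. svar (n - r) * proj (pds ys (pd (y n) p))) = 0" for r
      proof -
        have "proj (pds ys (super_gen (z (n - r)) * pd_x n p)) = 0" for n
          by (rule proj_pds_odd_mult) (use z ys Suc in \<open>auto simp: proj_pds_pd_x\<close>)
        then have "(\<Sum>n\<in>{r..<M}. svar (n - r) * proj (pds ys (pd (y n) p))) =
            proj (pds ys (\<Sum>n\<in>{r..<M}. s_gen (n - r) * pd (y n) p + super_smul c (super_gen (z (n - r)) * pd_x n p)))"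
          using ys by (simp add: pds_sum proj_sum pds_s_gen proj_s_gen)
        then show ?thesis unfolding eq by simp
      qed
      from triangular_system_zero[OF this True] show ?thesis .
    qed (use y in simp)
    show ?case
    proof (intro allI impI)
      fix ys assume ys: "odd_gens ys" "length ys \<le> Suc k"
      show "proj (pds ys p) = 0"
      proof (cases ys)
        case Nil
        then show ?thesis using assms(2) by simp
      next
        case (Cons y zs)
        obtain n where "y = b_gen n \<or> y = c_gen n"
          using ys(1) Cons by (cases y rule: proj_gen.cases) auto
        then show ?thesis
        proof
          assume "y = b_gen n"
          moreover have "proj (pds zs (pd (b_gen n) p)) = 0"
            by (rule key[where z = c_gen and c = 1, OF _ _ _ act_eq(2)]) (use ys Cons M in auto)
          ultimately show ?thesis by (simp add: Cons)
        next
          assume "y = c_gen n"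
          moreover have "proj (pds zs (pd (c_gen n) p)) = 0"
            by (rule key[where z = b_gen and c = "-1", OF _ _ _ act_eq(1)]) (use ys Cons M in auto)
          ultimately show ?thesis by (simp add: Cons)
        qed
      qed
    qed
  qed
  show "odd_vanishing p"
    unfolding odd_vanishing_def using vanish by blast
qed

text \<open>
  Compare the coefficients of \<open>b\<^sub>0\<close> in \<open>E\<^sub>1\<^sub>2[r] p = 0\<close>. Up to sign, \<open>g m\<close> is the coefficient of \<open>b\<^sub>0 c\<^sub>m\<close> in \<open>p\<close>.
\<close>

lemma invariant_proj_divisible:
  assumes "p \<in> invariants"
  shows "\<exists>g L. (\<forall>m\<ge>L. g m = 0) \<and> (\<forall>r. dx r (proj p) = (\<Sum>l<L. svar l * g (r + l)))"
proof -
  obtain M where M: "\<And>n k l. n \<ge> M \<Longrightarrow> pd (k, l, n) p = 0"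
    using pd_bound by blast
  define g where "g m = proj (pd (b_gen 0) (pd (c_gen m) p))" for m
  have "dx r (proj p) = (\<Sum>l<M. svar l * g (r + l))" for r
  proof -
    have summand: "proj (pds [b_gen 0] (s_gen (n - r) * pd (c_gen n) p +
          super_smul (-1) (super_gen (b_gen (n - r)) * pd_x n p))) =
        svar (n - r) * g n - (if n = r then dx r (proj p) else 0)" if "r \<le> n" for n
    proof -
      have "proj (pds [b_gen 0] (s_gen (n - r) * pd (c_gen n) p)) = svar (n - r) * g n"
        by (subst pds_s_gen) (simp_all add: proj_s_gen g_def)
      moreover have "proj (pd (b_gen 0) (super_gen (b_gen (n - r)) * pd_x n p)) =
          (if n = r then dx r (proj p) else 0)"
        using that proj_pds_pd_x[of "[]" r p] by (simp add: pd_gen_mult)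
      ultimately show ?thesis by simp
    qed
    have "0 = proj (pds [b_gen 0] (act_basis (I1, I2, r) p))"
      using assms by (simp add: invariants_iff)
    also have "act_basis (I1, I2, r) p = (\<Sum>n\<in>{r..<M}. s_gen (n - r) * pd (c_gen n) p +
        super_smul (-1) (super_gen (b_gen (n - r)) * pd_x n p))"
      by (rule act_basis_odd_eq_sum(1)) (rule M)
    also have "proj (pds [b_gen 0] \<dots>) = (\<Sum>n\<in>{r..<M}. svar (n - r) * g n - (if n = r then dx r (proj p) else 0))"
      unfolding pds_sum proj_sum by (rule sum.cong) (use summand in auto)
    also have "\<dots> = (\<Sum>n\<in>{r..<M}. svar (n - r) * g n) - (if r < M then dx r (proj p) else 0)"
      by (simp add: sum_subtractf)
    also have "(if r < M then dx r (proj p) else 0) = dx r (proj p)"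
      using proj_pds_pd_x[of "[]" r p] M[of r] by (auto simp: pd_x_def)
    finally have "dx r (proj p) = (\<Sum>n\<in>{r..<M}. svar (n - r) * g n)" by simp
    also have "\<dots> = (\<Sum>l<M - r. svar l * g (r + l))"
      by (rule sum.reindex_bij_witness[of _ "\<lambda>l. r + l" "\<lambda>n. n - r"]) auto
    also have "\<dots> = (\<Sum>l<M. svar l * g (r + l))"
      by (rule sum.mono_neutral_left) (auto simp: g_def M)
    finally show ?thesis .
  qed
  moreover have "\<forall>m\<ge>M. g m = 0" by (simp add: g_def M)
  ultimately show ?thesis by blast
qed


section \<open>Taylor expansion in the coordinates s and x\<close>

primrec dss :: "nat list \<Rightarrow> (uv \<times> nat) cpoly \<Rightarrow> (uv \<times> nat) cpoly" where
  "dss [] p = p"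
| "dss (n # ns) p = dss ns (ds n p)"

lemma dss_simps [simp]:
  "dss ns 0 = 0" "dss ns (p + q) = dss ns p + dss ns q" "dss ns (smul c p) = smul c (dss ns p)"
  by (induction ns arbitrary: p q) auto

lemma dss_dx: "dss ns (dx i p) = dx i (dss ns p)"
  by (induction ns arbitrary: p) (auto simp: ds_dx_commute)

definition delete_nth :: "nat \<Rightarrow> 'a list \<Rightarrow> 'a list" where
  "delete_nth j xs = take j xs @ drop (Suc j) xs"

lemma delete_nth_simps [simp]:
  "delete_nth 0 (x # xs) = xs" "delete_nth (Suc j) (x # xs) = x # delete_nth j xs"
  by (simp_all add: delete_nth_def)

lemma dss_svar_mult:
  "dss ns (svar l * q) =
     svar l * dss ns q + (\<Sum>j<length ns. if ns ! j = l then dss (delete_nth j ns) q else 0)"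
proof (induction ns arbitrary: q)
  case (Cons n ns)
  show ?case
    by (auto simp: Cons sum.lessThan_Suc_shift simp del: sum.lessThan_Suc intro!: sum.cong)
qed simp

text \<open>
  Up to the factor \<open>d!\<close>, \<open>xjet M d p ns\<close> is the part of degree \<open>d\<close> in \<open>x\<close> at \<open>s = 0\<close> of the derivative of \<open>p\<close> by
  \<open>s\<^sub>n\<close> for \<open>n\<close> in \<open>ns\<close>. The recursion is Euler's identity; \<open>M\<close> bounds the indices of the variables.
\<close>

primrec xjet :: "nat \<Rightarrow> nat \<Rightarrow> (uv \<times> nat) cpoly \<Rightarrow> nat list \<Rightarrow> (uv \<times> nat) cpoly" where
  "xjet M 0 p ns = smul (const_term (dss ns p)) 1"
| "xjet M (Suc d) p ns = (\<Sum>i<M. xvar i * xjet M d (dx i p) ns)"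

lemma xjet_simps [simp]:
  "xjet M d 0 ns = 0" "xjet M d (p + q) ns = xjet M d p ns + xjet M d q ns"
  "xjet M d (smul c p) ns = smul c (xjet M d p ns)"
  by (induction d arbitrary: p q)
     (auto simp: lookup_add smul_left_add smul_lookup smul_smul distrib_left sum.distrib smul_sum
        smul_mult_right_comm)

lemma xjet_sum: "xjet M d (sum f A) ns = (\<Sum>a\<in>A. xjet M d (f a) ns)"
  by (induction A rule: infinite_finite_induct) auto

text \<open>
  At \<open>s = 0\<close> only those terms of the Leibniz rule survive in which \<open>s\<^sub>l\<close> is differentiated.
\<close>

lemma xjet_svar_mult:
  "xjet M d (svar l * q) ns =
     (\<Sum>j<length ns. if ns ! j = l then xjet M d q (delete_nth j ns) else 0)"
proof (induction d arbitrary: q)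
  case 0
  have sum: "const_term (sum f A) = (\<Sum>a\<in>A. const_term (f a))" for f and A :: "nat set"
    by (rule lookup_sum)
  have smul_sum': "smul (sum f A) 1 = (\<Sum>a\<in>A. smul (f a) 1)" for f and A :: "nat set"
    by (induction A rule: infinite_finite_induct) (auto simp: smul_left_add)
  show ?case
    by (auto simp: dss_svar_mult lookup_add const_term_coord_mult sum smul_sum' intro!: sum.cong)
next
  case (Suc d)
  have "xjet M (Suc d) (svar l * q) ns =
      (\<Sum>i<M. \<Sum>j<length ns. if ns ! j = l then xvar i * xjet M d (dx i q) (delete_nth j ns) else 0)"
    by (simp add: Suc sum_distrib_left if_distrib cong: if_cong)
  also have "\<dots> = (\<Sum>j<length ns. if ns ! j = l then xjet M (Suc d) q (delete_nth j ns) else 0)"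
    by (subst sum.swap) (auto intro!: sum.cong)
  finally show ?case .
qed


subsection \<open>Bihomogeneous polynomials\<close>

text \<open>
  Polynomials of degree \<open>N\<close> in \<open>s\<close> and \<open>d\<close> in \<open>x\<close>, in the variables with index below \<open>M\<close>.
\<close>

inductive bihom :: "nat \<Rightarrow> nat \<Rightarrow> nat \<Rightarrow> (uv \<times> nat) cpoly \<Rightarrow> bool" for M where
  bihom_one: "bihom M 0 0 1"
| bihom_zero: "bihom M N d 0"
| bihom_add: "bihom M N d p \<Longrightarrow> bihom M N d q \<Longrightarrow> bihom M N d (p + q)"
| bihom_smul: "bihom M N d p \<Longrightarrow> bihom M N d (smul c p)"
| bihom_s: "bihom M N d p \<Longrightarrow> n < M \<Longrightarrow> bihom M (Suc N) d (svar n * p)"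
| bihom_x: "bihom M N d p \<Longrightarrow> n < M \<Longrightarrow> bihom M N (Suc d) (xvar n * p)"

lemma bihom_ds: "bihom M N d p \<Longrightarrow> (case N of 0 \<Rightarrow> ds n p = 0 | Suc N' \<Rightarrow> bihom M N' d (ds n p))"
proof (induction rule: bihom.induct)
  case (bihom_s N d p m)
  have "bihom M N d (svar m * ds n p)"
    using bihom_s by (cases N) (auto intro: bihom.intros)
  then show ?case using bihom_s by (auto intro: bihom.intros)
qed (auto split: nat.splits intro: bihom.intros)

lemma bihom_dx: "bihom M N d p \<Longrightarrow> (case d of 0 \<Rightarrow> dx n p = 0 | Suc d' \<Rightarrow> bihom M N d' (dx n p))"
proof (induction rule: bihom.induct)
  case (bihom_x N d p m)
  have "bihom M N d (xvar m * dx n p)"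
    using bihom_x by (cases d) (auto intro: bihom.intros)
  then show ?case using bihom_x by (auto intro: bihom.intros)
qed (auto split: nat.splits intro: bihom.intros)

lemma bihom_dss:
  "bihom M N d p \<Longrightarrow> if length ns \<le> N then bihom M (N - length ns) d (dss ns p) else dss ns p = 0"
proof (induction ns arbitrary: N p)
  case (Cons n ns)
  show ?case
  proof (cases N)
    case 0
    then show ?thesis using bihom_ds[OF Cons.prems, of n] by simp
  next
    case (Suc N')
    then show ?thesis using bihom_ds[OF Cons.prems, of n] Cons.IH[of N' "ds n p"] by simp
  qed
qed simp

lemma bihom_const_term: "bihom M N d p \<Longrightarrow> (if N = 0 \<and> d = 0 then p = smul (const_term p) 1 else const_term p = 0)"
proof (induction rule: bihom.induct)
  case bihom_one
  then show ?case by (simp add: lookup_one)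
next
  case (bihom_add N d p q)
  then show ?case by (auto simp: lookup_add smul_left_add split: if_splits)
next
  case (bihom_smul N d p c)
  then show ?case by (auto simp: smul_lookup simp flip: smul_smul split: if_splits)
qed (auto simp: const_term_coord_mult)

lemma bihom_euler_s: "bihom M N d p \<Longrightarrow> (\<Sum>n<M. svar n * ds n p) = of_nat N * p"
proof (induction rule: bihom.induct)
  case (bihom_add N d p q)
  then show ?case by (simp add: distrib_left sum.distrib)
next
  case (bihom_smul N d p c)
  then show ?case by (simp add: smul_mult_right_comm flip: smul_sum)
next
  case (bihom_s N d p m)
  have "(\<Sum>n<M. svar n * ds n (svar m * p)) = (\<Sum>n<M. (if n = m then svar m * p else 0) + svar m * (svar n * ds n p))"
    by (intro sum.cong) (auto simp: distrib_left mult.left_commute)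
  also have "\<dots> = svar m * p + svar m * (\<Sum>n<M. svar n * ds n p)"
    using bihom_s.hyps(2) by (simp add: sum.distrib sum_distrib_left)
  finally show ?case using bihom_s by (simp add: distrib_right distrib_left mult.left_commute)
next
  case (bihom_x N d p m)
  have "(\<Sum>n<M. svar n * ds n (xvar m * p)) = xvar m * (\<Sum>n<M. svar n * ds n p)"
    by (simp add: sum_distrib_left mult.left_commute)
  then show ?case using bihom_x by (simp add: mult.left_commute)
qed auto

lemma bihom_euler_x: "bihom M N d p \<Longrightarrow> (\<Sum>n<M. xvar n * dx n p) = of_nat d * p"
proof (induction rule: bihom.induct)
  case (bihom_add N d p q)
  then show ?case by (simp add: distrib_left sum.distrib)
next
  case (bihom_smul N d p c)
  then show ?case by (simp add: smul_mult_right_comm flip: smul_sum)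
next
  case (bihom_x N d p m)
  have "(\<Sum>n<M. xvar n * dx n (xvar m * p)) = (\<Sum>n<M. (if n = m then xvar m * p else 0) + xvar m * (xvar n * dx n p))"
    by (intro sum.cong) (auto simp: distrib_left mult.left_commute)
  also have "\<dots> = xvar m * p + xvar m * (\<Sum>n<M. xvar n * dx n p)"
    using bihom_x.hyps(2) by (simp add: sum.distrib sum_distrib_left)
  finally show ?case using bihom_x by (simp add: distrib_right distrib_left mult.left_commute)
next
  case (bihom_s N d p m)
  have "(\<Sum>n<M. xvar n * dx n (svar m * p)) = svar m * (\<Sum>n<M. xvar n * dx n p)"
    by (simp add: sum_distrib_left mult.left_commute)
  then show ?case using bihom_s by (simp add: mult.left_commute)
qed auto

lemma bihom_bounded: "bihom M N d p \<Longrightarrow> M \<le> i \<Longrightarrow> ds i p = 0 \<and> dx i p = 0"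
  by (induction rule: bihom.induct) auto

text \<open>
  A derivative of complementary order of a bihomogeneous polynomial is a constant, all other constant terms
  vanish, and iterating Euler's identity in \<open>x\<close> produces the factor \<open>d!\<close>.
\<close>

lemma xjet_bihom:
  assumes "bihom M N' d' p" "length ns = N"
  shows "xjet M d p ns = (if N' = N \<and> d' = d then of_nat (fact d) * dss ns p else 0)"
  using assms
proof (induction d arbitrary: p d')
  case 0
  show ?case
  proof (cases "N \<le> N'")
    case True
    then have "bihom M (N' - N) d' (dss ns p)" using bihom_dss[OF 0(1), of ns] 0(2) by simp
    from bihom_const_term[OF this] True show ?thesis by (auto split: if_splits)
  next
    case False
    then show ?thesis using bihom_dss[OF 0(1), of ns] 0(2) by simp
  qed
next
  case (Suc d)
  show ?case
  proof (cases d')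
    case 0
    then have "dx i p = 0" for i using bihom_dx[OF Suc.prems(1), of i] by simp
    then show ?thesis using 0 by simp
  next
    case (Suc e)
    then have "bihom M N' e (dx i p)" for i using bihom_dx[OF Suc.prems(1), of i] by simp
    then have jet: "xjet M d (dx i p) ns = (if N' = N \<and> e = d then of_nat (fact d) * dss ns (dx i p) else 0)" for i
      using Suc.IH Suc.prems by blast
    show ?thesis
    proof (cases "N' = N \<and> e = d")
      case True
      then have "bihom M 0 (Suc d) (dss ns p)"
        using bihom_dss[OF Suc.prems(1), of ns] Suc.prems(2) Suc by simp
      from bihom_euler_x[OF this] have "(\<Sum>i<M. xvar i * dx i (dss ns p)) = of_nat (Suc d) * dss ns p" .
      then have "(\<Sum>i<M. of_nat (fact d) * (xvar i * dx i (dss ns p))) = of_nat (fact d) * (of_nat (Suc d) * dss ns p)"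
        by (simp only: sum_distrib_left [symmetric])
      then show ?thesis
        using True Suc by (simp add: jet dss_dx algebra_simps)
    qed (use Suc jet in auto)
  qed
qed

definition index_lists :: "nat \<Rightarrow> nat \<Rightarrow> nat list set" where
  "index_lists M N = {ns. set ns \<subseteq> {..<M} \<and> length ns = N}"

lemma finite_index_lists [simp]: "finite (index_lists M N)"
  by (simp add: index_lists_def finite_lists_length_eq)

lemma sum_index_lists_Suc:
  "(\<Sum>ns\<in>index_lists M (Suc N). G ns) = (\<Sum>n<M. \<Sum>ns\<in>index_lists M N. G (n # ns))"
proof -
  have eq: "index_lists M (Suc N) = (\<lambda>(n, ns). n # ns) ` ({..<M} \<times> index_lists M N)"
    by (auto simp: index_lists_def length_Suc_conv image_iff)
  have "inj_on (\<lambda>(n, ns). n # ns) ({..<M} \<times> index_lists M N)"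
    by (auto simp: inj_on_def)
  then show ?thesis
    unfolding eq by (simp add: sum.reindex sum.cartesian_product split_def)
qed

lemma sum_svar_dss:
  "bihom M N d p \<Longrightarrow> (\<Sum>ns\<in>index_lists M N. prod_list (map svar ns) * dss ns p) = of_nat (fact N) * p"
proof (induction N arbitrary: p)
  case 0
  have "index_lists M 0 = {[]}" by (auto simp: index_lists_def)
  then show ?case by simp
next
  case (Suc N)
  have "(\<Sum>ns\<in>index_lists M (Suc N). prod_list (map svar ns) * dss ns p) =
      (\<Sum>n<M. svar n * (\<Sum>ns\<in>index_lists M N. prod_list (map svar ns) * dss ns (ds n p)))"
    by (simp add: sum_index_lists_Suc sum_distrib_left mult.assoc)
  also have "\<dots> = (\<Sum>n<M. svar n * (of_nat (fact N) * ds n p))"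
    using Suc.IH bihom_ds[OF Suc.prems] by simp
  also have "\<dots> = of_nat (fact N) * (\<Sum>n<M. svar n * ds n p)"
    by (simp add: sum_distrib_left mult.left_commute)
  finally show ?case
    by (simp add: bihom_euler_s[OF Suc.prems] algebra_simps)
qed

definition taylor_part :: "nat \<Rightarrow> nat \<Rightarrow> nat \<Rightarrow> (uv \<times> nat) cpoly \<Rightarrow> (uv \<times> nat) cpoly" where
  "taylor_part M N d p = (\<Sum>ns\<in>index_lists M N. prod_list (map svar ns) * xjet M d p ns)"

lemma taylor_part_bihom:
  assumes "bihom M N' d' p"
  shows "taylor_part M N d p = (if N' = N \<and> d' = d then of_nat (fact N * fact d) * p else 0)"
proof -
  have "taylor_part M N d p = (\<Sum>ns\<in>index_lists M N.
      if N' = N \<and> d' = d then of_nat (fact d) * (prod_list (map svar ns) * dss ns p) else 0)"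
    unfolding taylor_part_def
    by (intro sum.cong refl) (auto simp: xjet_bihom[OF assms] index_lists_def mult.left_commute)
  also have "\<dots> = (if N' = N \<and> d' = d then of_nat (fact N * fact d) * p else 0)"
    using sum_svar_dss assms by (auto simp: mult_ac simp flip: sum_distrib_left)
  finally show ?thesis .
qed

inductive bideg_le :: "nat \<Rightarrow> nat \<Rightarrow> (uv \<times> nat) cpoly \<Rightarrow> bool" for M K where
  bideg_le_bihom: "bihom M N d p \<Longrightarrow> N \<le> K \<Longrightarrow> d \<le> K \<Longrightarrow> bideg_le M K p"
| bideg_le_add: "bideg_le M K p \<Longrightarrow> bideg_le M K q \<Longrightarrow> bideg_le M K (p + q)"

lemma bihom_mono: "bihom M N d p \<Longrightarrow> M \<le> M' \<Longrightarrow> bihom M' N d p"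
  by (induction rule: bihom.induct) (auto intro: bihom.intros)

lemma bideg_le_mono: "bideg_le M K p \<Longrightarrow> M \<le> M' \<Longrightarrow> K \<le> K' \<Longrightarrow> bideg_le M' K' p"
proof (induction rule: bideg_le.induct)
  case (bideg_le_bihom N d p)
  then show ?case by (meson bideg_le.bideg_le_bihom bihom_mono order_trans)
qed (auto intro: bideg_le.intros)

lemma bideg_le_smul: "bideg_le M K p \<Longrightarrow> bideg_le M K (smul c p)"
  by (induction rule: bideg_le.induct) (auto simp: smul_add intro: bideg_le.intros bihom.intros)

lemma bideg_le_coord_mult:
  "bideg_le M K p \<Longrightarrow> n < M \<Longrightarrow> bideg_le M (Suc K) (svar n * p) \<and> bideg_le M (Suc K) (xvar n * p)"
proof (induction rule: bideg_le.induct)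
  case (bideg_le_bihom N d p)
  then have "bihom M (Suc N) d (svar n * p)" "bihom M N (Suc d) (xvar n * p)"
    by (auto intro: bihom.intros)
  then show ?case using bideg_le_bihom by (auto intro: bideg_le.bideg_le_bihom)
qed (auto simp: distrib_left intro: bideg_le.intros)

lemma bideg_le_exists: "\<exists>M K. bideg_le M K p"
proof (induction p rule: sx_induct)
  case (add p q)
  then obtain M K M' K' where "bideg_le M K p" "bideg_le M' K' q" by blast
  then have "bideg_le (max M M') (max K K') p" "bideg_le (max M M') (max K K') q"
    by (auto intro: bideg_le_mono)
  then show ?case by (blast intro: bideg_le_add)
next
  case (s n p)
  then obtain M K where "bideg_le M K p" by blast
  then have "bideg_le (max M (Suc n)) K p" by (auto intro: bideg_le_mono)
  from bideg_le_coord_mult[OF this, of n] show ?case by (auto simp: less_max_iff_disj)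
next
  case (x n p)
  then obtain M K where "bideg_le M K p" by blast
  then have "bideg_le (max M (Suc n)) K p" by (auto intro: bideg_le_mono)
  from bideg_le_coord_mult[OF this, of n] show ?case by (auto simp: less_max_iff_disj)
next
  case (smul c p)
  then show ?case using bideg_le_smul by blast
qed (blast intro: bideg_le_bihom bihom.intros order_refl)+

lemma taylor_part_add: "taylor_part M N d (p + q) = taylor_part M N d p + taylor_part M N d q"
  by (simp add: taylor_part_def distrib_left sum.distrib)

text \<open>
  Each part of the Taylor expansion sees only its own bihomogeneous component, which it multiplies by
  \<open>N! d!\<close>. So the expansion recovers \<open>p\<close> without a projection onto components.
\<close>

lemma taylor_expansion:
  "bideg_le M K p \<Longrightarrow>
     p = (\<Sum>N\<le>K. \<Sum>d\<le>K. smul (1 / (fact N * fact d)) (taylor_part M N d p))"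
proof (induction rule: bideg_le.induct)
  case (bideg_le_bihom N d p)
  have coef: "smul (1 / (fact N * fact d)) (of_nat (fact N * fact d) * p) = p"
    by (simp add: smul_def mult_single flip: single_of_nat mult.assoc)
  have "(\<Sum>N'\<le>K. \<Sum>d'\<le>K. smul (1 / (fact N' * fact d')) (taylor_part M N' d' p)) =
      (\<Sum>N'\<le>K. \<Sum>d'\<le>K. if N' = N \<and> d' = d then p else 0)"
    by (intro sum.cong refl) (use coef in \<open>auto simp: taylor_part_bihom[OF bideg_le_bihom(1)]\<close>)
  also have "\<dots> = (\<Sum>N'\<le>K. if N' = N then p else 0)"
    using bideg_le_bihom(3) by (intro sum.cong refl) auto
  also have "\<dots> = p" using bideg_le_bihom(2) by simp
  finally show ?case by simp
next
  case (bideg_le_add p q)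
  then show ?case by (simp add: taylor_part_add smul_add sum.distrib)
qed

lemma bideg_le_bounded: "bideg_le M K p \<Longrightarrow> M \<le> i \<Longrightarrow> ds i p = 0 \<and> dx i p = 0"
  by (induction rule: bideg_le.induct) (auto dest: bihom_bounded)


section \<open>Shifts of coefficient families\<close>

text \<open>
  Composition of a family with \<open>bump j i\<close> is the operator \<open>S\<^sub>j\<^sup>i\<close>, the \<open>i\<close>-fold shift of the \<open>j\<close>-th index.
\<close>

definition bump :: "nat \<Rightarrow> nat \<Rightarrow> nat list \<Rightarrow> nat list" where
  "bump j i ns = ns[j := ns ! j + i]"

lemma length_bump [simp]: "length (bump j i ns) = length ns"
  by (simp add: bump_def)

lemma bump_0 [simp]: "bump j 0 ns = ns"
  by (simp add: bump_def)

lemma bump_bump: "bump j i (bump j k ns) = bump j (k + i) ns"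
  by (cases "j < length ns") (auto simp: bump_def add.assoc list_update_beyond)

lemma bump_commute: "bump j i (bump k l ns) = bump k l (bump j i ns)"
proof (cases "j = k")
  case True
  then show ?thesis by (simp add: bump_bump add.commute)
next
  case False
  then show ?thesis by (simp add: bump_def list_update_swap)
qed

lemma nth_bump: "j < length ns \<Longrightarrow> bump j i ns ! k = (if k = j then ns ! j + i else ns ! k)"
  by (auto simp: bump_def)

lemma delete_nth_bump: "delete_nth j (bump j i ns) = delete_nth j ns"
  by (simp add: delete_nth_def bump_def)

lemma sum_list_bump: "j < length ns \<Longrightarrow> sum_list (bump j i ns) = sum_list ns + i"
  using elem_le_sum_list[of j ns] by (simp add: bump_def sum_list_update)

type_synonym family = "nat list \<Rightarrow> (uv \<times> nat) cpoly"

definition supported :: "nat \<Rightarrow> nat \<Rightarrow> (nat list \<Rightarrow> 'a::zero) \<Rightarrow> bool" where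
  "supported N B F \<longleftrightarrow> (\<forall>ns. F ns \<noteq> 0 \<longrightarrow> length ns = N \<and> sum_list ns < B)"

lemma supported_mono: "supported N B F \<Longrightarrow> B \<le> B' \<Longrightarrow> supported N B' F"
  by (force simp: supported_def)

text \<open>
  The operator \<open>\<Sum>i. x\<^sub>i S\<^sub>j\<^sup>i\<close>. Summation over the support gives it a meaning without fixing a bound.
\<close>

definition raise :: "nat \<Rightarrow> family \<Rightarrow> family" where
  "raise j F ns = (\<Sum>i | F (bump j i ns) \<noteq> 0. xvar i * F (bump j i ns))"

lemma supported_bump_less: "supported N B F \<Longrightarrow> j < N \<Longrightarrow> F (bump j i ns) \<noteq> 0 \<Longrightarrow> i < B"
  unfolding supported_def using sum_list_bump[of j ns i] by force

lemma raise_eq: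
  assumes "supported N B F" "j < N"
  shows "raise j F ns = (\<Sum>i<B. xvar i * F (bump j i ns))"
  unfolding raise_def using supported_bump_less[OF assms]
  by (intro sum.mono_neutral_left) auto

lemma supported_bump: "supported N B F \<Longrightarrow> j < N \<Longrightarrow> supported N B (\<lambda>ns. F (bump j i ns))"
  unfolding supported_def using sum_list_bump[of j _ i] by force

lemma supported_raise:
  assumes "supported N B F" "j < N"
  shows "supported N B (raise j F)"
  unfolding supported_def
proof (intro allI impI)
  fix ns assume "raise j F ns \<noteq> 0"
  then obtain i where "F (bump j i ns) \<noteq> 0"
    unfolding raise_def by (metis (mono_tags, lifting) mult_zero_right sum.neutral)
  then show "length ns = N \<and> sum_list ns < B"
    using supported_bump[OF assms] unfolding supported_def by blast
qed

text \<open>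
  The families obtained from constants by sums and the operators \<open>raise j\<close>. The aim is to show that the
  families of Taylor coefficients of suitable polynomials are of this form.
\<close>

inductive conv_family :: "nat \<Rightarrow> family \<Rightarrow> bool" for N where
  conv_family_const: "supported N B v \<Longrightarrow> conv_family N (\<lambda>ns. smul (v ns) 1)"
| conv_family_add: "conv_family N F \<Longrightarrow> conv_family N G \<Longrightarrow> conv_family N (\<lambda>ns. F ns + G ns)"
| conv_family_raise: "conv_family N F \<Longrightarrow> j < N \<Longrightarrow> conv_family N (raise j F)"

lemma smul_one_neq_zero: "smul c (1 :: 'x cpoly) \<noteq> 0 \<longleftrightarrow> c \<noteq> 0"
  using smul_lookup[of c "1 :: 'x cpoly" 0] by (auto simp: lookup_one)

lemma conv_family_supported: "conv_family N F \<Longrightarrow> \<exists>B. supported N B F"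
proof (induction rule: conv_family.induct)
  case (conv_family_const B v)
  then show ?case by (intro exI[of _ B]) (auto simp: supported_def smul_one_neq_zero)
next
  case (conv_family_add F G)
  then obtain A B where "supported N A F" "supported N B G" by blast
  then have "supported N (max A B) F" "supported N (max A B) G" by (auto intro: supported_mono)
  then have "supported N (max A B) (\<lambda>ns. F ns + G ns)"
    unfolding supported_def by (metis add.right_neutral)
  then show ?case by blast
qed (blast intro: supported_raise)

lemma conv_family_zero: "conv_family N (\<lambda>ns. 0)"
  using conv_family_const[of N 0 "\<lambda>_. 0"] by (simp add: supported_def)

lemma conv_family_sum:
  "(\<And>a. a \<in> A \<Longrightarrow> conv_family N (F a)) \<Longrightarrow> conv_family N (\<lambda>ns. \<Sum>a\<in>A. F a ns)"
  by (induction A rule: infinite_finite_induct) (auto intro: conv_family_zero conv_family_add)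

lemma raise_uminus: "raise j (\<lambda>ns. - F ns) = (\<lambda>ns. - raise j F ns)"
  by (auto simp: raise_def sum_negf)

lemma conv_family_uminus: "conv_family N F \<Longrightarrow> conv_family N (\<lambda>ns. - F ns)"
proof (induction rule: conv_family.induct)
  case (conv_family_const B v)
  then have "conv_family N (\<lambda>ns. smul (- v ns) 1)"
    by (intro conv_family.conv_family_const[of _ B]) (auto simp: supported_def)
  then show ?case by (simp add: smul_uminus)
next
  case (conv_family_add F G)
  then show ?case using conv_family.conv_family_add[OF conv_family_add.IH] by simp
next
  case (conv_family_raise F j)
  then show ?case using conv_family.conv_family_raise[OF conv_family_raise.IH] by (simp add: raise_uminus)
qed

lemma conv_family_diff: "conv_family N F \<Longrightarrow> conv_family N G \<Longrightarrow> conv_family N (\<lambda>ns. F ns - G ns)"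
  using conv_family_add[OF _ conv_family_uminus, of N F G] by simp

lemma raise_bump: "raise j (\<lambda>ns. F (bump a i ns)) = (\<lambda>ns. raise j F (bump a i ns))"
  by (rule ext) (simp add: raise_def bump_commute[of a i])

lemma conv_family_bump: "conv_family N F \<Longrightarrow> a < N \<Longrightarrow> conv_family N (\<lambda>ns. F (bump a i ns))"
proof (induction rule: conv_family.induct)
  case (conv_family_const B v)
  then show ?case by (intro conv_family.conv_family_const[of _ B] supported_bump)
next
  case (conv_family_raise F j)
  then show ?case using conv_family.conv_family_raise[of N "\<lambda>ns. F (bump a i ns)" j] by (simp add: raise_bump)
qed (auto intro: conv_family.conv_family_add)

lemma raise_add:
  assumes "conv_family N F" "conv_family N G" "j < N"
  shows "raise j (\<lambda>ns. F ns + G ns) = (\<lambda>ns. raise j F ns + raise j G ns)"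
proof
  fix ns
  obtain A B where "supported N A F" "supported N B G" using assms conv_family_supported by blast
  then have "supported N (max A B) F" "supported N (max A B) G" by (auto intro: supported_mono)
  moreover from this have "supported N (max A B) (\<lambda>ns. F ns + G ns)"
    unfolding supported_def by (metis add.right_neutral)
  ultimately show "raise j (\<lambda>ns. F ns + G ns) ns = raise j F ns + raise j G ns"
    by (simp add: raise_eq[OF _ assms(3)] distrib_left sum.distrib)
qed

lemma raise_diff:
  assumes "conv_family N F" "conv_family N G" "j < N"
  shows "raise j (\<lambda>ns. F ns - G ns) = (\<lambda>ns. raise j F ns - raise j G ns)"
  using raise_add[OF assms(1) conv_family_uminus[OF assms(2)] assms(3)] by (simp add: raise_uminus)

text \<open>
  For constants, the recursion \<open>G(\<dots>, n\<^sub>b + 1, \<dots>) = G(\<dots>, n\<^sub>a + 1, \<dots>) + F(\<dots>)\<close> is solved along the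
  antidiagonals of \<open>(n\<^sub>a, n\<^sub>b)\<close>, starting with \<open>0\<close> at \<open>n\<^sub>b = 0\<close>; the support grows by one step at most. As
  \<open>raise\<close> commutes with the shifts, surjectivity passes to all other families.
\<close>

lemma shift_difference_surj:
  assumes "conv_family N F" "a < N" "b < N" "a \<noteq> b"
  shows "\<exists>G. conv_family N G \<and> F = (\<lambda>ns. G (bump b 1 ns) - G (bump a 1 ns))"
  using assms(1)
proof (induction rule: conv_family.induct)
  case (conv_family_const B v)
  \<comment> \<open>solution along the antidiagonal through \<open>ns\<close>: move \<open>1, 2, \<dots>\<close> units from entry \<open>b\<close> to entry \<open>a\<close>, after lowering \<open>b\<close> by one\<close>
  define w where "w ns = (if length ns = N then \<Sum>k<ns ! b. v (bump a k (ns[b := ns ! b - 1 - k])) else 0)" for ns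
  have "supported N (Suc B) w"
    unfolding supported_def
  proof (intro allI impI)
    fix ns assume ns: "w ns \<noteq> 0"
    then have len: "length ns = N" by (auto simp: w_def split: if_splits)
    from ns obtain k where k: "k < ns ! b" "v (bump a k (ns[b := ns ! b - 1 - k])) \<noteq> 0"
      unfolding w_def by (metis (no_types, lifting) lessThan_iff sum.neutral)
    then have "sum_list (bump a k (ns[b := ns ! b - 1 - k])) < B"
      using conv_family_const unfolding supported_def by blast
    then show "length ns = N \<and> sum_list ns < Suc B"
      using len k(1) assms elem_le_sum_list[of b ns]
      by (simp add: sum_list_bump sum_list_update)
  qed
  then have "conv_family N (\<lambda>ns. smul (w ns) 1)" by (rule conv_family.conv_family_const)
  moreover have "v ns = w (bump b 1 ns) - w (bump a 1 ns)" for ns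
  proof (cases "length ns = N")
    case True
    have "w (bump b 1 ns) = (\<Sum>k<Suc (ns ! b). v (bump a k (ns[b := ns ! b - k])))"
      using True assms by (simp add: w_def bump_def)
    also have "\<dots> = v ns + (\<Sum>k<ns ! b. v (bump a (Suc k) (ns[b := ns ! b - Suc k])))"
      by (subst sum.lessThan_Suc_shift) simp
    also have "(\<Sum>k<ns ! b. v (bump a (Suc k) (ns[b := ns ! b - Suc k]))) = w (bump a 1 ns)"
      using True assms by (simp add: w_def bump_def list_update_swap[of a b])
    finally show ?thesis by simp
  next
    case False
    then show ?thesis using conv_family_const by (auto simp: w_def supported_def)
  qed
  then have "(\<lambda>ns. smul (v ns) 1) = (\<lambda>ns. smul (w (bump b 1 ns)) (1 :: (uv \<times> nat) cpoly) - smul (w (bump a 1 ns)) 1)"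
    by (auto simp: smul_left_add smul_uminus simp flip: diff_conv_add_uminus)
       (metis (no_types, lifting) add_uminus_conv_diff smul_left_add smul_uminus)
  ultimately show ?case by blast
next
  case (conv_family_add F G)
  then obtain F' G' where F': "conv_family N F'" "F = (\<lambda>ns. F' (bump b 1 ns) - F' (bump a 1 ns))"
    and G': "conv_family N G'" "G = (\<lambda>ns. G' (bump b 1 ns) - G' (bump a 1 ns))" by blast
  show ?case
    by (intro exI[of _ "\<lambda>ns. F' ns + G' ns"] conjI conv_family.conv_family_add[OF F'(1) G'(1)] ext)
       (simp add: F'(2) G'(2) add_diff_add)
next
  case (conv_family_raise F j)
  then obtain F' where F': "conv_family N F'" "F = (\<lambda>ns. F' (bump b 1 ns) - F' (bump a 1 ns))" by blast
  have "raise j F = (\<lambda>ns. raise j F' (bump b 1 ns) - raise j F' (bump a 1 ns))"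
    unfolding F'(2) using F'(1) assms conv_family_raise.hyps(2)
    by (subst raise_diff[of N]) (auto intro: conv_family_bump simp: raise_bump)
  then show ?case using conv_family.conv_family_raise[OF F'(1) conv_family_raise.hyps(2)] by blast
qed

text \<open>
  The point is that the \<open>u j\<close> are arbitrary, whereas the \<open>v j\<close> are again of the special form. With \<open>T\<close> the shift
  of the sequence index \<open>i\<close>, the operator \<open>T - S\<^sub>a\<close> removes the \<open>a\<close>-th term, so the induction hypothesis applies to
  \<open>h = (T - S\<^sub>a) f\<close>. Each term of the resulting sum is of the form \<open>(S\<^sub>j - S\<^sub>a) v j\<close> by surjectivity. Subtracting
  the \<open>v j\<close> leaves a sequence killed by \<open>T - S\<^sub>a\<close>, that is, \<open>S\<^sub>a\<^sup>i\<close> applied to its initial term.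
\<close>

lemma vandermonde_splitting:
  assumes "finite J" "J \<subseteq> {..<N}" "\<And>i. conv_family N (f i)" "\<And>i ns. f i ns = (\<Sum>j\<in>J. u j (bump j i ns))"
  shows "\<exists>v. (\<forall>j\<in>J. conv_family N (v j)) \<and> (\<forall>i ns. f i ns = (\<Sum>j\<in>J. v j (bump j i ns)))"
  using assms
proof (induction J arbitrary: f u rule: finite_induct)
  case empty
  then show ?case by auto
next
  case (insert a J)
  have a: "a < N" and J: "J \<subseteq> {..<N}" using insert.prems(1) by auto
  define h where "h i ns = f (Suc i) ns - f i (bump a 1 ns)" for i ns
  have "conv_family N (h i)" for i
    unfolding h_def using insert.prems(2) a by (intro conv_family_diff conv_family_bump)
  moreover have "h i ns = (\<Sum>j\<in>J. (\<lambda>ns. u j (bump j 1 ns) - u j (bump a 1 ns)) (bump j i ns))" for i ns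
    unfolding h_def insert.prems(3) using insert.hyps
    by (simp add: bump_bump bump_commute[of _ _ a] sum_subtractf)
  ultimately obtain w where w: "\<And>j. j \<in> J \<Longrightarrow> conv_family N (w j)" "\<And>i ns. h i ns = (\<Sum>j\<in>J. w j (bump j i ns))"
    using insert.IH[OF J, of h "\<lambda>j ns. u j (bump j 1 ns) - u j (bump a 1 ns)"] by blast
  have "\<exists>G. conv_family N G \<and> w j = (\<lambda>ns. G (bump j 1 ns) - G (bump a 1 ns))" if "j \<in> J" for j
    using that insert.hyps J a by (intro shift_difference_surj w) auto
  then obtain v where v: "\<And>j. j \<in> J \<Longrightarrow> conv_family N (v j)"
    "\<And>j. j \<in> J \<Longrightarrow> w j = (\<lambda>ns. v j (bump j 1 ns) - v j (bump a 1 ns))" by metis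
  define f' where "f' i ns = f i ns - (\<Sum>j\<in>J. v j (bump j i ns))" for i ns
  have step: "f' (Suc i) ns = f' i (bump a 1 ns)" for i ns
  proof -
    have "h i ns = (\<Sum>j\<in>J. v j (bump j (Suc i) ns) - v j (bump j i (bump a 1 ns)))"
      unfolding w(2) using v(2) by (intro sum.cong) (auto simp: bump_bump bump_commute[of _ _ a])
    then show ?thesis by (simp add: f'_def h_def sum_subtractf algebra_simps)
  qed
  have f': "f' i ns = f' 0 (bump a i ns)" for i ns
  proof (induction i arbitrary: ns)
    case (Suc i)
    then show ?case by (simp add: step bump_bump)
  qed simp
  have conv_f': "conv_family N (f' 0)"
    unfolding f'_def using insert.prems(2) v(1) by (auto intro!: conv_family_diff conv_family_sum)
  show ?case
  proof (intro exI[of _ "v(a := f' 0)"] conjI ballI allI)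
    fix j assume "j \<in> insert a J"
    then show "conv_family N ((v(a := f' 0)) j)" using v(1) conv_f' by auto
  next
    fix i ns
    have "(\<Sum>j\<in>J. (v(a := f' 0)) j (bump j i ns)) = (\<Sum>j\<in>J. v j (bump j i ns))"
      using insert.hyps by (intro sum.cong) auto
    then show "f i ns = (\<Sum>j\<in>insert a J. (v(a := f' 0)) j (bump j i ns))"
      using insert.hyps f'[of i ns] by (simp add: f'_def algebra_simps)
  qed
qed


section \<open>The condition on projections of invariants\<close>

text \<open>
  For a polynomial in one pair \<open>s, x\<close> of variables, the analogous condition is that \<open>\<partial>p/\<partial>x\<close> is divisible by \<open>s\<close>;
  it says that \<open>p\<close> is constant at \<open>s = 0\<close>, hence supersymmetric. In the affine version the same \<open>g\<close> serves
  all derivatives.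
\<close>

definition s_divisible :: "(uv \<times> nat) cpoly \<Rightarrow> bool" where
  "s_divisible p \<longleftrightarrow> (\<exists>g L. (\<forall>m\<ge>L. g m = 0) \<and> (\<forall>r. dx r p = (\<Sum>l<L. svar l * g (r + l))))"

definition coords_below :: "nat \<Rightarrow> (uv \<times> nat) cpoly \<Rightarrow> bool" where
  "coords_below M p \<longleftrightarrow> (\<forall>i\<ge>M. ds i p = 0 \<and> dx i p = 0)"

lemma coords_below_deriv: "coords_below M p \<Longrightarrow> coords_below M (ds n p) \<and> coords_below M (dx n p)"
  by (simp add: coords_below_def ds_commute[of _ n] dx_commute[of _ n]
      ds_dx_commute[of _ n p] ds_dx_commute[of n _ p, symmetric])

lemma s_divisible_dx:
  assumes "s_divisible p"
  shows "s_divisible (dx i p)"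
proof -
  obtain g L where g: "\<forall>m\<ge>L. g m = 0" "\<And>r. dx r p = (\<Sum>l<L. svar l * g (r + l))"
    using assms unfolding s_divisible_def by blast
  have "dx r (dx i p) = (\<Sum>l<L. svar l * dx i (g (r + l)))" for r
    unfolding dx_commute[of r] g(2)[of r] by (simp add: dx_sum)
  then show ?thesis
    unfolding s_divisible_def using g(1) by (intro exI[of _ "\<lambda>m. dx i (g m)"] exI[of _ L]) auto
qed

lemma dss_nonzero_entries: "coords_below M p \<Longrightarrow> dss ns p \<noteq> 0 \<Longrightarrow> set ns \<subseteq> {..<M}"
proof (induction ns arbitrary: p)
  case (Cons n ns)
  then have "ds n p \<noteq> 0" by auto
  then have "n < M" using Cons.prems(1) unfolding coords_below_def by (metis not_le)
  then show ?case using Cons coords_below_deriv[of M p n] by auto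
qed simp

lemma xjet_nonzero_entries:
  "coords_below M p \<Longrightarrow> xjet M' d p ns \<noteq> 0 \<Longrightarrow> set ns \<subseteq> {..<M}"
proof (induction d arbitrary: p)
  case 0
  then have "dss ns p \<noteq> 0" by auto
  then show ?case using dss_nonzero_entries 0 by blast
next
  case (Suc d)
  then obtain i where "xjet M' d (dx i p) ns \<noteq> 0"
    by (metis (no_types, lifting) mult_zero_right sum.neutral xjet.simps(2))
  then show ?case using Suc coords_below_deriv by blast
qed

lemma sum_list_bound: "set ns \<subseteq> {..<M} \<Longrightarrow> sum_list ns \<le> length ns * M"
  by (induction ns) auto

lemma xjet_supported:
  assumes "coords_below M p"
  shows "supported N (N * M + 1) (\<lambda>ns. if length ns = N then xjet M' d p ns else 0)"
  unfolding supported_def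
proof (intro allI impI)
  fix ns assume "(if length ns = N then xjet M' d p ns else 0) \<noteq> 0"
  then have "length ns = N" "xjet M' d p ns \<noteq> 0" by (auto split: if_splits)
  then show "length ns = N \<and> sum_list ns < N * M + 1"
    using sum_list_bound[OF xjet_nonzero_entries[OF assms]] by (metis Suc_eq_plus1 less_Suc_eq_le)
qed

text \<open>
  Induction on \<open>d\<close>. By the Leibniz rule the jet \<open>f i\<close> of \<open>\<partial>p/\<partial>x\<^sub>i\<close> equals \<open>\<Sum>j. S\<^sub>j\<^sup>i u\<^sub>j\<close>, where \<open>u\<^sub>j\<close> comes from
  \<open>g\<close> with the \<open>j\<close>-th derivative left out. The induction hypothesis covers the \<open>f i\<close> but says nothing about
  the \<open>u\<^sub>j\<close>, since \<open>g\<close> need not satisfy the condition on \<open>p\<close>; they are replaced by means of the Vandermonde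
  splitting. After that, Euler's recursion for the jet of \<open>p\<close> is a sum of applications of \<open>raise\<close>.
\<close>

lemma xjet_conv_family:
  assumes "s_divisible p" "coords_below M p"
  shows "conv_family N (\<lambda>ns. if length ns = N then xjet M d p ns else 0)"
  using assms
proof (induction d arbitrary: p)
  case 0
  have eq: "(\<lambda>ns. if length ns = N then xjet M 0 p ns else 0) =
      (\<lambda>ns. smul (if length ns = N then const_term (dss ns p) else 0) 1)"
    by auto
  have "supported N (N * M + 1) (\<lambda>ns. if length ns = N then const_term (dss ns p) else 0)"
    using xjet_supported[OF 0(2), of N M 0] unfolding eq supported_def smul_one_neq_zero .
  then show ?case unfolding eq by (rule conv_family_const)
next
  case (Suc d)
  obtain g L where g: "\<And>m. m \<ge> L \<Longrightarrow> g m = 0" "\<And>r. dx r p = (\<Sum>l<L. svar l * g (r + l))"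
    using Suc.prems(1) unfolding s_divisible_def by blast
  define f where "f i ns = (if length ns = N then xjet M d (dx i p) ns else 0)" for i ns
  define u where "u j ns = (if length ns = N then xjet M d (g (ns ! j)) (delete_nth j ns) else 0)" for j ns
  have conv_f: "conv_family N (f i)" for i
    unfolding f_def using Suc s_divisible_dx coords_below_deriv by blast
  have "f i ns = (\<Sum>j<N. u j (bump j i ns))" for i ns
  proof (cases "length ns = N")
    case True
    have "f i ns = (\<Sum>l<L. \<Sum>j<N. if ns ! j = l then xjet M d (g (i + l)) (delete_nth j ns) else 0)"
      using True by (simp add: f_def g(2)[of i] xjet_sum xjet_svar_mult)
    also have "\<dots> = (\<Sum>j<N. \<Sum>l<L. if ns ! j = l then xjet M d (g (i + l)) (delete_nth j ns) else 0)"
      by (rule sum.swap)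
    also have "\<dots> = (\<Sum>j<N. u j (bump j i ns))"
    proof (intro sum.cong refl)
      fix j assume "j \<in> {..<N}"
      then have "u j (bump j i ns) = xjet M d (g (i + ns ! j)) (delete_nth j ns)"
        using True by (simp add: u_def nth_bump delete_nth_bump add.commute)
      moreover have "g (i + ns ! j) = 0" if "\<not> ns ! j < L" using that g(1) by simp
      ultimately show "(\<Sum>l<L. if ns ! j = l then xjet M d (g (i + l)) (delete_nth j ns) else 0) = u j (bump j i ns)"
        by (cases "ns ! j < L") (auto simp: sum.delta)
    qed
    finally show ?thesis .
  qed (simp add: f_def u_def)
  from vandermonde_splitting[OF finite_lessThan subset_refl conv_f this]
  obtain v where v: "\<And>j. j < N \<Longrightarrow> conv_family N (v j)" "\<And>i ns. f i ns = (\<Sum>j<N. v j (bump j i ns))"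
    by (metis lessThan_iff)
  have "\<exists>B. \<forall>j<N. supported N B (v j)"
  proof -
    have "\<forall>j\<in>{..<N}. \<exists>b. supported N b (v j)"
      using v(1) conv_family_supported by auto
    from bchoice[OF this] obtain b where b: "\<And>j. j < N \<Longrightarrow> supported N (b j) (v j)"
      by auto
    have "supported N (\<Sum>j<N. b j) (v j)" if "j < N" for j
      using b[OF that] by (rule supported_mono) (use that in \<open>auto intro: member_le_sum\<close>)
    then show ?thesis by blast
  qed
  then obtain B0 where B0: "\<And>j. j < N \<Longrightarrow> supported N B0 (v j)" by blast
  define B where "B = max M B0"
  have B: "supported N B (v j)" if "j < N" for j
    using B0[OF that] by (rule supported_mono) (simp add: B_def)
  have "(\<lambda>ns. if length ns = N then xjet M (Suc d) p ns else 0) = (\<lambda>ns. \<Sum>j<N. raise j (v j) ns)"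
  proof
    fix ns
    have "(if length ns = N then xjet M (Suc d) p ns else 0) = (\<Sum>i<M. xvar i * f i ns)"
      by (simp add: f_def)
    also have "\<dots> = (\<Sum>i<B. xvar i * f i ns)"
      using Suc.prems(2) by (intro sum.mono_neutral_left) (auto simp: B_def f_def coords_below_def)
    also have "\<dots> = (\<Sum>j<N. raise j (v j) ns)"
      unfolding v(2) sum_distrib_left
      by (subst sum.swap) (simp add: raise_eq[OF B])
    finally show "(if length ns = N then xjet M (Suc d) p ns else 0) = (\<Sum>j<N. raise j (v j) ns)" .
  qed
  moreover have "conv_family N (\<lambda>ns. \<Sum>j<N. raise j (v j) ns)"
    by (rule conv_family_sum) (simp add: conv_family_raise v(1))
  ultimately show ?case by simp
qed


section \<open>Pairing with power series\<close>

definition pair_series :: "nat \<Rightarrow> family \<Rightarrow> (nat \<Rightarrow> (uv \<times> nat) cpoly fps) \<Rightarrow> (uv \<times> nat) cpoly" where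
  "pair_series N F f = (\<Sum>ns | F ns \<noteq> 0. F ns * (\<Prod>j<N. fps_nth (f j) (ns ! j)))"

definition bounded_lists :: "nat \<Rightarrow> nat \<Rightarrow> nat list set" where
  "bounded_lists N B = {ns. length ns = N \<and> sum_list ns < B}"

lemma finite_bounded_lists [simp]: "finite (bounded_lists N B)"
proof (rule finite_subset)
  show "bounded_lists N B \<subseteq> index_lists B N"
    using member_le_sum_list by (fastforce simp: bounded_lists_def index_lists_def)
qed simp

lemma pair_series_superset:
  assumes "finite A" "{ns. F ns \<noteq> 0} \<subseteq> A"
  shows "pair_series N F f = (\<Sum>ns\<in>A. F ns * (\<Prod>j<N. fps_nth (f j) (ns ! j)))"
  unfolding pair_series_def using assms by (intro sum.mono_neutral_left) auto

lemma pair_series_bounded: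
  "supported N B F \<Longrightarrow> pair_series N F f = (\<Sum>ns\<in>bounded_lists N B. F ns * (\<Prod>j<N. fps_nth (f j) (ns ! j)))"
  by (rule pair_series_superset[OF finite_bounded_lists]) (auto simp: supported_def bounded_lists_def)

definition xvar_series :: "(uv \<times> nat) cpoly fps" where "xvar_series = Abs_fps xvar"
definition svar_series :: "(uv \<times> nat) cpoly fps" where "svar_series = Abs_fps svar"

text \<open>
  Substituting \<open>m\<^sub>j = n\<^sub>j + i\<close> turns the sum over \<open>i\<close> into the Cauchy product of \<open>x(z)\<close> with the \<open>j\<close>-th series.
\<close>

lemma pair_series_raise:
  assumes F: "supported N B F" and j: "j < N"
  shows "pair_series N (raise j F) f = pair_series N F (f(j := xvar_series * f j))"
proof -
  define R where "R ns = (\<Prod>k\<in>{..<N} - {j}. fps_nth (f k) (ns ! k))" for ns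
  have prod_f: "(\<Prod>k<N. fps_nth (f k) (ns ! k)) = fps_nth (f j) (ns ! j) * R ns" for ns
    unfolding R_def using j by (subst prod.remove[of _ j]) auto
  have prod_f': "(\<Prod>k<N. fps_nth ((f(j := xvar_series * f j)) k) (ns ! k)) =
      (\<Sum>i\<le>ns ! j. xvar i * fps_nth (f j) (ns ! j - i)) * R ns" for ns
    unfolding R_def using j
    by (subst prod.remove[of _ j]) (auto simp: fps_mult_nth xvar_series_def atLeast0AtMost)
  have R: "R (bump j i ns) = R ns" if "length ns = N" for i ns
    unfolding R_def using that j by (intro prod.cong) (auto simp: nth_bump)
  have "pair_series N (raise j F) f =
      (\<Sum>ns\<in>bounded_lists N B. \<Sum>i<B. xvar i * F (bump j i ns) * (fps_nth (f j) (ns ! j) * R ns))"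
    by (simp add: pair_series_bounded[OF supported_raise[OF F j]] raise_eq[OF F j] prod_f sum_distrib_right)
  also have "\<dots> = (\<Sum>(ns, i)\<in>bounded_lists N B \<times> {..<B}. xvar i * F (bump j i ns) * (fps_nth (f j) (ns ! j) * R ns))"
    by (simp add: sum.cartesian_product)
  also have "\<dots> = (\<Sum>(ns, i)\<in>{(ns, i). ns \<in> bounded_lists N B \<and> i < B \<and> bump j i ns \<in> bounded_lists N B}.
      xvar i * F (bump j i ns) * (fps_nth (f j) (ns ! j) * R ns))"
  proof (rule sum.mono_neutral_right)
    have "F (bump j i ns) = 0" if "bump j i ns \<notin> bounded_lists N B" for i ns
      using F that by (auto simp: supported_def bounded_lists_def)
    then show "\<forall>a\<in>bounded_lists N B \<times> {..<B} -
        {(ns, i). ns \<in> bounded_lists N B \<and> i < B \<and> bump j i ns \<in> bounded_lists N B}.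
        (case a of (ns, i) \<Rightarrow> xvar i * F (bump j i ns) * (fps_nth (f j) (ns ! j) * R ns)) = 0"
      by auto (metis mult_zero_left mult_zero_right)
  qed auto
  also have "\<dots> = (\<Sum>(ms, i)\<in>(SIGMA ms:bounded_lists N B. {..ms ! j}). F ms * (xvar i * fps_nth (f j) (ms ! j - i)) * R ms)"
  proof (rule sum.reindex_bij_witness[of _ "\<lambda>(ms, i). (ms[j := ms ! j - i], i)" "\<lambda>(ns, i). (bump j i ns, i)"])
    show "(case case a of (ns, i) \<Rightarrow> (bump j i ns, i) of (ms, i) \<Rightarrow> (ms[j := ms ! j - i], i)) = a"
      if "a \<in> {(ns, i). ns \<in> bounded_lists N B \<and> i < B \<and> bump j i ns \<in> bounded_lists N B}" for a
      using that j by (auto simp: bounded_lists_def bump_def)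
    show "(case a of (ns, i) \<Rightarrow> (bump j i ns, i)) \<in> (SIGMA ms:bounded_lists N B. {..ms ! j})"
      if "a \<in> {(ns, i). ns \<in> bounded_lists N B \<and> i < B \<and> bump j i ns \<in> bounded_lists N B}" for a
      using that j by (auto simp: bounded_lists_def nth_bump)
    show "(case case a of (ms, i) \<Rightarrow> (ms[j := ms ! j - i], i) of (ns, i) \<Rightarrow> (bump j i ns, i)) = a"
      if "a \<in> (SIGMA ms:bounded_lists N B. {..ms ! j})" for a
      using that j by (auto simp: bounded_lists_def bump_def)
    show "(case a of (ms, i) \<Rightarrow> (ms[j := ms ! j - i], i)) \<in>
        {(ns, i). ns \<in> bounded_lists N B \<and> i < B \<and> bump j i ns \<in> bounded_lists N B}"
      if a: "a \<in> (SIGMA ms:bounded_lists N B. {..ms ! j})" for a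
    proof -
      obtain ms i where a': "a = (ms, i)" "length ms = N" "sum_list ms < B" "i \<le> ms ! j"
        using a by (auto simp: bounded_lists_def)
      then have "bump j i (ms[j := ms ! j - i]) = ms" using j by (simp add: bump_def)
      moreover have "ms ! j \<le> sum_list ms" using a' j by (intro elem_le_sum_list) simp
      ultimately show ?thesis
        using a' j by (auto simp: bounded_lists_def sum_list_update)
    qed
    show "(case case a of (ns, i) \<Rightarrow> (bump j i ns, i) of
          (ms, i) \<Rightarrow> F ms * (xvar i * fps_nth (f j) (ms ! j - i)) * R ms) =
        (case a of (ns, i) \<Rightarrow> xvar i * F (bump j i ns) * (fps_nth (f j) (ns ! j) * R ns))"
      if "a \<in> {(ns, i). ns \<in> bounded_lists N B \<and> i < B \<and> bump j i ns \<in> bounded_lists N B}" for a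
      using that j by (auto simp: bounded_lists_def nth_bump R mult_ac)
  qed
  also have "\<dots> = (\<Sum>ms\<in>bounded_lists N B. \<Sum>i\<le>ms ! j. F ms * (xvar i * fps_nth (f j) (ms ! j - i)) * R ms)"
    by (subst sum.Sigma) auto
  also have "\<dots> = pair_series N F (f(j := xvar_series * f j))"
    unfolding pair_series_bounded[OF F] prod_f'
    by (simp add: sum_distrib_left sum_distrib_right mult.assoc)
  finally show ?thesis .
qed

lemma pair_series_add:
  assumes "supported N B F" "supported N B G"
  shows "pair_series N (\<lambda>ns. F ns + G ns) f = pair_series N F f + pair_series N G f"
proof -
  have "supported N B (\<lambda>ns. F ns + G ns)"
    using assms unfolding supported_def by (metis add.right_neutral)
  then show ?thesis
    by (simp add: pair_series_bounded[OF assms(1)] pair_series_bounded[OF assms(2)]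
        pair_series_bounded distrib_right sum.distrib)
qed


section \<open>The algebra of affine supersymmetric polynomials\<close>

lemma affine_zero: "0 \<in> affine_supersymmetric"
  using generated_subalgebra.smul[OF generated_subalgebra.one, where c = 0]
  by (simp add: affine_supersymmetric_def)

lemma affine_closed:
  "1 \<in> affine_supersymmetric"
  "p \<in> affine_supersymmetric \<Longrightarrow> smul c p \<in> affine_supersymmetric"
  "p \<in> affine_supersymmetric \<Longrightarrow> q \<in> affine_supersymmetric \<Longrightarrow> p + q \<in> affine_supersymmetric"
  "p \<in> affine_supersymmetric \<Longrightarrow> q \<in> affine_supersymmetric \<Longrightarrow> p * q \<in> affine_supersymmetric"
  unfolding affine_supersymmetric_def by (auto intro: generated_subalgebra.intros)

lemma affine_sum: "(\<And>a. a \<in> A \<Longrightarrow> f a \<in> affine_supersymmetric) \<Longrightarrow> sum f A \<in> affine_supersymmetric"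
  by (induction A rule: infinite_finite_induct) (auto intro: affine_zero affine_closed)

lemma affine_prod: "(\<And>a. a \<in> A \<Longrightarrow> f a \<in> affine_supersymmetric) \<Longrightarrow> prod f A \<in> affine_supersymmetric"
  by (induction A rule: infinite_finite_induct) (auto intro: affine_zero affine_closed)

lemma UNIV_uv: "(UNIV :: uv set) = {U, V}"
  using uv.exhaust by auto

lemma subst_poly_uv:
  fixes P :: "uv cpoly"
  assumes "\<kappa> 0 = 0" "finite A" "Poly_Mapping.keys P \<subseteq> A"
  shows "subst_poly \<kappa> f P =
    (\<Sum>m\<in>A. \<kappa> (Poly_Mapping.lookup P m) * (f U ^ Poly_Mapping.lookup m U * f V ^ Poly_Mapping.lookup m V))"
proof -
  have "(\<Prod>x\<in>Poly_Mapping.keys m. f x ^ Poly_Mapping.lookup m x) =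
      f U ^ Poly_Mapping.lookup m U * f V ^ Poly_Mapping.lookup m V" for m :: "uv \<Rightarrow>\<^sub>0 nat"
  proof -
    have "(\<Prod>x\<in>Poly_Mapping.keys m. f x ^ Poly_Mapping.lookup m x) = (\<Prod>x\<in>{U, V}. f x ^ Poly_Mapping.lookup m x)"
    proof (rule prod.mono_neutral_left)
      show "Poly_Mapping.keys m \<subseteq> {U, V}" using UNIV_uv by blast
    qed (auto simp: in_keys_iff)
    then show ?thesis by simp
  qed
  then have "subst_poly \<kappa> f P =
    (\<Sum>m\<in>Poly_Mapping.keys P. \<kappa> (Poly_Mapping.lookup P m) * (f U ^ Poly_Mapping.lookup m U * f V ^ Poly_Mapping.lookup m V))"
    by (simp add: subst_poly_def)
  also have "\<dots> = (\<Sum>m\<in>A. \<kappa> (Poly_Mapping.lookup P m) * (f U ^ Poly_Mapping.lookup m U * f V ^ Poly_Mapping.lookup m V))"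
    using assms by (intro sum.mono_neutral_left) (auto simp: in_keys_iff)
  finally show ?thesis .
qed

text \<open>
  These are the coefficients for the supersymmetric polynomial \<open>(u + v) u\<^sup>k\<close>.
\<close>

lemma coeff_s_x_power_affine: "fps_nth (svar_series * xvar_series ^ k) n \<in> affine_supersymmetric"
proof -
  let ?m1 = "Poly_Mapping.single U (Suc k)" and ?m2 = "Poly_Mapping.single U k + Poly_Mapping.single V (1::nat)"
  define P :: "uv cpoly" where "P = Poly_Mapping.single ?m1 1 + Poly_Mapping.single ?m2 1"
  have ne: "?m1 \<noteq> ?m2"
  proof
    assume "?m1 = ?m2"
    then have "Poly_Mapping.lookup ?m1 V = Poly_Mapping.lookup ?m2 V" by simp
    then show False by (simp add: lookup_add lookup_single)
  qed
  have keys: "Poly_Mapping.keys P \<subseteq> {?m1, ?m2}"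
    unfolding P_def using keys_add[of "Poly_Mapping.single ?m1 1" "Poly_Mapping.single ?m2 1"] by auto
  have fin: "finite {?m1, ?m2}" by simp
  have look: "Poly_Mapping.lookup P ?m1 = 1" "Poly_Mapping.lookup P ?m2 = 1"
    using ne ne[symmetric] by (simp_all add: P_def lookup_add lookup_single del: single_add)
  have val: "subst_poly \<kappa> f P = \<kappa> 1 * (f U + f V) * f U ^ k" if "\<kappa> 0 = 0" for \<kappa> and f :: "uv \<Rightarrow> 'r::comm_ring_1"
    using that ne look
    by (simp add: subst_poly_uv[where \<kappa> = \<kappa> and f = f, OF that fin keys] del: single_add)
       (simp add: lookup_add lookup_single algebra_simps)
  have "subst_t P = 0" unfolding subst_t_def by (subst val) auto
  then have "P \<in> supersymmetric" unfolding supersymmetric_def by (intro CollectI exI[of _ 0]) simp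
  moreover have "subst_series P = svar_series * xvar_series ^ k"
  proof -
    have "Abs_fps (\<lambda>r. cvar (U, r)) + Abs_fps (\<lambda>r. cvar (V, r)) = svar_series"
      by (rule fps_ext) (simp add: svar_series_def svar_def)
    moreover have "Abs_fps (\<lambda>r. cvar (U, r)) = xvar_series"
      by (rule fps_ext) (simp add: xvar_series_def xvar_def)
    ultimately show ?thesis
      unfolding subst_series_def by (subst val) auto
  qed
  ultimately show ?thesis
    unfolding affine_supersymmetric_def by (metis (mono_tags, lifting) CollectI generated_subalgebra.gen)
qed

text \<open>
  The exponents \<open>k\<close> are arbitrary in order to let the induction through: \<open>raise j\<close> increases the \<open>j\<close>-th one.
\<close>

lemma pair_series_affine:
  assumes "conv_family N F"
  shows "pair_series N F (\<lambda>j. svar_series * xvar_series ^ k j) \<in> affine_supersymmetric"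
  using assms
proof (induction arbitrary: k rule: conv_family.induct)
  case (conv_family_const B v)
  have "smul (v ns) 1 * (\<Prod>j<N. fps_nth (svar_series * xvar_series ^ k j) (ns ! j)) \<in> affine_supersymmetric" for ns
    by (intro affine_closed affine_prod coeff_s_x_power_affine)
  then show ?case unfolding pair_series_def by (intro affine_sum)
next
  case (conv_family_add F G)
  obtain A B where "supported N A F" "supported N B G" using conv_family_add conv_family_supported by blast
  then have "supported N (max A B) F" "supported N (max A B) G" by (auto intro: supported_mono)
  then show ?case using conv_family_add.IH by (simp add: pair_series_add affine_closed)
next
  case (conv_family_raise F j)
  obtain B where "supported N B F" using conv_family_raise conv_family_supported by blast
  moreover have "(\<lambda>j. svar_series * xvar_series ^ k j)(j := xvar_series * (svar_series * xvar_series ^ k j)) = (\<lambda>i. svar_series * xvar_series ^ (k(j := Suc (k j))) i)"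
    by (auto simp: mult_ac)
  ultimately show ?case
    using conv_family_raise.IH[of "k(j := Suc (k j))"] conv_family_raise.hyps(2) by (simp add: pair_series_raise)
qed

text \<open>
  Each part of the Taylor expansion is the pairing of a family of jets with copies of the series \<open>s(z)\<close>.
\<close>

lemma s_divisible_imp_affine:
  assumes "s_divisible p"
  shows "p \<in> affine_supersymmetric"
proof -
  obtain M K where MK: "bideg_le M K p" using bideg_le_exists by blast
  have M: "coords_below M p" using bideg_le_bounded[OF MK] by (auto simp: coords_below_def)
  have "taylor_part M N d p \<in> affine_supersymmetric" for N d
  proof -
    let ?F = "\<lambda>ns. if length ns = N then xjet M d p ns else 0"
    have "pair_series N ?F (\<lambda>j. svar_series * xvar_series ^ 0) =
        (\<Sum>ns\<in>index_lists M N. ?F ns * (\<Prod>j<N. fps_nth (svar_series * xvar_series ^ 0) (ns ! j)))"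
      using xjet_nonzero_entries[OF M]
      by (intro pair_series_superset[OF finite_index_lists]) (auto simp: index_lists_def split: if_splits)
    also have "\<dots> = taylor_part M N d p"
      unfolding taylor_part_def
    proof (intro sum.cong refl)
      fix ns assume "ns \<in> index_lists M N"
      then have len: "length ns = N" by (simp add: index_lists_def)
      have "prod_list (map svar ns) = (\<Prod>j<N. svar (ns ! j))"
        using len by (simp add: prod.list_conv_set_nth atLeast0LessThan)
      then show "?F ns * (\<Prod>j<N. fps_nth (svar_series * xvar_series ^ 0) (ns ! j)) = prod_list (map svar ns) * xjet M d p ns"
        using len by (simp add: svar_series_def mult.commute)
    qed
    finally show ?thesis
      using pair_series_affine[OF xjet_conv_family[OF assms M], of N d "\<lambda>_. 0"] by simp
  qed
  then show ?thesis
    by (subst taylor_expansion[OF MK]) (intro affine_sum affine_closed)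
qed


section \<open>Lifting to invariants\<close>

subsection \<open>Generating series of the generators\<close>

definition gen_series :: "idx \<Rightarrow> idx \<Rightarrow> super_sym fps" where
  "gen_series k l = Abs_fps (\<lambda>n. super_gen (k, l, n))"

abbreviation a_series :: "super_sym fps" where "a_series \<equiv> gen_series I1 I1"
abbreviation b_series :: "super_sym fps" where "b_series \<equiv> gen_series I1 I2"
abbreviation c_series :: "super_sym fps" where "c_series \<equiv> gen_series I2 I1"
abbreviation d_series :: "super_sym fps" where "d_series \<equiv> gen_series I2 I2"
abbreviation s_series :: "super_sym fps" where "s_series \<equiv> a_series + d_series"

lemma fps_mult_eq_reverse:
  fixes f g :: "super_sym fps"
  assumes "\<And>i j. fps_nth f i * fps_nth g j = super_smul c (fps_nth g j * fps_nth f i)"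
  shows "fps_nth (f * g) n = super_smul c (fps_nth (g * f) n)"
proof -
  have "fps_nth (f * g) n = (\<Sum>i=0..n. super_smul c (fps_nth g (n - i) * fps_nth f i))"
    by (simp add: fps_mult_nth assms)
  also have "\<dots> = (\<Sum>i=0..n. super_smul c (fps_nth g i * fps_nth f (n - i)))"
    by (rule sum.reindex_bij_witness[of _ "\<lambda>i. n - i" "\<lambda>i. n - i"]) auto
  finally show ?thesis by (simp add: fps_mult_nth super_smul_sum)
qed

lemma gen_series_commute:
  assumes "even ((par k + par l) * (par k' + par l'))"
  shows "gen_series k l * gen_series k' l' = gen_series k' l' * gen_series k l"
proof (rule fps_ext)
  fix n
  have "super_gen (k, l, i) * super_gen (k', l', j) = super_gen (k', l', j) * super_gen (k, l, i)" for i j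
    using assms super_gen_commute[of "(k, l, i)" "(k', l', j)"] by simp
  then show "fps_nth (gen_series k l * gen_series k' l') n = fps_nth (gen_series k' l' * gen_series k l) n"
    by (subst fps_mult_eq_reverse[where c = 1]) (auto simp: gen_series_def)
qed

lemma gen_series_anticommute:
  assumes "odd ((par k + par l) * (par k' + par l'))"
  shows "gen_series k l * gen_series k' l' = - (gen_series k' l' * gen_series k l)"
proof (rule fps_ext)
  fix n
  have "super_gen (k, l, i) * super_gen (k', l', j) = - (super_gen (k', l', j) * super_gen (k, l, i))" for i j
    using assms super_gen_commute[of "(k, l, i)" "(k', l', j)"] by simp
  then show "fps_nth (gen_series k l * gen_series k' l') n = fps_nth (- (gen_series k' l' * gen_series k l)) n"
    by (subst fps_mult_eq_reverse[where c = "-1"]) (auto simp: gen_series_def)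
qed

lemma super_sym_eq_uminus: "p = - p \<Longrightarrow> p = 0" for p :: super_sym
proof -
  assume "p = - p"
  then have "super_smul (1 / 2) (p + p) = 0" by (metis add.right_inverse super_smul_simps(1))
  then have "super_smul (1 / 2 + 1 / 2) p = 0" by (simp only: super_smul_left_add super_smul_simps(4))
  then show "p = 0" by simp
qed

lemma odd_series_sq:
  assumes "odd (par k + par l)"
  shows "gen_series k l * gen_series k l = 0"
proof (rule fps_ext)
  fix n
  have "gen_series k l * gen_series k l = - (gen_series k l * gen_series k l)"
    using assms by (intro gen_series_anticommute) simp
  then have "fps_nth (gen_series k l * gen_series k l) n = - fps_nth (gen_series k l * gen_series k l) n"
    by (metis fps_neg_nth)
  then show "fps_nth (gen_series k l * gen_series k l) n = fps_nth 0 n"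
    using super_sym_eq_uminus by simp
qed

text \<open>
  In closed form this is \<open>s a\<^sup>k - k a\<^sup>k\<^sup>-\<^sup>1 b c\<close>. Since \<open>(b c)\<^sup>2 = 0\<close>, it equals \<open>s (a - b c / s)\<^sup>k\<close> wherever \<open>s\<close> can be
  inverted, and there \<open>a - b c / s\<close> is killed by both odd currents.
\<close>

primrec lift_series :: "nat \<Rightarrow> super_sym fps" where
  "lift_series 0 = s_series"
| "lift_series (Suc k) = a_series * lift_series k - a_series ^ k * (b_series * c_series)"


subsection \<open>Superderivations of power series\<close>

definition map_series :: "('a \<Rightarrow> 'b) \<Rightarrow> 'a fps \<Rightarrow> 'b fps" where
  "map_series h f = Abs_fps (\<lambda>n. h (fps_nth f n))"

lemma map_series_nth [simp]: "fps_nth (map_series h f) n = h (fps_nth f n)"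
  by (simp add: map_series_def)

definition act_series :: "pos \<Rightarrow> super_sym fps \<Rightarrow> super_sym fps" where
  "act_series e = map_series (act_basis e)"

definition twist_series :: "pos \<Rightarrow> super_sym fps \<Rightarrow> super_sym fps" where
  "twist_series e = map_series (super_twist (ppar e))"

lemma act_basis_zero [simp]: "act_basis e 0 = 0"
  using act_basis_smul[of e 0 0] by simp

lemma act_basis_diff: "act_basis e (p - q) = act_basis e p - act_basis e q"
  using act_basis_add[of e "p - q" q] by (simp add: algebra_simps)

lemma act_basis_sum: "act_basis e (sum f A) = (\<Sum>a\<in>A. act_basis e (f a))"
  by (induction A rule: infinite_finite_induct) (auto simp: act_basis_add)

lemma super_twist_simps [simp]:
  "super_twist m 0 = 0" "super_twist m 1 = 1" "super_twist m (p + q) = super_twist m p + super_twist m q"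
proof -
  show "super_twist m 1 = 1"
    by transfer (simp add: super_rel_def super_ideal.zero flip: fmon_Nil, simp add: twist_fmon super_ideal.zero)
qed (transfer, simp add: super_rel_def super_ideal.zero twist_linear)+

lemma super_twist_sum: "super_twist m (sum f A) = (\<Sum>a\<in>A. super_twist m (f a))"
  by (induction A rule: infinite_finite_induct) auto

lemma act_series_simps:
  "act_series e 1 = 0" "act_series e (f + g) = act_series e f + act_series e g"
  "act_series e (f - g) = act_series e f - act_series e g"
  "act_series e (f * g) = act_series e f * g + twist_series e f * act_series e g"
proof -
  show "act_series e 1 = 0" by (rule fps_ext) (simp add: act_series_def act_basis_one)
  show "act_series e (f + g) = act_series e f + act_series e g"
    by (rule fps_ext) (simp add: act_series_def act_basis_add)
  show "act_series e (f - g) = act_series e f - act_series e g"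
    by (rule fps_ext) (simp add: act_series_def act_basis_diff)
  show "act_series e (f * g) = act_series e f * g + twist_series e f * act_series e g"
    by (rule fps_ext)
       (simp only: act_series_def twist_series_def map_series_nth fps_mult_nth fps_add_nth
          act_basis_sum act_basis_mult sum.distrib)
qed

lemma twist_series_simps:
  "twist_series e 1 = 1" "twist_series e (f + g) = twist_series e f + twist_series e g"
  "twist_series e (f * g) = twist_series e f * twist_series e g"
proof -
  show "twist_series e 1 = 1" by (rule fps_ext) (simp add: twist_series_def)
  show "twist_series e (f + g) = twist_series e f + twist_series e g"
    by (rule fps_ext) (simp add: twist_series_def)
  show "twist_series e (f * g) = twist_series e f * twist_series e g"
    by (rule fps_ext)
       (simp only: twist_series_def map_series_nth fps_mult_nth super_twist_sum super_twist_mult)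
qed

lemma twist_gen_series:
  "twist_series e (gen_series k l) =
     (if even (ppar e * (par k + par l)) then gen_series k l else - gen_series k l)"
proof (rule fps_ext)
  fix n
  have "(- 1 :: complex) ^ (ppar e * (par k + par l)) = (if even (ppar e * (par k + par l)) then 1 else - 1)"
    by (rule minus_one_power_iff)
  then show "fps_nth (twist_series e (gen_series k l)) n =
      fps_nth (if even (ppar e * (par k + par l)) then gen_series k l else - gen_series k l) n"
    by (simp add: twist_series_def gen_series_def super_twist_gen del: even_mult_iff even_add)
qed

lemma act_gen_series:
  "act_series (i, j, r) (gen_series k l) =
     fps_X ^ r * ((if k = j then gen_series i l else 0) -
       (if i = l then (if even ((par i + par j) * (par k + par l)) then gen_series k j else - gen_series k j) else 0))"
proof (rule fps_ext)
  fix n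
  have "act_basis (i, j, r) (super_gen (k, l, n)) = ad_super (i, j, r) (k, l, n)"
    by (simp only: act_basis_gen ad_super_def)
  then show "fps_nth (act_series (i, j, r) (gen_series k l)) n =
      fps_nth (fps_X ^ r * ((if k = j then gen_series i l else 0) -
       (if i = l then (if even ((par i + par j) * (par k + par l)) then gen_series k j else - gen_series k j) else 0))) n"
    unfolding act_series_def gen_series_def map_series_nth fps_X_power_mult_nth fps_nth_Abs_fps ad_super_eq
    by (cases i; cases j; cases k; cases l) (simp_all add: not_le)
qed

lemma mult_left_commute_of_commute: "x * y = y * x \<Longrightarrow> x * (y * z) = y * (x * z)" for x :: "'a::semigroup_mult"
  by (metis mult.assoc)

lemma central_series:
  "b_series * a_series = a_series * b_series" "c_series * a_series = a_series * c_series" "d_series * a_series = a_series * d_series"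
  "b_series * d_series = d_series * b_series" "c_series * d_series = d_series * c_series"
  "b_series * (a_series * f) = a_series * (b_series * f)" "c_series * (a_series * f) = a_series * (c_series * f)"
  "d_series * (a_series * f) = a_series * (d_series * f)"
  "b_series * (d_series * f) = d_series * (b_series * f)" "c_series * (d_series * f) = d_series * (c_series * f)"
proof -
  show 1: "b_series * a_series = a_series * b_series" "c_series * a_series = a_series * c_series" "d_series * a_series = a_series * d_series"
    "b_series * d_series = d_series * b_series" "c_series * d_series = d_series * c_series"
    by (rule gen_series_commute, simp)+
  show "b_series * (a_series * f) = a_series * (b_series * f)" "c_series * (a_series * f) = a_series * (c_series * f)"
    "d_series * (a_series * f) = a_series * (d_series * f)"
    "b_series * (d_series * f) = d_series * (b_series * f)" "c_series * (d_series * f) = d_series * (c_series * f)"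
    by (rule mult_left_commute_of_commute, rule 1)+
qed

lemma central_power:
  "b_series * a_series ^ k = a_series ^ k * b_series" "c_series * a_series ^ k = a_series ^ k * c_series"
  "d_series * a_series ^ k = a_series ^ k * d_series"
  "b_series * (a_series ^ k * f) = a_series ^ k * (b_series * f)" "c_series * (a_series ^ k * f) = a_series ^ k * (c_series * f)"
  "d_series * (a_series ^ k * f) = a_series ^ k * (d_series * f)"
  "a_series * a_series ^ k = a_series ^ k * a_series" "a_series * (a_series ^ k * f) = a_series ^ k * (a_series * f)"
proof -
  show 1: "b_series * a_series ^ k = a_series ^ k * b_series" "c_series * a_series ^ k = a_series ^ k * c_series"
    "d_series * a_series ^ k = a_series ^ k * d_series" "a_series * a_series ^ k = a_series ^ k * a_series"
    by (rule power_commuting_commutes[symmetric], rule central_series[symmetric] refl)+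
  show "b_series * (a_series ^ k * f) = a_series ^ k * (b_series * f)" "c_series * (a_series ^ k * f) = a_series ^ k * (c_series * f)"
    "d_series * (a_series ^ k * f) = a_series ^ k * (d_series * f)" "a_series * (a_series ^ k * f) = a_series ^ k * (a_series * f)"
    by (rule mult_left_commute_of_commute, rule 1)+
qed

lemma odd_products:
  "b_series * b_series = 0" "c_series * c_series = 0" "c_series * b_series = - (b_series * c_series)"
  "b_series * (b_series * f) = 0" "c_series * (c_series * f) = 0" "c_series * (b_series * f) = - (b_series * (c_series * f))"
proof -
  show 1: "b_series * b_series = 0" "c_series * c_series = 0" "c_series * b_series = - (b_series * c_series)"
    by (rule odd_series_sq gen_series_anticommute, simp)+
  show "b_series * (b_series * f) = 0" "c_series * (c_series * f) = 0" "c_series * (b_series * f) = - (b_series * (c_series * f))"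
    unfolding mult.assoc[symmetric] 1 by simp_all
qed

lemma odd_mult_lift_series:
  "b_series * lift_series k = a_series ^ k * (s_series * b_series)"
  "c_series * lift_series k = a_series ^ k * (s_series * c_series)"
proof (induction k)
  case 0
  { case 1 then show ?case by (simp add: distrib_left distrib_right central_series) }
  { case 2 then show ?case by (simp add: distrib_left distrib_right central_series) }
next
  case (Suc k)
  { case 1
    have "b_series * lift_series (Suc k) = a_series * (b_series * lift_series k)"
      by (simp add: right_diff_distrib central_series central_power odd_products)
    then show ?case by (simp add: Suc mult.assoc) }
  { case 2
    have "c_series * lift_series (Suc k) = a_series * (c_series * lift_series k)"
      by (simp add: right_diff_distrib central_series central_power odd_products)
    then show ?case by (simp add: Suc mult.assoc) }
qed

lemma fps_X_power_left: "f * (fps_X ^ r * g) = fps_X ^ r * (f * g)" "f * fps_X ^ r = fps_X ^ r * f"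
  for f g :: "super_sym fps"
proof -
  show 1: "f * fps_X ^ r = fps_X ^ r * f" by (rule fps_mult_fps_X_power_commute [symmetric])
  show "f * (fps_X ^ r * g) = fps_X ^ r * (f * g)" by (rule mult_left_commute_of_commute) (rule 1)
qed

lemma twist_a_power: "twist_series e (a_series ^ k) = a_series ^ k"
  by (induction k) (auto simp: twist_series_simps twist_gen_series)

lemma act_a_power_odd:
  "act_series e (a_series ^ k) * (b_series * c_series) = 0"
proof (induction k)
  case (Suc k)
  obtain i j r where e: "e = (i, j, r)" by (cases e)
  have "act_series e a_series * (a_series ^ k * (b_series * c_series)) = 0"
    unfolding e act_gen_series
    by (cases i; cases j)
       (simp_all add: mult.assoc central_series central_power odd_products)
  then show ?case
    using Suc
    by (simp add: act_series_simps twist_gen_series distrib_right mult.assoc)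
qed (simp add: act_series_simps)

text \<open>
  In the induction step for an odd current, the action on the factor \<open>a\<close> and the action on \<open>b c\<close> produce the
  same multiple of \<open>a\<^sup>k s\<close> with opposite signs, and all other terms contain the square of an odd series. An
  even current kills \<open>a\<close> and \<open>b c\<close>.
\<close>

lemma act_lift_series: "act_series e (lift_series k) = 0"
proof (induction k)
  case 0
  obtain i j r where e: "e = (i, j, r)" by (cases e)
  show ?case
    unfolding e by (cases i; cases j) (simp_all add: act_series_simps act_gen_series)
next
  case (Suc k)
  obtain i j r where e: "e = (i, j, r)" by (cases e)
  have "act_series e (lift_series (Suc k)) =
      act_series e a_series * lift_series k - a_series ^ k * act_series e (b_series * c_series)"
    using Suc act_a_power_odd[of e k]
    by (simp add: act_series_simps twist_a_power)
  also have "\<dots> = 0"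
    unfolding e
    by (cases i; cases j)
       (simp_all add: act_series_simps act_gen_series twist_gen_series mult.assoc odd_mult_lift_series
          fps_X_power_left distrib_left distrib_right right_diff_distrib central_series central_power odd_products)
  finally show ?case .
qed

lemma lift_series_invariant: "fps_nth (lift_series k) n \<in> invariants"
proof -
  have "act_basis e (fps_nth (lift_series k) n) = 0" for e
    using act_lift_series[of e k] by (metis act_series_def fps_zero_nth map_series_nth)
  then show ?thesis by (simp add: invariants_iff del: split_paired_All)
qed

lemma proj_series_simps:
  "map_series proj (f + g) = map_series proj f + map_series proj g"
  "map_series proj (f - g) = map_series proj f - map_series proj g"
  "map_series proj (f * g) = map_series proj f * map_series proj g"
  "map_series proj 1 = 1"
proof -
  show "map_series proj (f + g) = map_series proj f + map_series proj g"
    "map_series proj (f - g) = map_series proj f - map_series proj g"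
    "map_series proj 1 = 1"
    by (rule fps_ext, simp)+
  show "map_series proj (f * g) = map_series proj f * map_series proj g"
    by (rule fps_ext) (simp only: map_series_nth fps_mult_nth proj_sum proj_simps)
qed

lemma proj_lift_series: "map_series proj (lift_series k) = svar_series * xvar_series ^ k"
proof (induction k)
  case 0
  show ?case
    by (rule fps_ext) (simp add: gen_series_def svar_series_def svar_def)
next
  case (Suc k)
  have "map_series proj b_series = 0" "map_series proj a_series = xvar_series"
    by (rule fps_ext, simp add: gen_series_def xvar_series_def xvar_def)+
  then show ?case by (simp add: proj_series_simps Suc mult.left_commute)
qed


section \<open>Every affine supersymmetric polynomial lifts\<close>

lemma invariants_closed:
  "1 \<in> invariants" "0 \<in> invariants"
  "p \<in> invariants \<Longrightarrow> q \<in> invariants \<Longrightarrow> p + q \<in> invariants"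
  "p \<in> invariants \<Longrightarrow> q \<in> invariants \<Longrightarrow> p - q \<in> invariants"
  "p \<in> invariants \<Longrightarrow> q \<in> invariants \<Longrightarrow> p * q \<in> invariants"
  "p \<in> invariants \<Longrightarrow> super_smul c p \<in> invariants"
  by (simp_all add: invariants_iff act_basis_one act_basis_add act_basis_diff act_basis_mult act_basis_smul
      del: split_paired_All)

definition liftable :: "(uv \<times> nat) cpoly set" where
  "liftable = proj ` invariants"

lemma liftable_closed:
  "1 \<in> liftable" "0 \<in> liftable"
  "p \<in> liftable \<Longrightarrow> q \<in> liftable \<Longrightarrow> p + q \<in> liftable"
  "p \<in> liftable \<Longrightarrow> q \<in> liftable \<Longrightarrow> p - q \<in> liftable"
  "p \<in> liftable \<Longrightarrow> q \<in> liftable \<Longrightarrow> p * q \<in> liftable"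
  "p \<in> liftable \<Longrightarrow> smul c p \<in> liftable"
  unfolding liftable_def
  by (safe, (rule image_eqI[rotated], rule invariants_closed; assumption?; simp)+)

lemma liftable_sum: "(\<And>a. a \<in> A \<Longrightarrow> f a \<in> liftable) \<Longrightarrow> sum f A \<in> liftable"
  by (induction A rule: infinite_finite_induct) (auto intro: liftable_closed)

text \<open>
  Series whose coefficients lift form a ring, so lifting can be discussed for whole series at once.
\<close>

definition liftable_series :: "(uv \<times> nat) cpoly fps set" where
  "liftable_series = {f. \<forall>n. fps_nth f n \<in> liftable}"

lemma liftable_series_closed:
  "0 \<in> liftable_series"
  "f \<in> liftable_series \<Longrightarrow> g \<in> liftable_series \<Longrightarrow> f + g \<in> liftable_series"
  "f \<in> liftable_series \<Longrightarrow> g \<in> liftable_series \<Longrightarrow> f - g \<in> liftable_series"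
  "f \<in> liftable_series \<Longrightarrow> g \<in> liftable_series \<Longrightarrow> f * g \<in> liftable_series"
  by (auto simp: liftable_series_def fps_mult_nth intro!: liftable_closed liftable_sum)

lemma liftable_series_sum: "(\<And>a. a \<in> A \<Longrightarrow> f a \<in> liftable_series) \<Longrightarrow> sum f A \<in> liftable_series"
  by (induction A rule: infinite_finite_induct) (auto intro: liftable_series_closed)

abbreviation const_series :: "complex \<Rightarrow> (uv \<times> nat) cpoly fps" where
  "const_series c \<equiv> fps_const (Poly_Mapping.single 0 c)"

lemma const_series_mult: "f \<in> liftable_series \<Longrightarrow> const_series c * f \<in> liftable_series"
  by (auto simp: liftable_series_def smul_def [symmetric] intro: liftable_closed)

lemma s_x_power_liftable: "svar_series * xvar_series ^ k \<in> liftable_series"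
  unfolding liftable_series_def liftable_def proj_lift_series[symmetric]
  using lift_series_invariant by auto

definition vvar_series :: "(uv \<times> nat) cpoly fps" where "vvar_series = svar_series - xvar_series"

lemma s_monomial_liftable: "svar_series * xvar_series ^ i * vvar_series ^ j \<in> liftable_series"
proof (induction j arbitrary: i)
  case 0
  then show ?case by (simp add: s_x_power_liftable)
next
  case (Suc j)
  have eq: "svar_series * xvar_series ^ i * vvar_series ^ Suc j = svar_series * (svar_series * xvar_series ^ i * vvar_series ^ j) - svar_series * xvar_series ^ Suc i * vvar_series ^ j"
    by (simp add: vvar_series_def algebra_simps)
  have s: "svar_series \<in> liftable_series" using s_x_power_liftable[of 0] by simp
  show ?case
    unfolding eq by (rule liftable_series_closed(3)[OF liftable_series_closed(4)[OF s Suc] Suc])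
qed

text \<open>
  Modulo \<open>s\<close> the series \<open>v\<close> may be replaced by \<open>- x\<close>, one factor at a time, and multiples of \<open>s\<close> lift.
\<close>

lemma monomial_diff_liftable: "xvar_series ^ i * vvar_series ^ j - (- 1) ^ j * xvar_series ^ (i + j) \<in> liftable_series"
proof (induction j arbitrary: i)
  case 0
  then show ?case by (simp add: liftable_series_closed)
next
  case (Suc j)
  have eq: "xvar_series ^ i * vvar_series ^ Suc j - (- 1) ^ Suc j * xvar_series ^ (i + Suc j) =
      svar_series * xvar_series ^ i * vvar_series ^ j - (xvar_series ^ Suc i * vvar_series ^ j - (- 1) ^ j * xvar_series ^ (Suc i + j))"
    by (simp add: vvar_series_def algebra_simps)
  show ?case unfolding eq by (rule liftable_series_closed(3)[OF s_monomial_liftable Suc])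
qed

text \<open>
  Replacing \<open>v\<close> by \<open>- x\<close> changes \<open>P(u(z), v(z))\<close> by something liftable and turns it into the value of
  \<open>P(t, - t)\<close> at \<open>t = x(z)\<close>, which is constant by supersymmetry.
\<close>

lemma subst_series_liftable:
  assumes "P \<in> supersymmetric"
  shows "subst_series P \<in> liftable_series"
proof -
  let ?K = "Poly_Mapping.keys P"
  let ?c = "\<lambda>m. Poly_Mapping.lookup P m"
  let ?i = "\<lambda>m :: uv \<Rightarrow>\<^sub>0 nat. Poly_Mapping.lookup m U" and ?j = "\<lambda>m :: uv \<Rightarrow>\<^sub>0 nat. Poly_Mapping.lookup m V"
  have x: "Abs_fps (\<lambda>r. cvar (U, r)) = xvar_series"
    by (rule fps_ext) (simp add: xvar_series_def xvar_def)
  have v: "Abs_fps (\<lambda>r. cvar (V, r)) = vvar_series"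
    by (rule fps_ext) (simp add: vvar_series_def svar_series_def xvar_series_def xvar_def svar_def)
  have sub: "subst_series P = (\<Sum>m\<in>?K. const_series (?c m) * (xvar_series ^ ?i m * vvar_series ^ ?j m))"
    unfolding subst_series_def by (subst subst_poly_uv[where A = ?K]) (auto simp: x v)
  obtain c where c: "subst_t P = [:c:]" using assms unfolding supersymmetric_def by blast
  have "subst_t P = (\<Sum>m\<in>?K. [:?c m:] * ([:0, 1:] ^ ?i m * (- [:0, 1:]) ^ ?j m))"
    unfolding subst_t_def by (subst subst_poly_uv[where A = ?K]) auto
  also have "\<dots> = (\<Sum>m\<in>?K. monom (?c m * (- 1) ^ ?j m) (?i m + ?j m))"
  proof (intro sum.cong refl)
    fix m
    have "[:0, 1:] ^ i * (- [:0, 1:]) ^ j = monom ((- 1 :: complex) ^ j) (i + j)" for i j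
    proof -
      have "- [:0, 1 :: complex:] = monom (- 1) 1" "[:0, 1 :: complex:] = monom 1 1"
        by (simp_all add: monom_altdef)
      then show ?thesis by (simp only: monom_power mult_monom) simp
    qed
    then show "[:?c m:] * ([:0, 1:] ^ ?i m * (- [:0, 1:]) ^ ?j m) = monom (?c m * (- 1) ^ ?j m) (?i m + ?j m)"
      by (simp add: smult_monom)
  qed
  \<comment> \<open>collecting equal powers of \<open>t\<close> in \<open>P(t, - t)\<close>: all coefficients but the constant one cancel\<close>
  finally have coeffs: "(\<Sum>m | m \<in> ?K \<and> ?i m + ?j m = e. ?c m * (- 1) ^ ?j m) = coeff [:c:] e" for e
    unfolding c by (simp add: coeff_sum sum.inter_filter)
  have const_sum: "const_series (sum f A) = (\<Sum>a\<in>A. const_series (f a))" for f :: "(uv \<Rightarrow>\<^sub>0 nat) \<Rightarrow> complex" and A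
    by (induction A rule: infinite_finite_induct) (auto simp: single_add simp flip: fps_const_add)
  let ?E = "(\<lambda>m. ?i m + ?j m) ` ?K"
  have "(\<Sum>m\<in>?K. const_series (?c m * (- 1) ^ ?j m) * xvar_series ^ (?i m + ?j m)) =
      (\<Sum>e\<in>?E. \<Sum>m | m \<in> ?K \<and> ?i m + ?j m = e. const_series (?c m * (- 1) ^ ?j m) * xvar_series ^ e)"
    by (subst sum.image_gen[where g = "\<lambda>m. ?i m + ?j m"]) (auto intro!: sum.cong)
  also have "\<dots> = (\<Sum>e\<in>?E. const_series (coeff [:c:] e) * xvar_series ^ e)"
    unfolding coeffs[symmetric] const_sum sum_distrib_right ..
  also have "\<dots> \<in> liftable_series"
  proof -
    have "const_series (coeff [:c:] e) * xvar_series ^ e \<in> liftable_series" for e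
    proof (cases e)
      case 0
      have "(1 :: (uv \<times> nat) cpoly fps) \<in> liftable_series"
        by (auto simp: liftable_series_def liftable_closed)
      then show ?thesis using const_series_mult[of 1 c] 0 by simp
    qed (simp add: liftable_series_closed)
    then show ?thesis by (rule liftable_series_sum)
  qed
  finally have part1: "(\<Sum>m\<in>?K. const_series (?c m * (- 1) ^ ?j m) * xvar_series ^ (?i m + ?j m)) \<in> liftable_series" .
  have sign: "const_series (a * (- 1) ^ j) = const_series a * (- 1) ^ j" for a j
    by (induction j) (auto simp: single_uminus simp flip: fps_const_neg)
  have "subst_series P = (\<Sum>m\<in>?K. const_series (?c m) * (xvar_series ^ ?i m * vvar_series ^ ?j m - (- 1) ^ ?j m * xvar_series ^ (?i m + ?j m)))
      + (\<Sum>m\<in>?K. const_series (?c m * (- 1) ^ ?j m) * xvar_series ^ (?i m + ?j m))"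
    unfolding sub sum.distrib[symmetric] by (intro sum.cong refl) (simp add: sign algebra_simps)
  moreover have "(\<Sum>m\<in>A. const_series (?c m) * (xvar_series ^ ?i m * vvar_series ^ ?j m - (- 1) ^ ?j m * xvar_series ^ (?i m + ?j m))) \<in> liftable_series" for A
    by (intro liftable_series_sum const_series_mult monomial_diff_liftable)
  ultimately show ?thesis using part1 by (auto intro: liftable_series_closed)
qed

lemma affine_liftable:
  assumes "p \<in> affine_supersymmetric"
  shows "p \<in> liftable"
  using assms unfolding affine_supersymmetric_def
proof (induction rule: generated_subalgebra.induct)
  case (gen p)
  then show ?case using subst_series_liftable by (auto simp: liftable_series_def)
qed (auto intro: liftable_closed)

theorem theoremB:
  shows "\<exists>f. is_algebra_iso super_smul invariants smul affine_supersymmetric f"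
proof
  have "inj_on proj invariants"
  proof (rule inj_onI)
    fix p q assume "p \<in> invariants" "q \<in> invariants" "proj p = proj q"
    then have "p - q = 0"
      by (intro invariant_proj_zero invariants_closed) simp_all
    then show "p = q" by simp
  qed
  moreover have "proj p \<in> affine_supersymmetric" if "p \<in> invariants" for p
    using invariant_proj_divisible[OF that] by (intro s_divisible_imp_affine) (simp add: s_divisible_def)
  moreover have "affine_supersymmetric \<subseteq> proj ` invariants"
    using affine_liftable unfolding liftable_def by blast
  ultimately have "bij_betw proj invariants affine_supersymmetric"
    unfolding bij_betw_def by blast
  then show "is_algebra_iso super_smul invariants smul affine_supersymmetric proj"
    unfolding is_algebra_iso_def by simp
qed

end
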